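(* Let $P\subset\mathbb N$ be the set of primes, let $\delta=\delta_P$ be the conformal dimension of the prime Gauss IFS, and let $\mu=\mu_P$ be its conformal measure. Let $\psi$ be a doubling dimension function such that $\Psi(r)=r^{-\delta}\psi(r)$ is monotonic. Fix $\lambda>1$. Then $\mathcal H^\psi(\mu)=0$ if the series \[ \sum_{k=1}^\infty \frac{y^{\frac{1-2\delta}{1-\delta}}}{(\log y)^{\frac{\delta}{1-\delta}}}\Big|_{y=\Psi(\lambda^{-k})} \] diverges, and $\mathcal H^\psi(\mu)=\infty$ if it converges. (Convergence or divergence of this series does not depend on the choice of $\lambda>1$.)
   Context: For $E\subset\mathbb N$ and $a\in E$ let $\phi_a(x)=1/(a+x)$ on $[0,1]$. Let $E^*=\bigcup_{n\ge0}E^n$ be the finite words; for $\omega\in E^*$ put $\phi_\omega=\phi_{\omega_1}\circ\cdots\circ\phi_{\omega_{|\omega|}}$, $\|\phi_\omega'\|=\sup_{x\in[0,1]}|\phi_\omega'(x)|$, and the cylinder $[\omega]=\phi_\omega([0,1])$. The coding map $\pi:E^{\mathbb N}\to(0,1)$ is $\pi((a_n))=[0;a_1,a_2,\dots]$ (continued fraction), and $\Lambda_E=\pi(E^{\mathbb N})$. The pressure is $\mathrm P_E(s)=\lim_{n\to\infty}\frac1n\log\sum_{\omega\in E^n}\|\phi_\omega'\|^s$; the system is regular if there is $\delta_E$ with $\mathrm P_E(\delta_E)=0$, and then the conformal measure $\mu_E$ is the unique Borel probability measure on $\Lambda_E$ with $\mu_E(A)=\sum_{a\in E}\int_{\phi_a^{-1}(A)}|\phi_a'(x)|^{\delta_E}\,d\mu_E(x)$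 for all Borel $A\subset[0,1]$. For $E=P$ (primes) this system is regular and $1/2<\delta_P<1$ ($\delta_P\approx0.657$). A dimension function is a continuous increasing $\psi:(0,\infty)\to(0,\infty)$ with $\psi(r)\to0$ as $r\to0$; it is doubling if for every $C_1\ge1$ there is $C_2\ge1$ with $C_2^{-1}\le\psi(x)/\psi(y)\le C_2$ whenever $C_1^{-1}\le x/y\le C_1$. $\mathcal H^\psi$ is the $\psi$-dimensional Hausdorff measure, and for a locally finite Borel measure $\mu$ on $\mathbb R$, $\mathcal H^\psi(\mu)=\inf\{\mathcal H^\psi(A):\mu(\mathbb R\setminus A)=0\}$. *)

theory Defs
  imports "HOL-Analysis.Analysis" "HOL-Computational_Algebra.Primes"
begin

definition gphi :: "nat \<Rightarrow> real \<Rightarrow> real" where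
  "gphi a x = 1 / (real a + x)"

fun gphi_word :: "nat list \<Rightarrow> real \<Rightarrow> real" where
  "gphi_word [] = id"
| "gphi_word (a # w) = gphi a \<circ> gphi_word w"

definition words :: "nat set \<Rightarrow> nat \<Rightarrow> nat list set" where
  "words E n = {w. length w = n \<and> set w \<subseteq> E}"

definition dnorm :: "nat list \<Rightarrow> real" where
  "dnorm w = Sup ((\<lambda>x. \<bar>deriv (gphi_word w) x\<bar>) ` {0..1})"

definition pressure_zero :: "nat set \<Rightarrow> real \<Rightarrow> bool" where
  "pressure_zero E s \<longleftrightarrow>
     (\<forall>n. (\<lambda>w. dnorm w powr s) summable_on words E n) \<and>
     ((\<lambda>n. ln (\<Sum>\<^sub>\<infinity> w\<in>words E n. dnorm w powr s) / real n) \<longlonglongrightarrow> 0)"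

definition cf_code :: "(nat \<Rightarrow> nat) \<Rightarrow> real" where
  "cf_code a = lim (\<lambda>n. gphi_word (map a [0..<n]) 0)"

definition limit_set :: "nat set \<Rightarrow> real set" where
  "limit_set E = {cf_code a | a. \<forall>n. a n \<in> E}"

definition conformal_measure :: "nat set \<Rightarrow> real \<Rightarrow> real measure \<Rightarrow> bool" where
  "conformal_measure E s \<mu> \<longleftrightarrow>
     sets \<mu> = sets borel \<and> emeasure \<mu> (space \<mu>) = 1 \<and>
     (AE x in \<mu>. x \<in> limit_set E) \<and>
     (\<forall>A\<in>sets borel. A \<subseteq> {0..1} \<longrightarrow>
        emeasure \<mu> A = (\<Sum>\<^sub>\<infinity> a\<in>E. \<integral>\<^sup>+ x\<in>{x\<in>{0..1}. gphi a x \<in> A}.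
                          ennreal (\<bar>deriv (gphi a) x\<bar> powr s) \<partial>\<mu>))"

definition dimension_function :: "(real \<Rightarrow> real) \<Rightarrow> bool" where
  "dimension_function \<psi> \<longleftrightarrow>
     continuous_on {0<..} \<psi> \<and> mono_on {0<..} \<psi> \<and> (\<forall>r>0. \<psi> r > 0) \<and>
     (\<psi> \<longlongrightarrow> 0) (at_right 0)"

definition doubling :: "(real \<Rightarrow> real) \<Rightarrow> bool" where
  "doubling \<psi> \<longleftrightarrow>
     (\<forall>C1\<ge>1. \<exists>C2\<ge>1. \<forall>x>0. \<forall>y>0. 1 / C1 \<le> x / y \<and> x / y \<le> C1 \<longrightarrow>
        1 / C2 \<le> \<psi> x / \<psi> y \<and> \<psi> x / \<psi> y \<le> C2)"

text \<open>psi(diam U), with the convention psi(0) = 0 (diameter 0: empty set or a point)\<close>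
definition psi_diam :: "(real \<Rightarrow> real) \<Rightarrow> real set \<Rightarrow> ennreal" where
  "psi_diam \<psi> U = (if diameter U = 0 then 0 else ennreal (\<psi> (diameter U)))"

definition hausdorff_pre :: "(real \<Rightarrow> real) \<Rightarrow> real \<Rightarrow> real set \<Rightarrow> ennreal" where
  "hausdorff_pre \<psi> \<epsilon> A =
     (INF U \<in> {U :: nat \<Rightarrow> real set. A \<subseteq> (\<Union>i. U i) \<and>
                 (\<forall>i. bounded (U i) \<and> diameter (U i) \<le> \<epsilon>)}.
        (\<Sum>i. psi_diam \<psi> (U i)))"

definition hausdorff_psi :: "(real \<Rightarrow> real) \<Rightarrow> real set \<Rightarrow> ennreal" where
  "hausdorff_psi \<psi> A = (SUP \<epsilon> \<in> {0<..}. hausdorff_pre \<psi> \<epsilon> A)"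

definition hausdorff_psi_measure :: "(real \<Rightarrow> real) \<Rightarrow> real measure \<Rightarrow> ennreal" where
  "hausdorff_psi_measure \<psi> \<mu> =
     (INF A \<in> {A. A \<in> sets \<mu> \<and> emeasure \<mu> (UNIV - A) = 0}. hausdorff_psi \<psi> A)"

definition series_term :: "real \<Rightarrow> (real \<Rightarrow> real) \<Rightarrow> real \<Rightarrow> nat \<Rightarrow> real" where
  "series_term d \<Psi> lam k =
     (let y = \<Psi> (lam powr (- real k)) in
      if y > 1 then y powr ((1 - 2 * d) / (1 - d)) / (ln y) powr (d / (1 - d)) else 0)"

text \<open>The series converges: eventually y > 1 (so the terms are defined) and the terms are summable.\<close>
definition series_converges :: "real \<Rightarrow> (real \<Rightarrow> real) \<Rightarrow> real \<Rightarrow> bool" where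
  "series_converges d \<Psi> lam \<longleftrightarrow>
     (\<forall>\<^sub>F k in sequentially. \<Psi> (lam powr (- real k)) > 1) \<and>
     summable (series_term d \<Psi> lam)"

end

theory Submission
  imports Defs
begin

text \<open>
  Write \<open>F q = q powr (1 - \<delta>) / ln q\<close>.  Pulling a set \<open>U\<close> of limit points back along the longest common
  prefix of its digit sequences and bounding the number of primes in short intervals shows
  \<open>\<mu> U \<le> C * diameter U powr \<delta> * F q\<close>, where \<open>q\<close> is the next digit of any chosen point of \<open>U\<close>;
  intervals from \<open>0\<close> to \<open>1 / q\<close> show that this is sharp.  So whether \<open>\<psi>\<close> beats \<open>\<mu>\<close> is
  decided by whether \<open>F\<close> of the \<open>n\<close>-th digit exceeds \<open>\<Psi>\<close> at scale \<open>exp (- c * n)\<close> infinitely often.  By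
  bounded distortion the digits are independent up to a constant and \<open>\<mu> {digit \<ge> N}\<close> is comparable to
  \<open>N powr (1 - 2 * \<delta>) / ln N\<close>, so both Borel--Cantelli lemmas apply, and the series is the sum of these
  probabilities.  Convergence gives infinite Hausdorff measure by the mass distribution principle,
  divergence gives measure zero through the disjoint covers obtained by stopping at the first large digit.
\<close>

section \<open>Chebyshev-type bounds for primes\<close>

lemma leibniz_triangle_dvd_Lcm:
  assumes "m < n" "k \<le> m"
  shows "Suc m * (m choose k) dvd Lcm {1..n::nat}"
  using assms
proof (induction k arbitrary: m)
  case 0
  then show ?case by (auto intro!: dvd_Lcm)
next
  case (Suc k)
  let ?L = "Lcm {1..n::nat}"
  obtain j where m: "m = Suc j" using Suc.prems by (cases m) auto
  have "Suc j * (j choose k) dvd ?L" using Suc m by auto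
  then obtain u where u: "?L = Suc j * (j choose k) * u" by blast
  have "Suc m * (m choose k) dvd ?L" using Suc.IH[of m] Suc.prems by simp
  then obtain v where v: "?L = Suc m * (m choose k) * v" by blast
  have kj: "k \<le> j" using Suc.prems m by auto
  define a b c where "a = real (j choose k)" and "b = real (m choose k)" and "c = real (m choose Suc k)"
  have pos: "a > 0" "b > 0" "c > 0" 
    unfolding a_def b_def c_def of_nat_0_less_iff zero_less_binomial_iff using Suc.prems kj by auto
  have r1: "real (Suc k) * c = real m * a"
    using Suc_times_binomial_eq[of j k] unfolding a_def c_def m
    by (metis mult.commute of_nat_mult)
  have r2: "real (Suc k) * c = real (m - k) * b"
  proof -
    have "Suc k * (m choose Suc k) = (m - k) * (m choose k)"
      using binomial_absorb_comp[of m k] Suc_times_binomial_eq[of j k] unfolding m by (simp add: mult.commute)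
    then show ?thesis unfolding b_def c_def by (metis of_nat_mult)
  qed
  have "c * (real u - real v) * real (Suc m) = real ?L"
  proof -
    have L1: "real ?L = real m * a * u" using arg_cong[OF u, of real] by (simp only: of_nat_mult a_def m)
    have L2: "real ?L = real (Suc m) * b * v" using arg_cong[OF v, of real] by (simp only: of_nat_mult b_def)
    have "real (Suc k) * (c * u) = real ?L" by (metis L1 r1 mult.assoc)
    then have uu: "c * u = real ?L / real (Suc k)" by (metis of_nat_Suc nonzero_mult_div_cancel_left of_nat_neq_0)
    have "real (Suc k) * (c * v) = real (m-k) * (b * v)" by (metis r2 mult.assoc)
    moreover have "real (Suc m) * (b * v) = real ?L" by (metis L2 mult.assoc)
    then have "b * v = real ?L / real (Suc m)" by (metis nonzero_mult_div_cancel_left of_nat_neq_0)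
    ultimately have "real (Suc k) * (c * v) = real (m-k) * (real ?L / real (Suc m))" by simp
    then have "c * v = real (m-k) * (real ?L / real (Suc m)) / real (Suc k)"
      by (metis nonzero_mult_div_cancel_left of_nat_neq_0)
    then have vv: "c * v = real (m-k) * real ?L / (real (Suc m) * real (Suc k))" by simp
    have mk: "real (m - k) = real m - real k" using Suc.prems by (simp add: of_nat_diff)
    have "c * (real u - real v) = real ?L / real (Suc k) - real (m-k) * real ?L / (real (Suc m) * real (Suc k))"
      using uu vv by (simp add: algebra_simps)
    also have "\<dots> = real ?L / real (Suc m)"
      unfolding mk by (simp add: divide_simps) (simp add: algebra_simps)
    finally show ?thesis by simp
  qed
  then have "real_of_int (int ?L) = real_of_int (int (Suc m * (m choose Suc k)) * (int u - int v))"
    by (simp add: c_def algebra_simps)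
  then have "int ?L = int (Suc m * (m choose Suc k)) * (int u - int v)" by (rule of_int_eq_iff[THEN iffD1])
  then have "int (Suc m * (m choose Suc k)) dvd int ?L" by (metis dvd_triv_left)
  then show ?case by (simp only: of_nat_dvd_iff)
qed

lemma binomial_dvd_Lcm:
  assumes "k \<le> n"
  shows "(n choose k) dvd Lcm {1..n::nat}"
proof (cases "k = 0 \<or> n = 0")
  case True
  then show ?thesis using assms by auto
next
  case False
  then obtain m j where n: "n = Suc m" "k = Suc j" by (metis not0_implies_Suc)
  have "Suc m * (m choose j) dvd Lcm {1..n}" using n assms by (intro leibniz_triangle_dvd_Lcm) auto
  moreover have "(n choose k) dvd Suc m * (m choose j)"
    unfolding n by (metis Suc_times_binomial_eq dvd_triv_left)
  ultimately show ?thesis by (rule dvd_trans[rotated])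
qed

lemma prime_power_dvd_lcmD:
  assumes "prime p" "p ^ e dvd lcm a (b::nat)" 
  shows "p ^ e dvd a \<or> p ^ e dvd b"
proof (cases "a = 0 \<or> b = 0")
  case False
  then have "multiplicity p (lcm a b) = max (multiplicity p a) (multiplicity p b)"
    using assms by (intro multiplicity_lcm) auto
  then show ?thesis using assms False
    by (metis lcm_eq_0_iff max_def multiplicity_dvd' multiplicity_geI not_prime_unit power_dvd_iff_le_multiplicity prime_gt_0_nat)
qed auto

lemma prime_power_dvd_LcmD:
  assumes "prime p" "finite A" "p ^ e dvd Lcm (A::nat set)" "e > 0"
  shows "\<exists>a\<in>A. p ^ e dvd a"
  using assms(2,3)
proof (induction A)
  case empty
  then show ?case using assms by simp
next
  case (insert a A)
  then show ?case using prime_power_dvd_lcmD[OF assms(1), of e a "Lcm A"] by auto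
qed

lemma prime_power_dvd_binomial_le:
  assumes "prime p" "k \<le> n" "n > 0" "p ^ e dvd (n choose k)"
  shows "p ^ e \<le> n"
proof (cases "e = 0")
  case False
  have "p ^ e dvd Lcm {1..n}" using assms binomial_dvd_Lcm dvd_trans by blast
  then obtain a where "a \<in> {1..n}" "p ^ e dvd a"
    using prime_power_dvd_LcmD[OF assms(1), of "{1..n}" e] False by blast
  then show ?thesis using dvd_imp_le[of "p ^ e" a] by simp
qed (use assms in auto)

lemma central_binomial_ge: "2 ^ n \<le> (2 * n choose n)"
proof (induction n)
  case (Suc n)
  have a: "Suc n * (2 * Suc n choose Suc n) = (2 * Suc n) * (Suc (2 * n) choose n)"
    using Suc_times_binomial_eq[of "Suc (2*n)" n] by (simp add: mult_ac)
  have "2 * (2 * n choose n) \<le> 2 * (Suc (2*n) choose n)" 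
    by (cases n) auto
  also have "\<dots> = (2 * Suc n choose Suc n)" using a by (metis (no_types, lifting) Suc_neq_Zero mult.assoc mult.left_commute mult_cancel1)
  finally show ?case using Suc by simp
qed simp

lemma central_binomial_le_power_card:
  assumes "n > 0"
  shows "(2 * n choose n) \<le> (2 * n) ^ card {p. prime p \<and> p \<le> 2 * n}"
proof -
  let ?b = "2 * n choose n"
  have b: "?b \<noteq> 0" by (simp add: zero_less_binomial_iff)
  have "?b = (\<Prod>p\<in>prime_factors ?b. p ^ multiplicity p ?b)"
    using prime_factorization_nat[of ?b] b by simp
  also have "\<dots> \<le> (\<Prod>p\<in>prime_factors ?b. 2 * n)"
    using assms by (intro prod_mono) (auto intro!: prime_power_dvd_binomial_le[where k = n] multiplicity_dvd)
  also have "\<dots> = (2 * n) ^ card (prime_factors ?b)" by simp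
  also have "\<dots> \<le> (2 * n) ^ card {p. prime p \<and> p \<le> 2 * n}"
  proof (rule power_increasing)
    have "prime_factors ?b \<subseteq> {p. prime p \<and> p \<le> 2 * n}"
      using prime_power_dvd_binomial_le[where k = n and n = "2*n" and e = 1] assms by auto
    then show "card (prime_factors ?b) \<le> card {p. prime p \<and> p \<le> 2 * n}"
      by (intro card_mono) (auto intro: finite_subset[of _ "{..2*n}"])
  qed (use assms in auto)
  finally show ?thesis .
qed

lemma card_primes_ge:
  assumes "n > 0"
  shows "real n * ln 2 \<le> real (card {p. prime p \<and> p \<le> 2 * n}) * ln (2 * real n)"
proof -
  have "(2::real) ^ n \<le> (2 * real n) ^ card {p. prime p \<and> p \<le> 2 * n}"
    using of_nat_mono[OF order_trans[OF central_binomial_ge central_binomial_le_power_card[OF assms]], where 'a = real]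
    by (simp only: of_nat_mult of_nat_numeral of_nat_power)
  then have "ln ((2::real) ^ n) \<le> ln ((2 * real n) ^ card {p. prime p \<and> p \<le> 2 * n})"
    using assms by (intro ln_mono) auto
  moreover have "ln ((2 * real n) ^ card {p. prime p \<and> p \<le> 2 * n})
      = real (card {p. prime p \<and> p \<le> 2 * n}) * ln (2 * real n)"
    by (rule ln_realpow)
  ultimately show ?thesis by (simp add: ln_realpow)
qed

lemma binomial_le_exp_power:
  assumes "y > 0" "y \<le> n"
  shows "real (n choose y) \<le> (exp 1 * real n / real y) ^ y"
proof -
  have "(real y) ^ y / fact y \<le> exp (real y)"
  proof -
    have "(\<lambda>k. real y ^ k /\<^sub>R fact k) sums exp (real y)" by (rule exp_converges)
    then show ?thesis using sum_le_suminf[of "\<lambda>k. real y ^ k /\<^sub>R fact k" "{y}"]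
      by (simp add: sums_iff divide_inverse mult.commute)
  qed
  then have 1: "real y ^ y \<le> exp 1 ^ y * fact y" by (simp add: field_simps exp_of_nat_mult[symmetric])
  have "real (n choose y) * fact y \<le> real n ^ y"
    using binomial_fact_pow[of n y] by (metis of_nat_fact of_nat_le_iff of_nat_mult of_nat_power)
  then have "real (n choose y) * (real y ^ y) * fact y \<le> real n ^ y * (exp 1 ^ y * fact y)"
    using mult_mono[OF _ 1, of "real (n choose y) * fact y" "real n ^ y"] by (simp add: mult_ac)
  then have "real (n choose y) * (real y ^ y) \<le> real n ^ y * exp 1 ^ y" 
    by (simp add: mult.assoc[symmetric])
  then show ?thesis using assms by (simp add: power_mult_distrib power_divide field_simps)
qed

lemma prod_primes_dvd:
  assumes "finite A" "\<And>p. p \<in> A \<Longrightarrow> prime p" "\<And>p. p \<in> A \<Longrightarrow> p dvd (n::nat)"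
  shows "\<Prod>A dvd n"
  using assms
proof (induction A)
  case (insert a A)
  have "coprime a (\<Prod>A)"
    using insert by (intro prod_coprime_right) (metis insertCI primes_coprime)
  then show ?case using insert by (simp add: divides_mult)
qed simp

lemma card_primes_interval_le:
  assumes "y > 0" "y \<le> x"
  shows "real (card {p. prime p \<and> x < p \<and> p \<le> x + y}) * ln (real x)
           \<le> real y * (1 + ln ((real x + real y) / real y))"
proof -
  let ?A = "{p. prime p \<and> x < p \<and> p \<le> x + y}"
  have fin: "finite ?A" by (rule finite_subset[of _ "{..x+y}"]) auto
  have b: "(x + y choose y) > 0" by simp
  have "\<Prod>?A dvd (x + y choose y)"
  proof (rule prod_primes_dvd[OF fin])
    fix p assume p: "p \<in> ?A"
    then have "p dvd fact (x + y)" by (auto simp: prime_dvd_fact_iff)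
    also have "fact (x + y) = fact y * fact x * (x + y choose y)"
      using binomial_fact_lemma[of y "x + y"] by simp
    finally have "p dvd fact y * fact x * (x + y choose y)" .
    moreover have "\<not> p dvd fact y" "\<not> p dvd fact x" using p assms by (auto simp: prime_dvd_fact_iff)
    ultimately show "p dvd (x + y choose y)" using p by (auto simp: prime_dvd_mult_iff)
  qed auto
  then have "\<Prod>?A \<le> (x + y choose y)" using b by (rule dvd_imp_le)
  moreover have "x ^ card ?A \<le> \<Prod>?A"
    using prod_mono[of ?A "\<lambda>_. x" "\<lambda>p. p"] by simp
  ultimately have "real (x ^ card ?A) \<le> real (x + y choose y)" by linarith
  also have "\<dots> \<le> (exp 1 * real (x + y) / real y) ^ y" using assms by (intro binomial_le_exp_power) auto
  finally have "ln (real x ^ card ?A) \<le> ln ((exp 1 * real (x + y) / real y) ^ y)"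
    using assms by (intro ln_mono) auto
  also have "\<dots> = real y * ln (exp 1 * ((real x + real y) / real y))"
    using assms by (simp add: ln_realpow)
  also have "ln (exp 1 * ((real x + real y) / real y)) = 1 + ln ((real x + real y) / real y)"
    using assms by (subst ln_mult_pos) auto
  finally show ?thesis using assms by (simp add: ln_realpow)
qed

abbreviation primes_between :: "real \<Rightarrow> real \<Rightarrow> nat set" where
  "primes_between Q R \<equiv> {p. prime p \<and> Q \<le> real p \<and> real p < R}"

lemma card_primes_dyadic_le:
  assumes "Q \<ge> (2::real)"
  shows "real (card (primes_between Q (2 * Q))) \<le> 8 * Q / ln Q"
proof -
  define X where "X = nat \<lfloor>Q\<rfloor>"
  have X: "real X \<le> Q" "Q < real X + 1" "X \<ge> 2" using assms unfolding X_def by linarith+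
  let ?A = "{p. prime p \<and> X < p \<and> p \<le> X + X}"
  have fin: "finite ?A" by (rule finite_subset[of _ "{..X+X}"]) auto
  have "primes_between Q (2 * Q) \<subseteq> ?A \<union> {X, 2 * X + 1}"
  proof
    fix p assume "p \<in> primes_between Q (2 * Q)"
    then have p: "prime p" "Q \<le> real p" "real p < 2 * Q" by auto
    then have "real X \<le> real p" "real p < real (2 * X + 2)" using X by auto
    then have "X \<le> p" "p < 2 * X + 2" by linarith+
    then show "p \<in> ?A \<union> {X, 2 * X + 1}" using p by auto
  qed
  then have "card (primes_between Q (2 * Q)) \<le> card (?A \<union> {X, 2 * X + 1})"
    using fin by (intro card_mono) auto
  also have "\<dots> \<le> card ?A + 2" 
    by (rule order_trans[OF card_Un_le]) (simp add: card_insert_if)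
  finally have c: "real (card (primes_between Q (2 * Q))) \<le> real (card ?A) + 2" by simp
  have lX: "ln (real X) > 0" using X by simp
  have lX2: "ln Q \<le> 2 * ln (real X)"
  proof -
    have "Q \<le> real X * real X"
      using X mult_right_mono[of 2 "real X" "real X"] by linarith
    then have "ln Q \<le> ln (real X * real X)" using assms X by (intro ln_mono) auto
    then show ?thesis using X by (simp add: ln_mult)
  qed
  have "real (card ?A) * ln (real X) \<le> real X * (1 + ln ((real X + real X) / real X))"
    using card_primes_interval_le[of X X] X by simp
  also have "(real X + real X) / real X = 2" using X by simp
  also have "real X * (1 + ln 2) \<le> real X * 2" using ln_2_less_1 by (intro mult_left_mono) auto
  finally have a: "real (card ?A) * ln (real X) \<le> 2 * real X" by simp
  have "(real (card ?A) + 2) * ln Q \<le> (real (card ?A) + 2) * (2 * ln (real X))"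
    using lX2 by (intro mult_left_mono) auto
  also have "\<dots> \<le> 4 * real X + 4 * ln (real X)" using a by (simp add: algebra_simps)
  also have "\<dots> \<le> 8 * real X" using ln_le_minus_one[of "real X"] X by simp
  also have "\<dots> \<le> 8 * Q" using X by simp
  finally have "(real (card ?A) + 2) * ln Q \<le> 8 * Q" .
  then have "real (card ?A) + 2 \<le> 8 * Q / ln Q" using assms by (simp add: field_simps)
  then show ?thesis using c by linarith
qed

lemma finite_primes_less [simp]: "finite {p. prime p \<and> real p < R}"
proof (rule finite_subset)
  show "{p. prime p \<and> real p < R} \<subseteq> {..nat \<lceil>R\<rceil>}"
  proof
    fix p assume "p \<in> {p. prime p \<and> real p < R}"
    then have "real p \<le> R" by simp
    then have "real p \<le> real (nat \<lceil>R\<rceil>)" using real_nat_ceiling_ge by (rule order_trans)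
    then show "p \<in> {..nat \<lceil>R\<rceil>}" by simp
  qed
qed simp

lemma finite_primes_between [simp]: "finite (primes_between Q R)"
  by (rule finite_subset[OF _ finite_primes_less[of R]]) auto

lemma sum_primes_tail_le:
  assumes Q: "Q \<ge> (2::real)" and s: "s > 1" and F: "finite F" "\<And>p. p \<in> F \<Longrightarrow> prime p \<and> Q \<le> real p"
  shows "(\<Sum>p\<in>F. real p powr (- s)) \<le> 8 / (1 - 2 powr (1 - s)) * (Q powr (1 - s) / ln Q)"
proof -
  define r where "r = (2::real) powr (1 - s)"
  have r: "0 < r" "r < 1" using s powr_less_mono[of "1-s" 0 "2::real"] by (auto simp: r_def)
  have lQ: "ln Q > 0" using Q by simp
  define K where "K = 8 * (Q powr (1 - s) / ln Q)"
  have K: "K \<ge> 0" using lQ Q by (simp add: K_def)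
  have step: "(\<Sum>p\<in>{p\<in>F. 2^J * Q \<le> real p \<and> real p < 2^(Suc J) * Q}. real p powr (- s)) \<le> K * r ^ J" for J
  proof -
    define V where "V = 2^J * Q"
    have V: "V \<ge> Q" unfolding V_def using Q by (simp add: mult_le_cancel_right1)
    let ?B = "{p\<in>F. 2^J * Q \<le> real p \<and> real p < 2^(Suc J) * Q}"
    have sub: "?B \<subseteq> primes_between V (2 * V)" using F by (auto simp: V_def)
    have "(\<Sum>p\<in>?B. real p powr (- s)) \<le> (\<Sum>p\<in>?B. V powr (-s))"
      using s V Q by (intro sum_mono powr_mono2') (auto simp: V_def)
    also have "\<dots> = real (card ?B) * V powr (-s)" by simp
    also have "\<dots> \<le> real (card (primes_between V (2 * V))) * V powr (-s)"
      using sub by (intro mult_right_mono) (auto intro!: card_mono)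
    also have "\<dots> \<le> (8 * V / ln V) * V powr (-s)"
      using card_primes_dyadic_le[of V] V Q by (intro mult_right_mono) auto
    also have "\<dots> \<le> (8 * V / ln Q) * V powr (-s)"
      using V Q lQ by (intro mult_right_mono divide_left_mono mult_pos_pos) (auto intro!: ln_mono)
    also have "\<dots> = 8 * (V powr (1 - s) / ln Q)"
      using V Q powr_add[of V 1 "-s"] by (simp add: algebra_simps)
    also have "V powr (1 - s) = r ^ J * Q powr (1 - s)"
      unfolding V_def r_def using Q by (simp add: powr_mult powr_realpow[symmetric] powr_powr mult.commute)
    also have "8 * (r ^ J * Q powr (1 - s) / ln Q) = K * r ^ J" by (simp add: K_def)
    finally show ?thesis .
  qed
  have part: "(\<Sum>p\<in>{p\<in>F. real p < 2^J * Q}. real p powr (- s)) \<le> K * (\<Sum>j<J. r ^ j)" for J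
  proof (induction J)
    case 0
    have "{p\<in>F. real p < 2^0 * Q} = {}" using F by force
    then show ?case by (simp only: sum.empty lessThan_0)
  next
    case (Suc J)
    let ?B = "{p\<in>F. real p < 2^J * Q}" and ?C = "{p\<in>F. 2^J * Q \<le> real p \<and> real p < 2^(Suc J) * Q}"
    have eq: "{p\<in>F. real p < 2^(Suc J) * Q} = ?B \<union> ?C"
    proof -
      have "{p\<in>F. real p < W} = {p\<in>F. real p < V} \<union> {p\<in>F. V \<le> real p \<and> real p < W}" if "V \<le> W" for V W
        using that by (auto simp: not_less)
      moreover have "2^J * Q \<le> 2^(Suc J) * Q" using Q by simp
      ultimately show ?thesis by blast
    qed
    have "(\<Sum>p\<in>{p\<in>F. real p < 2^(Suc J) * Q}. real p powr (- s)) =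
       (\<Sum>p\<in>?B. real p powr (- s)) + (\<Sum>p\<in>?C. real p powr (- s))"
      unfolding eq by (rule sum.union_disjoint) (use F in auto)
    also have "\<dots> \<le> K * (\<Sum>j<J. r ^ j) + K * r ^ J" using Suc step by (intro add_mono)
    finally show ?case by (simp add: algebra_simps)
  qed
  obtain J where J: "\<forall>p\<in>F. real p < 2^J * Q"
  proof -
    obtain J where J: "real (Max (insert 1 F)) < 2 ^ J"
      using real_arch_pow[of "2::real" "real (Max (insert 1 F))"] by (metis one_less_numeral_iff semiring_norm(76))
    have "real p < 2^J * Q" if "p \<in> F" for p
    proof -
      have "real p \<le> real (Max (insert 1 F))" using that F by simp
      also have "\<dots> < 2 ^ J" by (rule J)
      also have "\<dots> \<le> 2 ^ J * Q" using Q by simp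
      finally show ?thesis .
    qed
    then show ?thesis using that by blast
  qed
  then have "(\<Sum>p\<in>F. real p powr (- s)) = (\<Sum>p\<in>{p\<in>F. real p < 2^J * Q}. real p powr (- s))"
    by (intro sum.cong) auto
  also have "\<dots> \<le> K * (\<Sum>j<J. r ^ j)" by (rule part)
  also have "\<dots> \<le> K * (1 / (1 - r))"
  proof (rule mult_left_mono[OF _ K])
    have "(\<Sum>j<J. r ^ j) \<le> (\<Sum>j. r ^ j)" using r by (intro sum_le_suminf summable_geometric) auto
    then show "(\<Sum>j<J. r ^ j) \<le> 1 / (1 - r)" using r by (simp add: suminf_geometric)
  qed
  finally show ?thesis by (simp add: K_def r_def field_simps)
qed

lemma card_primes_less_le:
  assumes "X \<ge> (4::real)"
  shows "real (card {p. prime p \<and> real p < X}) \<le> 34 * X / ln X"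
proof -
  define V where "V = sqrt X"
  have V: "V \<ge> 2" "V * V = X" using assms by (auto simp: V_def real_le_rsqrt)
  have lV: "ln V > 0" using V by simp
  have lX: "ln X = 2 * ln V" using V ln_mult_pos[of V V] by simp
  have part: "real (card {p. prime p \<and> real p < 2^J * V}) \<le> V + 8 * (2^J * V) / ln V" for J
  proof (induction J)
    case 0
    have "card {p. prime p \<and> real p < 2^0 * V} \<le> card {1..nat \<lfloor>V\<rfloor>}"
      by (intro card_mono) (auto simp: le_nat_iff le_floor_iff dest: prime_ge_1_nat)
    also have "real \<dots> \<le> V" using V by simp
    finally show ?case using V lV by (auto intro: add_increasing2)
  next
    case (Suc J)
    have "{p. prime p \<and> real p < 2^(Suc J) * V} =
      {p. prime p \<and> real p < 2^J * V} \<union> primes_between (2^J * V) (2 * (2^J * V))"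
      using V by auto
    then have "real (card {p. prime p \<and> real p < 2^(Suc J) * V}) \<le> 
      real (card {p. prime p \<and> real p < 2^J * V}) + real (card (primes_between (2^J * V) (2 * (2^J * V))))"
      using of_nat_mono[OF card_Un_le, where 'a = real] by simp
    also have "\<dots> \<le> (V + 8 * (2^J * V) / ln V) + 8 * (2^J * V) / ln V"
    proof (rule add_mono[OF Suc])
      have VV: "2^J * V \<ge> V" using V by (simp add: mult_le_cancel_right1)
      have "real (card (primes_between (2^J * V) (2 * (2^J * V)))) \<le> 8 * (2^J * V) / ln (2^J * V)"
        using V VV by (intro card_primes_dyadic_le) linarith
      also have "\<dots> \<le> 8 * (2^J * V) / ln V"
      proof (rule divide_left_mono)
        show "ln V \<le> ln (2^J * V)" using V VV by (intro ln_mono) linarith+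
        moreover have "0 < ln V" by (rule lV)
        ultimately show "0 < ln (2^J * V) * ln V" by simp
      qed (use V in simp)
      finally show "real (card (primes_between (2^J * V) (2 * (2^J * V)))) \<le> 8 * (2^J * V) / ln V" .
    qed
    finally show ?case by (simp add: mult_ac)
  qed
  obtain J0 where J0: "V < 2 ^ J0" using real_arch_pow[of 2] by auto
  define J where "J = (LEAST J. V \<le> 2 ^ J)"
  have J: "V \<le> 2 ^ J" unfolding J_def by (rule LeastI[of _ J0]) (use J0 in auto)
  have "J \<noteq> 0" using J V by (cases J) auto
  then obtain j where j: "J = Suc j" by (cases J) auto
  have "\<not> V \<le> 2 ^ j" using not_less_Least[of j "\<lambda>J. V \<le> 2 ^ J"] j J_def by auto
  then have J2: "2 ^ J \<le> 2 * V" using j by simp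
  have "real (card {p. prime p \<and> real p < X}) \<le> real (card {p. prime p \<and> real p < 2^J * V})"
  proof -
    have "X \<le> 2 ^ J * V" using J V mult_right_mono[of V "2^J" V] by simp
    then show ?thesis by (intro of_nat_mono card_mono) auto
  qed
  also have "\<dots> \<le> V + 8 * (2^J * V) / ln V" by (rule part)
  also have "\<dots> \<le> V + 8 * (2 * X) / ln V"
    using J2 V lV mult_right_mono[OF J2, of V] by (intro add_left_mono divide_right_mono) auto
  finally have "real (card {p. prime p \<and> real p < X}) \<le> V + 8 * (2 * X) / ln V" .
  moreover have "V \<le> X / ln V"
  proof -
    have "V * ln V \<le> V * V" using V lV ln_le_minus_one[of V] by (intro mult_left_mono) auto
    then show ?thesis using lV V by (simp add: field_simps)
  qed
  moreover have "X / ln V + 8 * (2 * X) / ln V = 34 * X / ln X"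
    unfolding lX using lV by (simp add: field_simps)
  ultimately show ?thesis by linarith
qed

lemma card_primes_between_ge:
  assumes "X \<ge> (1000::real)"
  shows "X / ln X \<le> real (card (primes_between X (1000 * X)))"
proof -
  obtain N :: nat where N: "X \<le> real N" "real N \<le> X + 1"
  proof
    show "X \<le> real (nat \<lceil>X\<rceil>)" by (rule real_nat_ceiling_ge)
    show "real (nat \<lceil>X\<rceil>) \<le> X + 1" using assms by linarith
  qed
  define n where "n = 200 * N"
  have n: "200 * X \<le> real n" "real n \<le> 200 * X + 200" "n > 0" 

  proof -
    have "real n = 200 * real N" by (simp add: n_def)
    then show "200 * X \<le> real n" and "real n \<le> 200 * X + 200" using N by simp_all
    have "real N > 0" using N assms by linarith
    then show "n > 0" by (simp add: n_def)
  qed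
  have lX: "ln X > 0" using assms by simp
  have "200 * X * (2/3) \<le> real n * ln 2"
    using n assms ln2_ge_two_thirds by (intro mult_mono) auto
  also have "\<dots> \<le> real (card {p. prime p \<and> p \<le> 2 * n}) * ln (2 * real n)"
    by (rule card_primes_ge) fact
  also have "ln (2 * real n) \<le> ln (X * X)"
  proof -
    have "2 * real n \<le> 1000 * X" using n assms by linarith
    also have "\<dots> \<le> X * X" using assms by (intro mult_right_mono) auto
    finally show ?thesis using n by (intro ln_mono) auto
  qed
  also have "ln (X * X) = 2 * ln X" using assms by (subst ln_mult_pos) auto
  finally have "200 * X * (2/3) \<le> real (card {p. prime p \<and> p \<le> 2 * n}) * (2 * ln X)"
    by (simp add: mult_left_mono)
  then have 1: "66 * X / ln X \<le> real (card {p. prime p \<and> p \<le> 2 * n})"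
    using lX assms by (simp add: field_simps)
  have "{p. prime p \<and> p \<le> 2 * n} \<subseteq> {p. prime p \<and> real p < X} \<union> primes_between X (1000 * X)"
  proof
    fix p assume p: "p \<in> {p. prime p \<and> p \<le> 2 * n}"
    then have "real p \<le> 2 * real n" by (metis (mono_tags) mem_Collect_eq of_nat_le_iff of_nat_mult of_nat_numeral)
    then have "real p < 1000 * X" using n assms by linarith
    then show "p \<in> {p. prime p \<and> real p < X} \<union> primes_between X (1000 * X)" using p by auto
  qed
  then have "card {p. prime p \<and> p \<le> 2 * n} \<le> card ({p. prime p \<and> real p < X} \<union> primes_between X (1000 * X))"
    by (intro card_mono) auto
  also have "\<dots> \<le> card {p. prime p \<and> real p < X} + card (primes_between X (1000 * X))"
    by (rule card_Un_le)
  finally have "real (card {p. prime p \<and> p \<le> 2 * n}) \<le> real (card {p. prime p \<and> real p < X}) + real (card (primes_between X (1000 * X)))"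
    by linarith
  moreover have "real (card {p. prime p \<and> real p < X}) \<le> 34 * X / ln X"
    using assms by (intro card_primes_less_le) auto
  moreover have "X / ln X \<le> 66 * X / ln X - 34 * X / ln X" using lX assms by (simp add: field_simps)
  ultimately show ?thesis using 1 by linarith
qed

lemma sum_primes_between_ge:
  assumes "X \<ge> (1000::real)" "s > 0"
  shows "(2000 * X) powr (- s) * (X / ln X)
     \<le> (\<Sum>p\<in>primes_between X (1000 * X). (real p + 1/2) powr (- s))"
proof -
  have "(2000 * X) powr (- s) * (X / ln X) \<le> (2000 * X) powr (- s) * real (card (primes_between X (1000 * X)))"
    by (intro mult_left_mono card_primes_between_ge assms) auto
  also have "\<dots> = (\<Sum>p\<in>primes_between X (1000 * X). (2000 * X) powr (- s))" by simp
  also have "\<dots> \<le> (\<Sum>p\<in>primes_between X (1000 * X). (real p + 1/2) powr (- s))"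
    using assms by (intro sum_mono powr_mono2') auto
  finally show ?thesis .
qed

lemma sum_primes_unbounded:
  assumes s: "s \<le> 1"
  shows "\<exists>F. finite F \<and> (\<forall>p\<in>F. prime p) \<and> M < (\<Sum>p\<in>F. (real p + 1/2) powr (- s))"
proof -
  define c where "c = 1 / (2000 * ln 1000 :: real)"
  have c: "c > 0" by (simp add: c_def)
  define f where "f p = (real p + 1/2) powr (- s)" for p
  define A where "A J = {p. prime p \<and> real p < 1000 ^ J}" for J :: nat
  have A: "(\<Sum>j<J. c * (1 / real (Suc j))) \<le> sum f (A (Suc J))" for J
  proof (induction J)
    case (Suc J)
    define X where "X = (1000::real) ^ Suc J"
    have X: "X \<ge> 1000" by (simp add: X_def)
    have "c * (1 / real (Suc J)) = (2000 * X) powr (- 1) * (X / ln X)"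
      unfolding powr_minus using X by (simp add: c_def) (simp add: X_def ln_realpow ln_mult field_simps)
    also have "\<dots> \<le> (\<Sum>p\<in>primes_between X (1000 * X). (real p + 1/2) powr (- 1))"
      by (intro sum_primes_between_ge X) simp
    also have "\<dots> \<le> (\<Sum>p\<in>primes_between X (1000 * X). f p)"
      unfolding f_def using s X by (intro sum_mono powr_mono) auto
    finally have 1: "c * (1 / real (Suc J)) \<le> sum f (primes_between X (1000 * X))" .
    have "A (Suc (Suc J)) = A (Suc J) \<union> primes_between X (1000 * X)"
      using X by (auto simp: A_def X_def)
    moreover have "A (Suc J) \<inter> primes_between X (1000 * X) = {}"
      by (auto simp: A_def X_def)
    ultimately have "sum f (A (Suc (Suc J))) = sum f (A (Suc J)) + sum f (primes_between X (1000 * X))"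
      by (simp only:) (rule sum.union_disjoint, auto simp: A_def)
    then show ?case using Suc 1 by simp
  qed (auto simp: f_def intro!: sum_nonneg)
  have "\<exists>J. M < (\<Sum>j<J. c * (1 / real (Suc j)))"
  proof (rule ccontr)
    assume "\<not> ?thesis"
    then have "summable (\<lambda>j. c * (1 / real (Suc j)))"
      using c by (intro bounded_imp_summable[of _ M]) (auto simp: not_less lessThan_Suc_atMost[symmetric] simp del: sum.lessThan_Suc)
    then have "summable (\<lambda>j. 1 / real (Suc j))" using c by (metis less_irrefl summable_cmult_iff)
    then show False using not_summable_harmonic[where 'a=real] by (simp add: summable_Suc_iff[of "\<lambda>n. 1 / real n"] inverse_eq_divide del: of_nat_Suc)
  qed
  then obtain J where "M < sum f (A (Suc J))" using A less_le_trans by blast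
  then show ?thesis unfolding f_def by (intro exI[of _ "A (Suc J)"]) (auto simp: A_def)
qed

lemma powr_over_ln_quasi_mono:
  assumes "s > 0" "2 \<le> V" "V \<le> (q::real)"
  shows "V powr s / ln V \<le> (1 + 1 / (s * ln 2)) * (q powr s / ln q)"
proof -
  define t where "t = q / V"
  have t: "t \<ge> 1" "q = V * t" using assms by (auto simp: t_def)
  have ts: "t powr s \<ge> 1" using t assms by (simp add: ge_one_powr_ge_zero)
  have lV: "ln V \<ge> ln 2" "ln V > 0" using assms by auto
  have lq: "ln q > 0" using assms by simp
  have "ln q = ln V + ln t" unfolding t(2) using assms t by (subst ln_mult_pos) auto
  also have "\<dots> \<le> ln V * t powr s + ln V / ln 2 * (t powr s / s)"
  proof (rule add_mono)
    show "ln V \<le> ln V * t powr s" using ts lV by simp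
    have "ln t \<le> t powr s / s" using t assms by (intro ln_powr_bound) auto
    also have "\<dots> \<le> ln V / ln 2 * (t powr s / s)"
      using mult_right_mono[of 1 "ln V / ln 2" "t powr s / s"] lV assms by simp
    finally show "ln t \<le> ln V / ln 2 * (t powr s / s)" .
  qed
  also have "\<dots> = (1 + 1 / (s * ln 2)) * t powr s * ln V"
    using assms by (simp add: field_simps)
  finally have "V powr s * ln q \<le> V powr s * ((1 + 1 / (s * ln 2)) * t powr s * ln V)"
    by (intro mult_left_mono) auto
  also have "\<dots> = (1 + 1 / (s * ln 2)) * q powr s * ln V"
    unfolding t(2) using assms t by (simp add: powr_mult)
  finally show ?thesis using lV lq by (simp add: divide_simps mult_ac)
qed

text \<open>The binomial bound loses a factor \<open>ln (q / N)\<close> against Brun--Titchmarsh for the primes within \<open>N\<close> of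
  \<open>q\<close>, but this is absorbed by \<open>(q / N) powr (1 - d)\<close>, so no sieve is needed.\<close>
lemma sum_primes_near_le:
  assumes d: "1/2 < d" "d < (1::real)"
  shows "\<exists>C>0. \<forall>D q R. finite D \<longrightarrow> (\<forall>a\<in>D. prime a) \<longrightarrow> q \<in> D \<longrightarrow> (\<exists>a\<in>D. a \<noteq> q) \<longrightarrow>
     (\<forall>a\<in>D. \<bar>1 / real a - 1 / real q\<bar> \<le> R) \<longrightarrow>
     (\<Sum>a\<in>D. real a powr (- 2 * d)) \<le> C * R powr d * (real q powr (1 - d) / ln (real q))"
proof -
  define s where "s = 1 - d"
  have s: "0 < s" using d by (simp add: s_def)
  define C1 where "C1 = 8 / (1 - 2 powr (1 - 2 * d))"
  define C2 where "C2 = 1 + 1 / (s * ln 2)"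
  have C1: "C1 > 0" using d powr_less_mono[of "1 - 2*d" 0 "2::real"] by (auto simp: C1_def)
  have C2: "C2 > 0" using s by (auto simp: C2_def intro!: add_pos_pos)
  define C where "C = 17 * C1 * C2 + 24 * (2 + 1 / s)"
  have C: "C > 0" using C1 C2 s by (auto simp: C_def intro!: add_pos_pos mult_pos_pos)
  have "(\<Sum>a\<in>D. real a powr (- 2 * d)) \<le> C * R powr d * (real q powr s / ln (real q))"
    if D: "finite D" "\<forall>a\<in>D. prime a" "q \<in> D" "\<exists>a\<in>D. a \<noteq> q"
      and R: "\<forall>a\<in>D. \<bar>1 / real a - 1 / real q\<bar> \<le> R" for D q R
  proof -
    have a2: "real a \<ge> 2" if "a \<in> D" for a using D(2) that prime_ge_2_nat[of a] by simp
    then have q2: "real q \<ge> 2" using D(3) by simp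
    have lq: "ln (real q) > 0" using q2 by simp
    define F where "F = real q powr s / ln (real q)"
    have F: "F \<ge> 0" using lq by (simp add: F_def)
    obtain b where b: "b \<in> D" "b \<noteq> q" using D by blast
    have "1 / real b \<noteq> 1 / real q" using b(2) a2[OF b(1)] q2 by simp
    moreover have "\<bar>1 / real b - 1 / real q\<bar> \<le> R" using R b(1) by blast
    ultimately have R0: "R > 0" by linarith
    show ?thesis
    proof (cases "R \<ge> 1 / (16 * real q)")
      case True
      define V where "V = max 2 (1 / (17 * R))"
      have "1 / (17 * R) \<le> real q" using True R0 q2 by (simp add: field_simps)
      then have V: "2 \<le> V" "V \<le> real q" "1 / (17 * R) \<le> V" using q2 by (auto simp: V_def)
      have Va: "V \<le> real a" if "a \<in> D" for a
      proof -
        have "1 / real a \<le> 1 / real q + R" using R[rule_format, OF that] by linarith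
        also have "\<dots> \<le> 17 * R" using True q2 by (simp add: field_simps)
        finally have "1 / (17 * R) \<le> real a" using R0 a2[OF that] by (simp add: field_simps)
        then show ?thesis using a2[OF that] by (simp add: V_def)
      qed
      have tail: "(\<Sum>a\<in>D. real a powr (- (2 * d))) \<le> C1 * (V powr (1 - 2 * d) / ln V)"
        unfolding C1_def by (rule sum_primes_tail_le) (use V Va D d in auto)
      have "V powr (1 - 2 * d) / ln V = V powr (- d) * (V powr s / ln V)"
        by (simp add: s_def powr_add[symmetric])
      also have "\<dots> \<le> V powr (- d) * (C2 * F)"
        unfolding F_def C2_def using V s by (intro mult_left_mono powr_over_ln_quasi_mono) auto
      also have "\<dots> \<le> (17 * R powr d) * (C2 * F)"
      proof (rule mult_right_mono)
        have "V powr (- d) \<le> (1 / (17 * R)) powr (- d)"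
          using V R0 d by (intro powr_mono2') auto
        also have "\<dots> = (17 * R) powr d"
          using R0 powr_divide[of 1 "17 * R" "- d"] powr_minus_divide[of "17 * R" d] by simp
        also have "\<dots> = 17 powr d * R powr d" by (rule powr_mult)
        also have "\<dots> \<le> 17 powr 1 * R powr d" using d by (intro mult_right_mono powr_mono) auto
        finally show "V powr (- d) \<le> 17 * R powr d" by simp
      qed (use C2 F in auto)
      finally have "C1 * (V powr (1 - 2 * d) / ln V) \<le> C1 * ((17 * R powr d) * (C2 * F))"
        using C1 by (intro mult_left_mono) auto
      with tail have "(\<Sum>a\<in>D. real a powr (- (2 * d))) \<le> (17 * C1 * C2) * (R powr d * F)"
        by (simp add: mult_ac)
      also have "\<dots> \<le> C * (R powr d * F)"
        using F s by (intro mult_right_mono) (auto simp: C_def)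
      finally show ?thesis by (simp add: F_def mult_ac)
    next
      case False
      then have R16: "16 * real q * R < 1" using q2 by (simp add: field_simps)
      define N where "N = 16 / 15 * R * (real q)\<^sup>2"
      define M where "M = nat \<lfloor>N\<rfloor>"
      have N0: "N > 0" using R0 q2 by (simp add: N_def)
      have "N * 15 = (16 * real q * R) * real q" by (simp add: N_def power2_eq_square)
      also have "\<dots> \<le> 1 * real q" using R16 by (intro mult_right_mono) auto
      finally have Nq: "15 * N \<le> real q" by simp
      have M: "real M \<le> N" "N < real M + 1" using N0 unfolding M_def by linarith+
      have near: "16 * real q \<le> 17 * real a \<and> \<bar>real a - real q\<bar> \<le> N" if a: "a \<in> D" for a
      proof -
        have 1: "\<bar>1 / real a - 1 / real q\<bar> \<le> R" using R a by blast
        have aq: "real a > 0" "real q > 0" using a2[OF a] q2 by auto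
        have dif: "real q - real a = (1 / real a - 1 / real q) * (real a * real q)" using aq by (simp add: field_simps)
        then have 2: "\<bar>real q - real a\<bar> \<le> R * (real a * real q)"
          using 1 aq by (metis abs_mult abs_of_pos mult_pos_pos mult_right_mono less_imp_le)
        have 3: "16 * (R * (real a * real q)) \<le> real a"
          using mult_right_mono[of "16 * real q * R" 1 "real a"] R16 aq by (simp add: mult_ac)
        have lo: "16 * real q \<le> 17 * real a" and hi: "15 * real a \<le> 16 * real q" using 2 3 by linarith+
        have "R * (real a * real q) \<le> R * ((16 / 15 * real q) * real q)"
          using hi aq R0 by (intro mult_left_mono mult_right_mono) auto
        also have "\<dots> = N" by (simp add: N_def power2_eq_square)
        finally show ?thesis using 2 lo by linarith
      qed
      have nearM: "a \<le> q + M \<and> q \<le> a + M" if "a \<in> D" for a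
      proof -
        have "\<bar>real a - real q\<bar> < real M + 1" using near[OF that] M by linarith
        then have "real a < real (q + M + 1)" "real q < real (a + M + 1)" by auto
        then show ?thesis by linarith
      qed
      have M1: "M \<ge> 1" using nearM[OF b(1)] b(2) by (cases M) auto
      have q15: "15 * M \<le> q" using M Nq by linarith
      define x where "x = q - M - 1"
      define y where "y = 2 * M + 1"
      have xy: "y > 0" "y \<le> x" "x + y = q + M" "q \<le> 2 * x" using M1 q15 by (auto simp: x_def y_def)
      have x0: "real x > 0" using xy by simp
      have "D \<subseteq> {p. prime p \<and> x < p \<and> p \<le> x + y}"
      proof
        fix a assume "a \<in> D"
        then show "a \<in> {p. prime p \<and> x < p \<and> p \<le> x + y}"
          using nearM[of a] D(2) M1 q15 by (auto simp: x_def y_def)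
      qed
      then have "card D \<le> card {p. prime p \<and> x < p \<and> p \<le> x + y}"
        by (intro card_mono) (rule finite_subset[of _ "{..x+y}"], auto)
      then have cD: "real (card D) \<le> real (card {p. prime p \<and> x < p \<and> p \<le> x + y})" by simp
      have lqx: "ln (real q) \<le> 2 * ln (real x)"
      proof -
        have "real q \<le> 2 * real x" using xy(4) by linarith
        also have "\<dots> \<le> real x * real x" using M1 q15 xy by (intro mult_right_mono) auto
        finally have "ln (real q) \<le> ln (real x * real x)" using q2 x0 by (intro ln_mono) auto
        then show ?thesis using x0 by (simp add: ln_mult)
      qed
      define t where "t = real q / N"
      have t: "t \<ge> 1" using Nq N0 q2 by (simp add: t_def)
      have ts: "t powr s \<ge> 1" using t s by (simp add: ge_one_powr_ge_zero)
      have lnt: "1 + ln ((real x + real y) / real y) \<le> (2 + 1 / s) * t powr s"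
      proof -
        have "real x + real y = real q + real M" using xy(3) by linarith
        then have "real x + real y \<le> 2 * real q" using q15 by linarith
        moreover have "N \<le> real y" using M by (simp add: y_def)
        ultimately have "(real x + real y) / real y \<le> 2 * real q / N"
          using N0 by (intro frac_le) auto
        then have "ln ((real x + real y) / real y) \<le> ln (2 * t)"
          using xy x0 by (intro ln_mono) (auto simp: t_def)
        moreover have "ln (2 * t) = ln 2 + ln t" using t by (subst ln_mult_pos) auto
        moreover have "ln t \<le> t powr s / s" using t s by (intro ln_powr_bound) auto
        ultimately have "1 + ln ((real x + real y) / real y) \<le> 2 * 1 + t powr s / s"
          using ln_2_less_1 by linarith
        also have "\<dots> \<le> 2 * t powr s + t powr s / s" using ts by linarith
        finally show ?thesis by (simp add: algebra_simps)
      qed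
      have "real (card D) * ln (real q) \<le> real (card D) * (2 * ln (real x))"
        using lqx by (intro mult_left_mono) auto
      also have "\<dots> \<le> 2 * (real (card {p. prime p \<and> x < p \<and> p \<le> x + y}) * ln (real x))"
        using cD xy x0 by (simp add: mult_right_mono)
      also have "\<dots> \<le> 2 * (real y * (1 + ln ((real x + real y) / real y)))"
        using xy by (intro mult_left_mono card_primes_interval_le) auto
      also have "\<dots> \<le> 2 * ((3 * N) * ((2 + 1 / s) * t powr s))"
      proof -
        have "real y \<le> 3 * N" using M M1 by (simp add: y_def)
        moreover have "0 \<le> 1 + ln ((real x + real y) / real y)" using xy x0 by (intro add_nonneg_nonneg ln_ge_zero) auto
        ultimately show ?thesis using lnt N0 by (intro mult_left_mono mult_mono) auto
      qed
      finally have cl: "real (card D) \<le> 6 * N * ((2 + 1 / s) * t powr s) / ln (real q)"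
        using lq by (simp add: field_simps)
      have "(\<Sum>a\<in>D. real a powr (- 2 * d)) \<le> (\<Sum>a\<in>D. 2 * real q powr (- 2 * d))"
      proof (rule sum_mono)
        fix a assume a: "a \<in> D"
        have "real a powr (- 2 * d) \<le> (16 / 17 * real q) powr (- 2 * d)"
          using near[OF a] d q2 by (intro powr_mono2') auto
        also have "\<dots> = (16 / 17) powr (- 2 * d) * real q powr (- 2 * d)" by (subst powr_mult) simp
        also have "\<dots> \<le> 2 * real q powr (- 2 * d)"
        proof (rule mult_right_mono)
          have "(16 / 17 :: real) powr (- 2 * d) \<le> (16 / 17) powr (- 2)" using d by (intro powr_mono') auto
          also have "\<dots> = (17 / 16)\<^sup>2" by (simp add: powr_minus powr_realpow[symmetric] power_divide)
          also have "\<dots> \<le> 2" by (simp add: power2_eq_square)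
          finally show "(16 / 17 :: real) powr (- 2 * d) \<le> 2" .
        qed auto
        finally show "real a powr (- 2 * d) \<le> 2 * real q powr (- 2 * d)" .
      qed
      also have "\<dots> = real (card D) * (2 * real q powr (- 2 * d))" by simp
      also have "\<dots> \<le> 6 * N * ((2 + 1 / s) * t powr s) / ln (real q) * (2 * real q powr (- 2 * d))"
        by (intro mult_right_mono cl) auto
      also have "\<dots> = 12 * (2 + 1 / s) * (N * t powr s) * real q powr (- 2 * d) / ln (real q)" by simp
      also have "N * t powr s = N powr d * real q powr s"
      proof -
        have "t powr s = real q powr s / N powr s" using N0 by (simp add: t_def powr_divide)
        then have "N powr s * t powr s = real q powr s" using N0 by simp
        moreover have "N = N powr d * N powr s" using N0 by (simp add: powr_add[symmetric] s_def)
        ultimately show ?thesis by (metis mult.assoc)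
      qed
      also have "N powr d = (16 / 15) powr d * R powr d * real q powr (2 * d)"
      proof -
        have "N powr d = (16 / 15) powr d * R powr d * ((real q)\<^sup>2) powr d"
          unfolding N_def by (simp only: powr_mult)
        also have "((real q)\<^sup>2) powr d = real q powr (2 * d)"
          using powr_powr[of "real q" 2 d] q2 by simp
        finally show ?thesis .
      qed
      also have "12 * (2 + 1 / s) * ((16 / 15) powr d * R powr d * real q powr (2 * d) * real q powr s) * real q powr (- 2 * d) / ln (real q)
        = (12 * (16 / 15) powr d * (2 + 1 / s)) * (R powr d * (real q powr (2 * d) * real q powr (- 2 * d)) * real q powr s / ln (real q))"
        by simp
      also have "real q powr (2 * d) * real q powr (- 2 * d) = 1"
        using q2 by (simp add: powr_add[symmetric])
      also have "(12 * (16 / 15) powr d * (2 + 1 / s)) * (R powr d * 1 * real q powr s / ln (real q)) 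
         = (12 * (16 / 15) powr d * (2 + 1 / s)) * (R powr d * F)" by (simp add: F_def)
      also have "\<dots> \<le> (24 * (2 + 1 / s)) * (R powr d * F)"
      proof (rule mult_right_mono)
        have "(16 / 15 :: real) powr d \<le> (16 / 15) powr 1" using d by (intro powr_mono) auto
        then have "(16 / 15 :: real) powr d \<le> 2" by simp
        then show "12 * (16 / 15) powr d * (2 + 1 / s) \<le> 24 * (2 + 1 / s)"
          using s by (intro mult_right_mono) auto
      qed (use F in auto)
      also have "\<dots> \<le> C * (R powr d * F)"
        using F C1 C2 by (intro mult_right_mono) (auto simp: C_def)
      finally show ?thesis by (simp add: F_def mult_ac)
    qed
  qed
  then show ?thesis unfolding s_def using C by (intro exI[of _ C]) blast
qed

section \<open>Inverse branches and the Gauss map\<close>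

definition J :: "real set" where "J = {0<..1/2}"

fun den :: "nat list \<Rightarrow> real \<Rightarrow> real" where
  "den [] x = 1"
| "den (a # w) x = den w x * (real a + gphi_word w x)"

lemma gphi_word_Cons: "gphi_word (a # w) x = 1 / (real a + gphi_word w x)"
  by (simp add: gphi_def)

lemma gphi_in_J: "a \<ge> 2 \<Longrightarrow> x \<ge> 0 \<Longrightarrow> gphi a x \<in> J"
  by (simp add: gphi_def J_def field_simps)

lemma gphi_word_in_J: "set w \<subseteq> {2..} \<Longrightarrow> x \<in> J \<Longrightarrow> gphi_word w x \<in> J"
proof (induction w)
  case (Cons a w)
  then have "gphi_word w x \<in> J" by simp
  then have "0 \<le> gphi_word w x" by (simp add: J_def)
  then show ?case using Cons.prems by (simp add: gphi_in_J)
qed simp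

lemma gphi_word_bounds: "set w \<subseteq> {2..} \<Longrightarrow> 0 \<le> x \<Longrightarrow> x \<le> 1 \<Longrightarrow> 0 \<le> gphi_word w x \<and> gphi_word w x \<le> 1"
proof (induction w)
  case (Cons a w)
  then have "0 \<le> gphi_word w x" by simp
  then have "gphi a (gphi_word w x) \<in> J" using Cons.prems by (intro gphi_in_J) auto
  then show ?case by (simp add: J_def)
qed simp

lemma den_pos: "set w \<subseteq> {2..} \<Longrightarrow> 0 \<le> x \<Longrightarrow> x \<le> 1 \<Longrightarrow> 0 < den w x"
proof (induction w)
  case (Cons a w)
  then have "0 < den w x" "0 \<le> gphi_word w x" "2 \<le> a" using gphi_word_bounds[of w x] by auto
  then show ?case by (auto intro!: mult_pos_pos add_pos_nonneg)
qed simp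

lemma den_ge_power: "set w \<subseteq> {2..} \<Longrightarrow> 0 \<le> x \<Longrightarrow> x \<le> 1 \<Longrightarrow> 2 ^ length w \<le> den w x"
proof (induction w)
  case (Cons a w)
  then have "2 ^ length w \<le> den w x" "0 \<le> gphi_word w x" "2 \<le> real a" using gphi_word_bounds[of w x] by auto
  moreover have "0 < den w x" using Cons.prems den_pos[of w x] by auto
  ultimately have "2 ^ length w * 2 \<le> den w x * (real a + gphi_word w x)" by (intro mult_mono) auto
  then show ?case by simp
qed simp

text \<open>The branches are Moebius maps whose denominator \<open>q + q' * x\<close> satisfies \<open>q' \<le> q\<close>; the second
  inequality makes the induction work.\<close>
lemma gphi_word_moebius:
  assumes "set w \<subseteq> {2..}"
  shows "\<exists>p p' q q'. 0 \<le> p \<and> 0 \<le> p' \<and> 0 < q \<and> 0 \<le> q' \<and> q' \<le> q \<and> p' + q' \<le> p + q \<and>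
    (\<forall>x\<in>{0..1}. den w x = q + q' * x \<and> gphi_word w x = (p + p' * x) / (q + q' * x))"
  using assms
proof (induction w)
  case Nil
  show ?case by (rule exI[of _ 0], rule exI[of _ 1], rule exI[of _ 1], rule exI[of _ 0]) auto
next
  case (Cons a w)
  then obtain p p' q q' where h: "0 \<le> p" "0 \<le> p'" "0 < q" "0 \<le> q'" "q' \<le> q" "p' + q' \<le> p + q"
    and f: "\<And>x. x \<in> {0..1} \<Longrightarrow> den w x = q + q' * x \<and> gphi_word w x = (p + p' * x) / (q + q' * x)" by auto
  have a: "real a \<ge> 2" using Cons.prems by auto
  have aq: "(real a - 1) * q' \<le> (real a - 1) * q" using a h by (intro mult_left_mono) auto
  have 1: "den (a # w) x = (real a * q + p) + (real a * q' + p') * x \<and>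
    gphi_word (a # w) x = (q + q' * x) / ((real a * q + p) + (real a * q' + p') * x)" if x: "x \<in> {0..1}" for x
  proof -
    have pos: "q + q' * x > 0" using h x by (auto intro: add_pos_nonneg)
    have "den (a # w) x = (q + q' * x) * (real a + (p + p' * x) / (q + q' * x))" using f[OF x] by simp
    also have "\<dots> = (real a * q + p) + (real a * q' + p') * x" using pos by (simp add: field_simps)
    finally have d: "den (a # w) x = (real a * q + p) + (real a * q' + p') * x" .
    have "real a + gphi_word w x = ((real a * q + p) + (real a * q' + p') * x) / (q + q' * x)"
      using f[OF x] pos by (simp add: field_simps)
    then have "gphi_word (a # w) x = (q + q' * x) / ((real a * q + p) + (real a * q' + p') * x)"
      unfolding gphi_word_Cons by simp
    then show ?thesis using d by blast
  qed
  have pos: "0 < real a * q + p" using h a by (auto intro!: add_pos_nonneg)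
  show ?case
    by (rule exI[of _ q], rule exI[of _ q'], rule exI[of _ "real a * q + p"], rule exI[of _ "real a * q' + p'"])
       (use 1 h a aq pos in \<open>auto simp: algebra_simps intro: add_pos_nonneg mult_pos_pos\<close>)
qed

lemma den_distortion:
  assumes "set w \<subseteq> {2..}" "0 \<le> x" "x \<le> 1"
  shows "den w 0 \<le> den w x" "den w x \<le> 2 * den w 0"
proof -
  obtain p p' q q' where h: "0 < q" "0 \<le> q'" "q' \<le> q"
    and f: "\<forall>x\<in>{0..1}. den w x = q + q' * x" using gphi_word_moebius[OF assms(1)] by blast
  have "den w 0 = q" "den w x = q + q' * x" using f assms by auto
  moreover have "q' * x \<le> q * 1" using h assms by (intro mult_mono) auto
  moreover have "0 \<le> q' * x" using h assms by simp
  ultimately show "den w 0 \<le> den w x" "den w x \<le> 2 * den w 0" by auto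
qed

lemma gphi_word_diff:
  assumes "set w \<subseteq> {2..}" "0 \<le> x" "x \<le> 1" "0 \<le> y" "y \<le> 1"
  shows "\<bar>gphi_word w x - gphi_word w y\<bar> = \<bar>x - y\<bar> / (den w x * den w y)"
  using assms(1)
proof (induction w)
  case (Cons a w)
  let ?u = "gphi_word w x" and ?v = "gphi_word w y"
  have uv: "0 \<le> ?u" "0 \<le> ?v" using gphi_word_bounds[of w] assms Cons.prems by auto
  have a: "real a \<ge> 2" using Cons.prems by auto
  have d: "den w x > 0" "den w y > 0" using den_pos[of w] assms Cons.prems by auto
  have "gphi_word (a # w) x - gphi_word (a # w) y = (?v - ?u) / ((real a + ?u) * (real a + ?v))"
    unfolding gphi_word_Cons using uv a by (simp add: divide_simps)
  then have "\<bar>gphi_word (a # w) x - gphi_word (a # w) y\<bar> = \<bar>?u - ?v\<bar> / ((real a + ?u) * (real a + ?v))"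
    using uv a by (simp add: abs_mult abs_minus_commute)
  also have "\<bar>?u - ?v\<bar> = \<bar>x - y\<bar> / (den w x * den w y)" using Cons by auto
  finally show ?case by (simp add: mult_ac)
qed simp

lemma gphi_word_diff_le:
  assumes "set w \<subseteq> {2..}" "0 \<le> x" "x \<le> 1" "0 \<le> y" "y \<le> 1"
  shows "\<bar>gphi_word w x - gphi_word w y\<bar> \<le> \<bar>x - y\<bar> / (den w 0)\<^sup>2"
  unfolding gphi_word_diff[OF assms] power2_eq_square
  using den_distortion[of w x] den_distortion[of w y] den_pos[of w 0] assms
  by (intro divide_left_mono mult_mono mult_pos_pos) auto

lemma gphi_word_diff_ge:
  assumes "set w \<subseteq> {2..}" "0 \<le> x" "x \<le> 1" "0 \<le> y" "y \<le> 1"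
  shows "\<bar>x - y\<bar> / (4 * (den w 0)\<^sup>2) \<le> \<bar>gphi_word w x - gphi_word w y\<bar>"
proof -
  have d: "den w 0 > 0" "den w x > 0" "den w y > 0" using den_pos[of w] assms by auto
  have "den w x * den w y \<le> (2 * den w 0) * (2 * den w 0)"
    using den_distortion[of w x] den_distortion[of w y] d assms by (intro mult_mono) auto
  then have "den w x * den w y \<le> 4 * (den w 0)\<^sup>2" by (simp add: power2_eq_square)
  then show ?thesis unfolding gphi_word_diff[OF assms]
    using d by (intro divide_left_mono) auto
qed

lemma den_0_le_prod:
  "set w \<subseteq> {2..} \<Longrightarrow> den w 0 \<le> (prod_list (map real w))\<^sup>2"
proof (induction w)
  case (Cons a w)
  have a: "real a \<ge> 2" using Cons.prems by auto
  have g: "0 \<le> gphi_word w 0" "gphi_word w 0 \<le> 1" using gphi_word_bounds[of w 0] Cons.prems by auto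
  have "real a + gphi_word w 0 \<le> real a * 2" using a g by simp
  also have "\<dots> \<le> real a * real a" using a by (intro mult_left_mono) auto
  finally have "den w 0 * (real a + gphi_word w 0) \<le> (prod_list (map real w))\<^sup>2 * (real a * real a)"
    using Cons a g den_pos[of w 0] by (intro mult_mono) auto
  then show ?case by (simp add: power2_eq_square mult_ac)
qed simp

definition gauss :: "real \<Rightarrow> real" where "gauss x = frac (1 / x)"
definition dig :: "real \<Rightarrow> nat" where "dig x = nat \<lfloor>1 / x\<rfloor>"
abbreviation digit :: "nat \<Rightarrow> real \<Rightarrow> nat" where "digit n x \<equiv> dig ((gauss ^^ n) x)"

definition digs :: "nat \<Rightarrow> real \<Rightarrow> nat list" where "digs n x = map (\<lambda>i. digit i x) [0..<n]"

definition prime_cf :: "real set" where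
  "prime_cf = {x. \<forall>n. (gauss ^^ n) x \<in> J \<and> prime (digit n x)}"

lemma length_digs [simp]: "length (digs n x) = n" by (simp add: digs_def)

lemma digs_0 [simp]: "digs 0 x = []" by (simp add: digs_def)

lemma digs_Suc: "digs (Suc n) x = digs n x @ [digit n x]"
  by (simp add: digs_def)

lemma digs_Suc_Cons: "digs (Suc n) x = dig x # digs n (gauss x)"
  unfolding digs_def by (simp only: upt_conv_Cons[OF zero_less_Suc] map_Suc_upt[symmetric])
    (simp add: funpow_swap1)

lemma gauss_gphi: "x \<in> J \<Longrightarrow> gauss (gphi a x) = x"
proof -
  assume "x \<in> J"
  then have "\<lfloor>x\<rfloor> = 0" by (auto simp: J_def floor_eq_iff)
  then show ?thesis by (simp add: gauss_def gphi_def frac_def)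
qed

lemma dig_gphi: "x \<in> J \<Longrightarrow> dig (gphi a x) = a"
proof -
  assume "x \<in> J"
  then have "\<lfloor>x\<rfloor> = 0" by (auto simp: J_def floor_eq_iff)
  then show ?thesis by (simp add: dig_def gphi_def)
qed

lemma gphi_dig_gauss: "x \<in> J \<Longrightarrow> gphi (dig x) (gauss x) = x"
proof -
  assume "x \<in> J"
  then have x: "x > 0" by (simp add: J_def)
  then have "\<lfloor>1 / x\<rfloor> \<ge> 0" by simp
  then have "real (dig x) + gauss x = 1 / x" by (simp add: dig_def gauss_def frac_def)
  then show ?thesis by (simp add: gphi_def)
qed

lemma funpow_gauss_gphi_word:
  "set w \<subseteq> {2..} \<Longrightarrow> x \<in> J \<Longrightarrow> (gauss ^^ length w) (gphi_word w x) = x \<and> digs (length w) (gphi_word w x) = w"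
proof (induction w)
  case (Cons a w)
  then have "gphi_word w x \<in> J" by (intro gphi_word_in_J) auto
  then show ?case using Cons by (simp add: funpow_Suc_right gauss_gphi dig_gphi digs_Suc_Cons del: funpow.simps)
qed simp

lemma gphi_word_digs:
  "(\<forall>i<n. (gauss ^^ i) x \<in> J) \<Longrightarrow> gphi_word (digs n x) ((gauss ^^ n) x) = x"
proof (induction n arbitrary: x)
  case (Suc n)
  have "\<forall>i<n. (gauss ^^ i) (gauss x) \<in> J"
    using Suc.prems by (metis Suc_less_eq funpow_Suc_right comp_apply)
  then have "gphi_word (digs n (gauss x)) ((gauss ^^ n) (gauss x)) = gauss x" by (rule Suc.IH)
  moreover have "x \<in> J" using Suc.prems by (metis funpow_0 zero_less_Suc)
  ultimately show ?case
    by (simp add: digs_Suc_Cons funpow_Suc_right gphi_dig_gauss del: funpow.simps)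
qed simp

lemma prime_cf_J: "x \<in> prime_cf \<Longrightarrow> (gauss ^^ n) x \<in> J"
  and prime_cf_prime: "x \<in> prime_cf \<Longrightarrow> prime (digit n x)"
  by (auto simp: prime_cf_def)

lemma prime_cf_subset: "prime_cf \<subseteq> J"
  using prime_cf_J[of _ 0] by auto

lemma prime_cf_digs: "x \<in> prime_cf \<Longrightarrow> gphi_word (digs n x) ((gauss ^^ n) x) = x"
  by (rule gphi_word_digs) (auto simp: prime_cf_J)

definition prime_words :: "nat \<Rightarrow> nat list set" where
  "prime_words n = {w. length w = n \<and> (\<forall>a\<in>set w. prime a)}"

lemma prime_words_ge2: "w \<in> prime_words n \<Longrightarrow> set w \<subseteq> {2..}"
  by (auto simp: prime_words_def prime_ge_2_nat)

lemma prime_cf_digs_word: "x \<in> prime_cf \<Longrightarrow> digs n x \<in> prime_words n"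
  by (auto simp: prime_words_def digs_def prime_cf_prime)

lemma measurable_gauss [measurable]: "gauss \<in> borel_measurable borel"
  unfolding gauss_def frac_def by measurable

lemma measurable_dig [measurable]: "dig \<in> measurable borel (count_space UNIV)"
  unfolding dig_def by measurable

lemma measurable_gauss_pow [measurable]: "(gauss ^^ n) \<in> borel_measurable borel"
  by (induction n) (auto intro: measurable_comp[OF _ measurable_gauss, unfolded comp_def] simp: id_def)

lemma measurable_digs [measurable]: "digs n \<in> measurable borel (count_space UNIV)"
proof (induction n)
  case 0
  then show ?case by (simp add: digs_def[abs_def])
next
  case (Suc n)
  then show ?case unfolding digs_Suc[abs_def] by measurable
qed

lemma J_borel [measurable]: "J \<in> sets borel" by (simp add: J_def)

lemma prime_cf_borel [measurable]: "prime_cf \<in> sets borel"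
  unfolding prime_cf_def by measurable

lemma gphi_image: "B \<subseteq> J \<Longrightarrow> gphi a ` B = {x. x > 0 \<and> 1 / x - real a \<in> B}"
  by (force simp: gphi_def J_def image_iff)

lemma gphi_image_borel:
  assumes "B \<in> sets borel" "B \<subseteq> J"
  shows "gphi a ` B \<in> sets borel"
  unfolding gphi_image[OF assms(2)] using assms(1) by measurable

lemma gphi_word_image_borel:
  assumes "set w \<subseteq> {2..}" "B \<in> sets borel" "B \<subseteq> J"
  shows "gphi_word w ` B \<in> sets borel"
  using assms(1)
proof (induction w)
  case (Cons a w)
  have "gphi_word w ` B \<subseteq> J" using gphi_word_in_J[of w] Cons.prems assms by auto
  moreover have "gphi_word w ` B \<in> sets borel" using Cons by auto
  ultimately have "gphi a ` gphi_word w ` B \<in> sets borel" by (intro gphi_image_borel)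
  then show ?case by (simp add: image_image)
qed (use assms in \<open>simp\<close>)

section \<open>The conformal measure\<close>

lemma abs_deriv_gphi:
  assumes "a \<ge> 1" "x \<ge> 0"
  shows "\<bar>deriv (gphi a) x\<bar> powr s = (real a + x) powr (- (2 * s))"
proof -
  have pos: "real a + x > 0" using assms by simp
  have "(gphi a has_real_derivative - (1 / (real a + x)\<^sup>2)) (at x)"
    unfolding gphi_def[abs_def] using pos
    by (auto intro!: derivative_eq_intros simp: power2_eq_square)
  then have "deriv (gphi a) x = - (1 / (real a + x)\<^sup>2)" by (rule DERIV_imp_deriv)
  then have "\<bar>deriv (gphi a) x\<bar> = (real a + x) powr (-2)" 
    using pos by (simp add: powr_neg_numeral)
  then show ?thesis using pos by (simp add: powr_powr)
qed

lemma cf_code_in_J: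
  assumes a: "\<And>n. prime (a n)"
  shows "cf_code a \<in> J"
proof -
  define u where "u n = gphi_word (map a [0..<n]) 0" for n
  have ge2: "a n \<ge> 2" for n using a prime_ge_2_nat by blast
  have wd: "set (map a [m..<n]) \<subseteq> {2..}" for m n using ge2 by auto
  have app: "gphi_word (v @ w) x = gphi_word v (gphi_word w x)" for v w x
    by (induction v) auto
  have dist: "\<bar>u m - u n\<bar> \<le> (1/4) ^ m" if "m \<le> n" for m n
  proof -
    let ?y = "gphi_word (map a [m..<n]) 0"
    have "u n = gphi_word (map a [0..<m]) ?y"
      unfolding u_def using that by (metis app le_add_diff_inverse map_append upt_add_eq_append zero_le)
    moreover have y: "0 \<le> ?y" "?y \<le> 1" using gphi_word_bounds[OF wd, of 0] by auto
    ultimately have "\<bar>u m - u n\<bar> \<le> \<bar>0 - ?y\<bar> / (den (map a [0..<m]) 0)\<^sup>2"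
      unfolding u_def by (simp only:) (rule gphi_word_diff_le[OF wd], auto)
    also have "\<dots> \<le> 1 / (2 ^ m)\<^sup>2"
      using y den_ge_power[OF wd, of 0 0 m] by (intro frac_le power_mono) auto
    also have "\<dots> = (1/4) ^ m" by (simp add: power2_eq_square power_one_over flip: power_mult_distrib)
    finally show ?thesis .
  qed
  have "Cauchy u"
  proof (rule metric_CauchyI)
    fix e :: real assume "e > 0"
    then obtain M where M: "(1/4::real) ^ M < e / 2" using real_arch_pow_inv[of "e/2" "1/4::real"] by auto
    have "dist (u m) (u n) < e" if "m \<ge> M" "n \<ge> M" for m n
      using dist[OF that(1)] dist[OF that(2)] M unfolding dist_real_def by linarith
    then show "\<exists>M. \<forall>m\<ge>M. \<forall>n\<ge>M. dist (u m) (u n) < e" by blast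
  qed
  then have "convergent u" by (simp add: Cauchy_convergent_iff)
  then have lim: "u \<longlonglongrightarrow> cf_code a" unfolding cf_code_def u_def[symmetric] by (simp add: convergent_LIMSEQ_iff)
  have bd: "u (Suc n) \<in> {1 / (real (a 0) + 1)..1/2}" for n
  proof -
    have "u (Suc n) = gphi (a 0) (gphi_word (map a [1..<Suc n]) 0)"
      unfolding u_def upt_conv_Cons[OF zero_less_Suc] by simp
    moreover have "0 \<le> gphi_word (map a [1..<Suc n]) 0" "gphi_word (map a [1..<Suc n]) 0 \<le> 1"
      using gphi_word_bounds[OF wd, of 0 1 "Suc n"] by (simp_all del: upt_Suc)
    ultimately show ?thesis using ge2[of 0]
      by (auto simp: gphi_def intro!: divide_left_mono mult_pos_pos add_pos_nonneg)
  qed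
  have lim': "(\<lambda>n. u (Suc n)) \<longlonglongrightarrow> cf_code a" using lim by (rule LIMSEQ_Suc)
  have "cf_code a \<in> {1 / (real (a 0) + 1)..1/2}"
    by (rule closed_sequentially[OF closed_atLeastAtMost _ lim']) (use bd in blast)
  then show ?thesis by (auto simp: J_def intro: less_le_trans[of 0 "1 / (real (a 0) + 1)"])
qed

lemma limit_set_primes_subset: "limit_set {p. prime p} \<subseteq> J"
  unfolding limit_set_def using cf_code_in_J by auto

locale prime_conformal =
  fixes \<mu> :: "real measure" and \<delta> :: real
  assumes conf: "conformal_measure {p. prime p} \<delta> \<mu>"
begin

lemma sets_mu [measurable_cong, simp]: "sets \<mu> = sets borel"
  using conf by (simp add: conformal_measure_def)

lemma space_mu [simp]: "space \<mu> = UNIV"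
  using sets_eq_imp_space_eq[OF sets_mu] by simp

lemma emeasure_UNIV [simp]: "emeasure \<mu> UNIV = 1"
  using conf by (simp add: conformal_measure_def)

lemma finite_mu: "finite_measure \<mu>"
  by (rule finite_measureI) simp

lemma emeasure_le_1: "emeasure \<mu> A \<le> 1"
  using emeasure_space[of \<mu> A] by simp

lemma AE_J: "AE x in \<mu>. x \<in> J"
  using conf limit_set_primes_subset unfolding conformal_measure_def by (auto elim: eventually_mono)

lemma emeasure_inter_J:
  assumes "A \<in> sets borel"
  shows "emeasure \<mu> (A \<inter> J) = emeasure \<mu> A"
  using AE_J assms by (intro emeasure_eq_AE) auto

definition wt :: "nat \<Rightarrow> real \<Rightarrow> ennreal" where
  "wt a x = ennreal ((real a + x) powr (- (2 * \<delta>)))"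

lemma measurable_wt [measurable]: "wt a \<in> borel_measurable borel"
  unfolding wt_def by measurable

lemma measurable_gphi [measurable]: "gphi a \<in> borel_measurable borel"
  unfolding gphi_def[abs_def] by measurable

lemma conformal_J:
  assumes "A \<in> sets borel" "A \<subseteq> {0..1}"
  shows "emeasure \<mu> A = (\<Sum>\<^sub>\<infinity> a\<in>{p. prime p}. \<integral>\<^sup>+ x. wt a x * indicator {x\<in>J. gphi a x \<in> A} x \<partial>\<mu>)"
proof -
  have "emeasure \<mu> A = (\<Sum>\<^sub>\<infinity> a\<in>{p. prime p}. \<integral>\<^sup>+ x\<in>{x\<in>{0..1}. gphi a x \<in> A}.
                          ennreal (\<bar>deriv (gphi a) x\<bar> powr \<delta>) \<partial>\<mu>)"
    using conf assms unfolding conformal_measure_def by blast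
  also have "\<dots> = (\<Sum>\<^sub>\<infinity> a\<in>{p. prime p}. \<integral>\<^sup>+ x. wt a x * indicator {x\<in>J. gphi a x \<in> A} x \<partial>\<mu>)"
  proof (rule infsum_cong)
    fix a :: nat assume "a \<in> {p. prime p}"
    then have a: "a \<ge> 1" using prime_ge_1_nat by auto
    show "(\<integral>\<^sup>+ x\<in>{x\<in>{0..1}. gphi a x \<in> A}. ennreal (\<bar>deriv (gphi a) x\<bar> powr \<delta>) \<partial>\<mu>)
        = (\<integral>\<^sup>+ x. wt a x * indicator {x\<in>J. gphi a x \<in> A} x \<partial>\<mu>)"
      using AE_J by (intro nn_integral_cong_AE, elim eventually_mono)
        (use a in \<open>auto simp: J_def wt_def indicator_def abs_deriv_gphi\<close>)
  qed
  finally show ?thesis .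
qed

lemma emeasure_gauss_null:
  assumes A: "A \<in> sets borel" "emeasure \<mu> A = 0"
  shows "emeasure \<mu> {x \<in> J. gauss x \<in> A} = 0"
proof -
  have "emeasure \<mu> {x \<in> J. gauss x \<in> A} = (\<Sum>\<^sub>\<infinity> a\<in>{p. prime p}. \<integral>\<^sup>+ x. wt a x * indicator {x\<in>J. gphi a x \<in> {x \<in> J. gauss x \<in> A}} x \<partial>\<mu>)"
  proof (rule conformal_J)
    have "{x \<in> J. gauss x \<in> A} = J \<inter> (gauss -` A \<inter> space borel)" by auto
    also have "\<dots> \<in> sets borel" using A by (intro sets.Int measurable_sets[OF measurable_gauss]) auto
    finally show "{x \<in> J. gauss x \<in> A} \<in> sets borel" .
  qed (auto simp: J_def)
  also have "\<dots> = (\<Sum>\<^sub>\<infinity> a\<in>{p::nat. prime p}. 0)"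
  proof (rule infsum_cong)
    fix a :: nat
    have "AE x in \<mu>. x \<notin> A" using A by (simp add: AE_iff_null null_setsI)
    then have "AE x in \<mu>. wt a x * indicator {x\<in>J. gphi a x \<in> {x \<in> J. gauss x \<in> A}} x = 0"
      by (elim eventually_mono) (auto simp: indicator_def gauss_gphi)
    then show "(\<integral>\<^sup>+ x. wt a x * indicator {x\<in>J. gphi a x \<in> {x \<in> J. gauss x \<in> A}} x \<partial>\<mu>) = 0"
      by (simp add: nn_integral_cong_AE[where v = "\<lambda>_. 0"])
  qed
  finally show ?thesis by simp
qed

lemma AE_prime_dig: "AE x in \<mu>. prime (dig x)"
proof -
  let ?A = "{x\<in>J. \<not> prime (dig x)}"
  have "emeasure \<mu> ?A = (\<Sum>\<^sub>\<infinity> a\<in>{p. prime p}. \<integral>\<^sup>+ x. wt a x * indicator {x\<in>J. gphi a x \<in> ?A} x \<partial>\<mu>)"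
    by (rule conformal_J) (auto simp: J_def)
  also have "\<dots> = (\<Sum>\<^sub>\<infinity> a\<in>{p. prime (p::nat)}. 0)"
    by (rule infsum_cong) (auto simp: indicator_def dig_gphi nn_integral_0_iff_AE)
  finally have "emeasure \<mu> ?A = 0" by simp
  moreover have "?A \<in> sets \<mu>" by simp
  ultimately have "AE x in \<mu>. x \<notin> ?A" by (simp add: AE_iff_null null_setsI)
  then show ?thesis using AE_J by eventually_elim auto
qed

lemma AE_gauss:
  assumes "AE x in \<mu>. P x"
  shows "AE x in \<mu>. P (gauss x)"
proof -
  from assms obtain N where N: "{x \<in> space \<mu>. \<not> P x} \<subseteq> N" "emeasure \<mu> N = 0" "N \<in> sets \<mu>"
    by (auto elim: AE_E)
  then have "emeasure \<mu> {x \<in> J. gauss x \<in> N} = 0" by (intro emeasure_gauss_null) auto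
  moreover have "{x \<in> J. gauss x \<in> N} \<in> sets \<mu>" 
  proof -
    have "{x \<in> J. gauss x \<in> N} = J \<inter> (gauss -` N \<inter> space borel)" by auto
    also have "\<dots> \<in> sets borel" using N by (intro sets.Int measurable_sets[OF measurable_gauss]) auto
    finally show ?thesis by simp
  qed
  ultimately have "AE x in \<mu>. x \<notin> {x \<in> J. gauss x \<in> N}" by (simp add: AE_iff_null null_setsI)
  then show ?thesis using AE_J by eventually_elim (use N in auto)
qed

lemma AE_gauss_pow:
  assumes "AE x in \<mu>. P x"
  shows "AE x in \<mu>. P ((gauss ^^ n) x)"
proof (induction n)
  case (Suc n)
  from AE_gauss[OF Suc] show ?case by (simp add: funpow_swap1)
qed (use assms in simp)

lemma AE_prime_cf: "AE x in \<mu>. x \<in> prime_cf"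
  unfolding prime_cf_def mem_Collect_eq AE_all_countable
  using AE_gauss_pow[OF AE_J] AE_gauss_pow[OF AE_prime_dig] by (auto simp: AE_conj_iff)

lemma emeasure_gphi_image:
  assumes "prime a" "B \<in> sets borel" "B \<subseteq> J"
  shows "emeasure \<mu> (gphi a ` B) = (\<integral>\<^sup>+ x. wt a x * indicator B x \<partial>\<mu>)"
proof -
  have inj: "gphi b x \<in> gphi a ` B \<longleftrightarrow> b = a \<and> x \<in> B" if "x \<in> J" for b x
  proof
    assume "gphi b x \<in> gphi a ` B"
    then obtain y where y: "y \<in> B" "gphi b x = gphi a y" by auto
    have "y \<in> J" using y assms by auto
    then show "b = a \<and> x \<in> B" using y that by (metis dig_gphi gauss_gphi)
  qed auto
  have sub: "gphi a ` B \<subseteq> J"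
    using assms gphi_in_J[of a] prime_ge_2_nat by (auto simp: J_def subset_iff)
  then have "emeasure \<mu> (gphi a ` B) = (\<Sum>\<^sub>\<infinity> b\<in>{p. prime p}. \<integral>\<^sup>+ x. wt b x * indicator {x\<in>J. gphi b x \<in> gphi a ` B} x \<partial>\<mu>)"
    using gphi_image_borel[OF assms(2,3)] by (intro conformal_J) (auto simp: J_def subset_iff)
  also have "\<dots> = (\<Sum>\<^sub>\<infinity> b\<in>{a}. \<integral>\<^sup>+ x. wt b x * indicator {x\<in>J. gphi b x \<in> gphi a ` B} x \<partial>\<mu>)"
  proof (rule infsum_cong_neutral)
    fix b assume "b \<in> {p. prime p} - {a}"
    then show "(\<integral>\<^sup>+ x. wt b x * indicator {x\<in>J. gphi b x \<in> gphi a ` B} x \<partial>\<mu>) = 0"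
      using inj by (auto simp: indicator_def nn_integral_0_iff_AE cong: conj_cong)
  qed (use assms in auto)
  also have "\<dots> = (\<integral>\<^sup>+ x. wt a x * indicator {x\<in>J. gphi a x \<in> gphi a ` B} x \<partial>\<mu>)" by simp
  also have "{x\<in>J. gphi a x \<in> gphi a ` B} = B" using inj assms by auto
  finally show ?thesis .
qed

end

lemma measurable_gphi_word [measurable]: "gphi_word w \<in> borel_measurable borel"
proof (induction w)
  case (Cons a w)
  then have "(\<lambda>x. 1 / (real a + gphi_word w x)) \<in> borel_measurable borel" by measurable
  then show ?case by (simp only: gphi_word_Cons[symmetric])
qed (simp add: id_def)

lemma measurable_den [measurable]: "den w \<in> borel_measurable borel"
  by (induction w) (auto intro!: borel_measurable_times borel_measurable_add)

context prime_conformal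
begin

lemma nn_integral_gphi:
  assumes a: "prime a" and B: "B \<in> sets borel" "B \<subseteq> J" and f [measurable]: "f \<in> borel_measurable borel"
  shows "(\<integral>\<^sup>+ x. f x * indicator (gphi a ` B) x \<partial>\<mu>) = (\<integral>\<^sup>+ x. f (gphi a x) * wt a x * indicator B x \<partial>\<mu>)"
proof -
  have im: "gphi a ` C \<in> sets borel" if "C \<in> sets borel" "C \<subseteq> J" for C
    using that by (rule gphi_image_borel)
  have [measurable]: "gphi a ` J \<in> sets borel" "gphi a ` B \<in> sets borel" using im B by auto
  have inj: "gphi a x \<in> gphi a ` C \<longleftrightarrow> x \<in> C" if "x \<in> J" "C \<subseteq> J" for x C
  proof
    assume "gphi a x \<in> gphi a ` C"
    then obtain y where y: "y \<in> C" "gphi a x = gphi a y" by auto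
    have yJ: "y \<in> J" using y(1) that(2) by (rule subsetD[rotated])
    have "x = y" using arg_cong[OF y(2), of gauss] gauss_gphi[OF that(1), of a] gauss_gphi[OF yJ, of a] by argo
    then show "x \<in> C" using y(1) by (simp only:)
  qed auto
  have eq: "density \<mu> (indicator (gphi a ` J)) = distr (density \<mu> (\<lambda>x. wt a x * indicator J x)) borel (gphi a)"
  proof (rule measure_eqI)
    fix A assume "A \<in> sets (density \<mu> (indicator (gphi a ` J)))"
    then have A [measurable]: "A \<in> sets borel" by simp
    let ?B = "{x \<in> J. gphi a x \<in> A}"
    have B' [measurable]: "?B \<in> sets borel" by measurable
    have "emeasure (density \<mu> (indicator (gphi a ` J))) A = (\<integral>\<^sup>+ x. indicator (gphi a ` ?B) x \<partial>\<mu>)"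
      by (subst emeasure_density) (auto simp: indicator_def intro!: nn_integral_cong)
    also have "\<dots> = emeasure \<mu> (gphi a ` ?B)" using im[OF B'] by (intro nn_integral_indicator) auto
    also have "\<dots> = (\<integral>\<^sup>+ x. wt a x * indicator ?B x \<partial>\<mu>)"
      by (rule emeasure_gphi_image) (use a in auto)
    also have "\<dots> = (\<integral>\<^sup>+ x. (wt a x * indicator J x) * indicator (gphi a -` A) x \<partial>\<mu>)"
      by (auto simp: indicator_def intro!: nn_integral_cong)
    also have "\<dots> = emeasure (density \<mu> (\<lambda>x. wt a x * indicator J x)) (gphi a -` A)"
    proof (rule emeasure_density[symmetric])
      show "gphi a -` A \<in> sets \<mu>" using measurable_sets[OF measurable_gphi A] by simp
    qed measurable
    also have "\<dots> = emeasure (distr (density \<mu> (\<lambda>x. wt a x * indicator J x)) borel (gphi a)) A"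
      by (subst emeasure_distr) auto
    finally show "emeasure (density \<mu> (indicator (gphi a ` J))) A = \<dots>" .
  qed simp
  let ?h = "\<lambda>x. f x * indicator (gphi a ` B) x"
  have "(\<integral>\<^sup>+ x. ?h x \<partial>\<mu>) = (\<integral>\<^sup>+ x. indicator (gphi a ` J) x * ?h x \<partial>\<mu>)"
    using B by (intro nn_integral_cong) (auto simp: indicator_def)
  also have "\<dots> = (\<integral>\<^sup>+ x. ?h x \<partial>density \<mu> (indicator (gphi a ` J)))"
    by (subst nn_integral_density) auto
  also have "\<dots> = (\<integral>\<^sup>+ x. ?h (gphi a x) \<partial>density \<mu> (\<lambda>x. wt a x * indicator J x))"
    unfolding eq by (subst nn_integral_distr) auto
  also have "\<dots> = (\<integral>\<^sup>+ x. (wt a x * indicator J x) * ?h (gphi a x) \<partial>\<mu>)"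
    by (subst nn_integral_density) auto
  also have "\<dots> = (\<integral>\<^sup>+ x. f (gphi a x) * wt a x * indicator B x \<partial>\<mu>)"
    using B inj by (intro nn_integral_cong) (auto simp: indicator_def mult_ac)
  finally show ?thesis .
qed

definition wtw :: "nat list \<Rightarrow> real \<Rightarrow> ennreal" where
  "wtw w x = ennreal (den w x powr (- (2 * \<delta>)))"

lemma measurable_wtw [measurable]: "wtw w \<in> borel_measurable borel"
  unfolding wtw_def by measurable

lemma wtw_Cons:
  assumes "set (a # w) \<subseteq> {2..}" "x \<in> J"
  shows "wt a (gphi_word w x) * wtw w x = wtw (a # w) x"
proof -
  have "0 < den w x" using den_pos[of w x] assms by (auto simp: J_def)
  then show ?thesis
    by (simp add: wt_def wtw_def powr_mult ennreal_mult[symmetric] mult.commute)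
qed

lemma nn_integral_word:
  assumes w: "\<forall>a\<in>set w. prime a" and B: "B \<in> sets borel" "B \<subseteq> J" and f: "f \<in> borel_measurable borel"
  shows "(\<integral>\<^sup>+ x. f x * indicator (gphi_word w ` B) x \<partial>\<mu>)
    = (\<integral>\<^sup>+ x. f (gphi_word w x) * wtw w x * indicator B x \<partial>\<mu>)"
  using w f
proof (induction w arbitrary: f)
  case Nil
  then show ?case by (simp add: wtw_def id_def)
next
  case (Cons a w)
  have f [measurable]: "f \<in> borel_measurable borel" by fact
  have ge2: "set (a # w) \<subseteq> {2..}" using Cons.prems prime_ge_2_nat by auto
  have C: "gphi_word w ` B \<in> sets borel" "gphi_word w ` B \<subseteq> J"
    using gphi_word_image_borel[of w B] gphi_word_in_J[of w] ge2 B by auto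
  have "gphi_word (a # w) ` B = gphi a ` (gphi_word w ` B)" by (simp add: image_image)
  then have "(\<integral>\<^sup>+ x. f x * indicator (gphi_word (a # w) ` B) x \<partial>\<mu>)
    = (\<integral>\<^sup>+ x. (f (gphi a x) * wt a x) * indicator (gphi_word w ` B) x \<partial>\<mu>)"
    using Cons.prems C by (simp add: nn_integral_gphi)
  also have "\<dots> = (\<integral>\<^sup>+ x. (f (gphi a (gphi_word w x)) * wt a (gphi_word w x)) * wtw w x * indicator B x \<partial>\<mu>)"
    using Cons.prems by (intro Cons.IH) auto
  also have "\<dots> = (\<integral>\<^sup>+ x. f (gphi_word (a # w) x) * wtw (a # w) x * indicator B x \<partial>\<mu>)"
  proof (rule nn_integral_cong)
    fix x
    show "(f (gphi a (gphi_word w x)) * wt a (gphi_word w x)) * wtw w x * indicator B x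
      = f (gphi_word (a # w) x) * wtw (a # w) x * indicator B x"
      using wtw_Cons[OF ge2, of x] B by (cases "x \<in> B") (auto simp: mult.assoc)
  qed
  finally show ?case .
qed

lemma emeasure_dig_le:
  assumes b: "\<And>F. finite F \<Longrightarrow> F \<subseteq> D \<Longrightarrow> (\<forall>p\<in>F. prime p) \<Longrightarrow> (\<Sum>p\<in>F. real p powr (- 2 * \<delta>)) \<le> b"
    and \<delta>: "\<delta> \<ge> 0"
  shows "emeasure \<mu> {x. dig x \<in> D} \<le> ennreal b"
proof -
  have m: "{x. dig x \<in> D} \<in> sets borel"
    using measurable_sets[OF measurable_dig, of D] by (simp add: vimage_def)
  have "emeasure \<mu> {x. dig x \<in> D} = emeasure \<mu> ({x. dig x \<in> D} \<inter> J)" using emeasure_inter_J[OF m] by simp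
  also have "\<dots> = (\<Sum>\<^sub>\<infinity> a\<in>{p. prime p}. \<integral>\<^sup>+ x. wt a x * indicator {x\<in>J. gphi a x \<in> {x. dig x \<in> D} \<inter> J} x \<partial>\<mu>)"
    using m by (intro conformal_J) (auto simp: J_def)
  also have "\<dots> \<le> ennreal b"
  proof (rule infsum_le_finite_sums)
    fix F :: "nat set" assume F: "finite F" "F \<subseteq> {p. prime p}"
    have "(\<Sum>a\<in>F. \<integral>\<^sup>+ x. wt a x * indicator {x\<in>J. gphi a x \<in> {x. dig x \<in> D} \<inter> J} x \<partial>\<mu>)
       \<le> (\<Sum>a\<in>F. if a \<in> D then ennreal (real a powr (- 2 * \<delta>)) else 0)"
    proof (rule sum_mono)
      fix a assume "a \<in> F"
      then have a: "a \<ge> 2" using F prime_ge_2_nat by auto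
      show "(\<integral>\<^sup>+ x. wt a x * indicator {x\<in>J. gphi a x \<in> {x. dig x \<in> D} \<inter> J} x \<partial>\<mu>)
        \<le> (if a \<in> D then ennreal (real a powr (- 2 * \<delta>)) else 0)"
      proof (cases "a \<in> D")
        case True
        have "(\<integral>\<^sup>+ x. wt a x * indicator {x\<in>J. gphi a x \<in> {x. dig x \<in> D} \<inter> J} x \<partial>\<mu>)
          \<le> (\<integral>\<^sup>+ x. ennreal (real a powr (- 2 * \<delta>)) \<partial>\<mu>)"
          using a \<delta> by (intro nn_integral_mono)
            (auto simp: indicator_def wt_def J_def intro!: ennreal_leI powr_mono2')
        then show ?thesis using True by simp
      next
        case False
        then have "(\<integral>\<^sup>+ x. wt a x * indicator {x\<in>J. gphi a x \<in> {x. dig x \<in> D} \<inter> J} x \<partial>\<mu>) = (\<integral>\<^sup>+ x. 0 \<partial>\<mu>)"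
          by (intro nn_integral_cong) (auto simp: indicator_def dig_gphi)
        then show ?thesis by simp
      qed
    qed
    also have "\<dots> = (\<Sum>a\<in>F \<inter> D. ennreal (real a powr (- 2 * \<delta>)))"
      using F by (intro sum.inter_restrict[symmetric])
    also have "\<dots> = ennreal (\<Sum>a\<in>F \<inter> D. real a powr (- 2 * \<delta>))" by (rule sum_ennreal) simp
    also have "\<dots> \<le> ennreal b" using F by (intro ennreal_leI b) auto
    finally show "(\<Sum>a\<in>F. \<integral>\<^sup>+ x. wt a x * indicator {x\<in>J. gphi a x \<in> {x. dig x \<in> D} \<inter> J} x \<partial>\<mu>) \<le> ennreal b" .
  qed (rule nonneg_summable_on_complete, simp)
  finally show ?thesis .
qed

lemma emeasure_dig_ge:
  assumes F: "finite F" "\<forall>p\<in>F. prime p" and s: "s \<ge> 0" "s \<ge> 2 * \<delta>"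
  shows "ennreal (\<Sum>p\<in>F. (real p + 1/2) powr (- s)) \<le> emeasure \<mu> {x. dig x \<in> F}"
proof -
  have m: "{x. dig x \<in> F} \<in> sets borel"
    using measurable_sets[OF measurable_dig, of F] by (simp add: vimage_def)
  have im: "gphi p ` J \<in> sets borel" for p by (rule gphi_image_borel) auto
  have "ennreal (\<Sum>p\<in>F. (real p + 1/2) powr (- s)) = (\<Sum>p\<in>F. ennreal ((real p + 1/2) powr (- s)))"
    by (rule sum_ennreal[symmetric]) simp
  also have "\<dots> \<le> (\<Sum>p\<in>F. emeasure \<mu> (gphi p ` J))"
  proof (rule sum_mono)
    fix p assume p: "p \<in> F"
    then have p2: "p \<ge> 2" using F prime_ge_2_nat by auto
    have "ennreal ((real p + 1/2) powr (- s)) = (\<integral>\<^sup>+ x. ennreal ((real p + 1/2) powr (- s)) \<partial>\<mu>)" by simp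
    also have "\<dots> \<le> (\<integral>\<^sup>+ x. wt p x * indicator J x \<partial>\<mu>)"
    proof (rule nn_integral_mono_AE)
      show "AE x in \<mu>. ennreal ((real p + 1/2) powr (- s)) \<le> wt p x * indicator J x"
        using AE_J
      proof eventually_elim
        case (elim x)
        have "(real p + 1/2) powr (- s) \<le> (real p + x) powr (- s)"
          using elim p2 s by (intro powr_mono2') (auto simp: J_def)
        also have "\<dots> \<le> (real p + x) powr (- (2 * \<delta>))"
          using elim p2 s by (intro powr_mono) (auto simp: J_def)
        finally show ?case using elim by (simp add: wt_def ennreal_leI)
      qed
    qed
    also have "\<dots> = emeasure \<mu> (gphi p ` J)" using p F by (intro emeasure_gphi_image[symmetric]) auto
    finally show "ennreal ((real p + 1/2) powr (- s)) \<le> emeasure \<mu> (gphi p ` J)" .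
  qed
  also have "\<dots> = emeasure \<mu> (\<Union>p\<in>F. gphi p ` J)"
  proof (rule sum_emeasure)
    show "disjoint_family_on (\<lambda>p. gphi p ` J) F"
      by (auto simp: disjoint_family_on_def) (metis dig_gphi)
  qed (use F im in auto)
  also have "\<dots> \<le> emeasure \<mu> {x. dig x \<in> F}"
    using m by (intro emeasure_mono) (auto simp: dig_gphi)
  finally show ?thesis .
qed

lemma delta_gt_half: "\<delta> > 1/2"
proof (rule ccontr)
  assume "\<not> ?thesis"
  then have "max 0 (2 * \<delta>) \<le> 1" by simp
  then obtain F where F: "finite F" "\<forall>p\<in>F. prime p" "1 < (\<Sum>p\<in>F. (real p + 1/2) powr (- max 0 (2 * \<delta>)))"
    using sum_primes_unbounded[of "max 0 (2 * \<delta>)" 1] by blast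
  have "ennreal (\<Sum>p\<in>F. (real p + 1/2) powr (- max 0 (2 * \<delta>))) \<le> emeasure \<mu> {x. dig x \<in> F}"
    using F by (intro emeasure_dig_ge) auto
  also have "\<dots> \<le> 1" by (rule emeasure_le_1)
  finally show False using F by (simp add: ennreal_le_1)
qed

lemma sum_inverse_squares_le:
  assumes "finite F" "F \<subseteq> {2::nat..}"
  shows "(\<Sum>p\<in>F. 1 / (real p)\<^sup>2) \<le> 3/4"
proof -
  have step: "(\<Sum>n=2..Suc (Suc N). 1 / (real n)\<^sup>2) \<le> 3/4 - 1 / real (Suc (Suc N))" for N
  proof (induction N)
    case (Suc N)
    define m where "m = real (Suc (Suc N))"
    have m: "m > 0" by (simp add: m_def)
    have "(\<Sum>n=2..Suc (Suc (Suc N)). 1 / (real n)\<^sup>2) \<le> (3/4 - 1 / m) + 1 / (m + 1)\<^sup>2"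
      using Suc by (simp add: m_def add_ac)
    also have "\<dots> \<le> 3/4 - 1 / (m + 1)"
    proof -
      have "1 / (m + 1)\<^sup>2 \<le> 1 / (m * (m + 1))" using m by (intro divide_left_mono) (auto simp: power2_eq_square)
      moreover have "1 / m - 1 / (m + 1) = 1 / (m * (m + 1))" using m by (simp add: field_simps)
      ultimately show ?thesis by linarith
    qed
    finally show ?case by (simp add: m_def add_ac)
  qed (simp add: numeral_2_eq_2)
  have "F \<subseteq> {2..Suc (Suc (Max (insert 0 F)))}" using assms by (auto intro!: le_SucI Max_ge)
  then have "(\<Sum>p\<in>F. 1 / (real p)\<^sup>2) \<le> (\<Sum>n=2..Suc (Suc (Max (insert 0 F))). 1 / (real n)\<^sup>2)"
    by (intro sum_mono2) auto
  also have "\<dots> \<le> 3/4" using step[of "Max (insert 0 F)"] by (smt (verit) divide_nonneg_nonneg of_nat_0_le_iff)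
  finally show ?thesis .
qed

lemma delta_lt_1: "\<delta> < 1"
proof (rule ccontr)
  assume "\<not> ?thesis"
  then have d: "\<delta> \<ge> 1" by simp
  have "emeasure \<mu> {x. dig x \<in> UNIV} \<le> ennreal (3/4)"
  proof (rule emeasure_dig_le)
    fix F :: "nat set" assume F: "finite F" "\<forall>p\<in>F. prime p"
    have ge2: "p \<ge> 2" if "p \<in> F" for p using F that prime_ge_2_nat by blast
    have "(\<Sum>p\<in>F. real p powr (- 2 * \<delta>)) \<le> (\<Sum>p\<in>F. 1 / (real p)\<^sup>2)"
    proof (rule sum_mono)
      fix p assume "p \<in> F"
      then have p: "real p \<ge> 2" using ge2 by fastforce
      then have "real p powr (- 2 * \<delta>) \<le> real p powr (- 2)" using d by (intro powr_mono) auto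
      then show "real p powr (- 2 * \<delta>) \<le> 1 / (real p)\<^sup>2" using p by (simp add: powr_neg_numeral)
    qed
    also have "\<dots> \<le> 3/4" using F ge2 by (intro sum_inverse_squares_le) auto
    finally show "(\<Sum>p\<in>F. real p powr (- 2 * \<delta>)) \<le> 3/4" .
  qed (use d in auto)
  then have "(1::ennreal) \<le> ennreal (3/4)" by simp
  then show False by (simp add: ennreal_ge_1)
qed


lemma nn_integral_digs:
  assumes g [measurable]: "g \<in> borel_measurable borel"
  shows "(\<integral>\<^sup>+ x. f (digs n x) * g ((gauss ^^ n) x) \<partial>\<mu>)
    = (\<integral>\<^sup>+ w. f w * (\<integral>\<^sup>+ x. g x * wtw w x \<partial>\<mu>) \<partial>count_space (prime_words n))"
proof -
  have im: "gphi_word w ` J \<in> sets borel" if "w \<in> prime_words n" for w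
    using that prime_words_ge2 by (intro gphi_word_image_borel) auto
  have "(\<integral>\<^sup>+ x. f (digs n x) * g ((gauss ^^ n) x) \<partial>\<mu>)
    = (\<integral>\<^sup>+ x. \<integral>\<^sup>+ w. f w * g ((gauss ^^ n) x) * indicator (gphi_word w ` J) x \<partial>count_space (prime_words n) \<partial>\<mu>)"
  proof (rule nn_integral_cong_AE)
    show "AE x in \<mu>. f (digs n x) * g ((gauss ^^ n) x) =
      (\<integral>\<^sup>+ w. f w * g ((gauss ^^ n) x) * indicator (gphi_word w ` J) x \<partial>count_space (prime_words n))"
      using AE_prime_cf
    proof eventually_elim
      case (elim x)
      have 1: "(\<integral>\<^sup>+ w. f w * g ((gauss ^^ n) x) * indicator (gphi_word w ` J) x \<partial>count_space (prime_words n))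
         = (\<integral>\<^sup>+ w. f w * g ((gauss ^^ n) x) * indicator {digs n x} w \<partial>count_space (prime_words n))"
      proof (rule nn_integral_cong)
        fix w assume "w \<in> space (count_space (prime_words n))"
        then have w: "w \<in> prime_words n" by simp
        have "x \<in> gphi_word w ` J \<longleftrightarrow> w = digs n x"
        proof
          assume "x \<in> gphi_word w ` J"
          then obtain y where y: "y \<in> J" "x = gphi_word w y" by auto
          show "w = digs n x"
            using funpow_gauss_gphi_word[OF prime_words_ge2[OF w] y(1)] w y(2) by (simp add: prime_words_def)
        next
          assume "w = digs n x"
          then have "x = gphi_word w ((gauss ^^ n) x)" using prime_cf_digs[OF elim] by simp
          then show "x \<in> gphi_word w ` J" using prime_cf_J[OF elim] by blast
        qed
        then show "f w * g ((gauss ^^ n) x) * indicator (gphi_word w ` J) x = f w * g ((gauss ^^ n) x) * indicator {digs n x} w"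
          by (auto simp: indicator_def)
      qed
      show ?case unfolding 1 using prime_cf_digs_word[OF elim, of n]
        by (subst nn_integral_indicator_singleton) auto
    qed
  qed
  also have "\<dots> = (\<integral>\<^sup>+ w. \<integral>\<^sup>+ x. f w * g ((gauss ^^ n) x) * indicator (gphi_word w ` J) x \<partial>\<mu> \<partial>count_space (prime_words n))"
  proof (rule nn_integral_count_space_nn_integral)
    fix w assume "w \<in> prime_words n"
    then have [measurable]: "gphi_word w ` J \<in> sets borel" by (rule im)
    show "(\<lambda>x. f w * g ((gauss ^^ n) x) * indicator (gphi_word w ` J) x) \<in> borel_measurable \<mu>" by measurable
  qed (rule countableI_type)
  also have "\<dots> = (\<integral>\<^sup>+ w. f w * (\<integral>\<^sup>+ x. g x * wtw w x \<partial>\<mu>) \<partial>count_space (prime_words n))"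
  proof (rule nn_integral_cong)
    fix w assume "w \<in> space (count_space (prime_words n))"
    then have w: "w \<in> prime_words n" by simp
    have "(\<integral>\<^sup>+ x. f w * g ((gauss ^^ n) x) * indicator (gphi_word w ` J) x \<partial>\<mu>)
      = (\<integral>\<^sup>+ x. f w * g ((gauss ^^ n) (gphi_word w x)) * wtw w x * indicator J x \<partial>\<mu>)"
      using w by (intro nn_integral_word) (auto simp: prime_words_def)
    also have "\<dots> = (\<integral>\<^sup>+ x. f w * (g x * wtw w x) \<partial>\<mu>)"
    proof (rule nn_integral_cong_AE)
      show "AE x in \<mu>. f w * g ((gauss ^^ n) (gphi_word w x)) * wtw w x * indicator J x = f w * (g x * wtw w x)"
        using AE_J
      proof eventually_elim
        case (elim x)
        have "(gauss ^^ n) (gphi_word w x) = x"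
          using funpow_gauss_gphi_word[OF prime_words_ge2[OF w] elim] w by (simp add: prime_words_def)
        then show ?case using elim by (simp add: mult_ac)
      qed
    qed
    also have "\<dots> = f w * (\<integral>\<^sup>+ x. g x * wtw w x \<partial>\<mu>)" by (rule nn_integral_cmult) measurable
    finally show "(\<integral>\<^sup>+ x. f w * g ((gauss ^^ n) x) * indicator (gphi_word w ` J) x \<partial>\<mu>)
      = f w * (\<integral>\<^sup>+ x. g x * wtw w x \<partial>\<mu>)" .
  qed
  finally show ?thesis .
qed

definition cyl :: "nat list \<Rightarrow> ennreal" where "cyl w = ennreal (den w 0 powr (- (2 * \<delta>)))"

lemma wtw_le_cyl: "set w \<subseteq> {2..} \<Longrightarrow> x \<in> J \<Longrightarrow> wtw w x \<le> cyl w"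
  unfolding wtw_def cyl_def using den_distortion[of w x] den_pos[of w 0] delta_gt_half
  by (intro ennreal_leI powr_mono2') (auto simp: J_def)

lemma cyl_le_wtw:
  assumes "set w \<subseteq> {2..}" "x \<in> J"
  shows "cyl w \<le> 4 * wtw w x"
proof -
  have x: "0 \<le> x" "x \<le> 1" using assms by (auto simp: J_def)
  have d: "den w 0 > 0" "den w x > 0" using den_pos[of w] assms(1) x by auto
  have "2 powr (- (2 * \<delta>)) * den w 0 powr (- (2 * \<delta>)) = (2 * den w 0) powr (- (2 * \<delta>))" by (simp add: powr_mult)
  also have "\<dots> \<le> den w x powr (- (2 * \<delta>))"
    using d delta_gt_half den_distortion[OF assms(1) x] by (intro powr_mono2') auto
  finally have 1: "2 powr (- (2 * \<delta>)) * den w 0 powr (- (2 * \<delta>)) \<le> den w x powr (- (2 * \<delta>))" .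
  have "(2::real) powr (-2) \<le> 2 powr (- (2 * \<delta>))" using delta_lt_1 by (intro powr_mono) auto
  then have "1 \<le> 4 * (2::real) powr (- (2 * \<delta>))" by (simp add: powr_neg_numeral)
  then have "1 * den w 0 powr (- (2 * \<delta>)) \<le> 4 * (2::real) powr (- (2 * \<delta>)) * den w 0 powr (- (2 * \<delta>))"
    by (intro mult_right_mono) auto
  then have "den w 0 powr (- (2 * \<delta>)) \<le> 4 * den w x powr (- (2 * \<delta>))" using 1 by simp
  then have "cyl w \<le> ennreal (4 * den w x powr (- (2 * \<delta>)))" unfolding cyl_def by (rule ennreal_leI)
  also have "\<dots> = 4 * wtw w x" by (simp add: wtw_def ennreal_mult)
  finally show ?thesis .
qed

lemma nn_integral_wtw_le:
  assumes "set w \<subseteq> {2..}" and [measurable]: "g \<in> borel_measurable borel"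
  shows "(\<integral>\<^sup>+ x. g x * wtw w x \<partial>\<mu>) \<le> cyl w * integral\<^sup>N \<mu> g"
proof -
  have "(\<integral>\<^sup>+ x. g x * wtw w x \<partial>\<mu>) \<le> (\<integral>\<^sup>+ x. cyl w * g x \<partial>\<mu>)"
    using AE_J by (intro nn_integral_mono_AE, elim eventually_mono)
      (use assms wtw_le_cyl in \<open>auto simp: mult.commute intro!: mult_left_mono\<close>)
  also have "\<dots> = cyl w * integral\<^sup>N \<mu> g" by (rule nn_integral_cmult) measurable
  finally show ?thesis .
qed

lemma nn_integral_wtw_ge:
  assumes "set w \<subseteq> {2..}" and [measurable]: "g \<in> borel_measurable borel"
  shows "cyl w * integral\<^sup>N \<mu> g \<le> 4 * (\<integral>\<^sup>+ x. g x * wtw w x \<partial>\<mu>)"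
proof -
  have "cyl w * integral\<^sup>N \<mu> g = (\<integral>\<^sup>+ x. cyl w * g x \<partial>\<mu>)" by (rule nn_integral_cmult[symmetric]) measurable
  also have "\<dots> \<le> (\<integral>\<^sup>+ x. 4 * (g x * wtw w x) \<partial>\<mu>)"
  proof (rule nn_integral_mono_AE)
    show "AE x in \<mu>. cyl w * g x \<le> 4 * (g x * wtw w x)"
      using AE_J
    proof eventually_elim
      case (elim x)
      have "cyl w * g x \<le> (4 * wtw w x) * g x" by (rule mult_right_mono[OF cyl_le_wtw[OF assms(1) elim]]) simp
      then show ?case by (simp add: mult_ac)
    qed
  qed
  also have "\<dots> = 4 * (\<integral>\<^sup>+ x. g x * wtw w x \<partial>\<mu>)" by (rule nn_integral_cmult) measurable
  finally show ?thesis .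
qed

lemma nn_integral_digs_0:
  "(\<integral>\<^sup>+ x. f (digs n x) \<partial>\<mu>) = (\<integral>\<^sup>+ w. f w * integral\<^sup>N \<mu> (wtw w) \<partial>count_space (prime_words n))"
  using nn_integral_digs[of "\<lambda>_. 1" f n] by simp

lemma nn_integral_wtw_1: "set w \<subseteq> {2..} \<Longrightarrow> integral\<^sup>N \<mu> (wtw w) \<le> cyl w"
  and nn_integral_wtw_1': "set w \<subseteq> {2..} \<Longrightarrow> cyl w \<le> 4 * integral\<^sup>N \<mu> (wtw w)"
  using nn_integral_wtw_le[of w "\<lambda>_. 1"] nn_integral_wtw_ge[of w "\<lambda>_. 1"] by auto

lemma nn_integral_digs_le:
  assumes g [measurable]: "g \<in> borel_measurable borel"
  shows "(\<integral>\<^sup>+ x. f (digs n x) * g ((gauss ^^ n) x) \<partial>\<mu>) \<le> 4 * ((\<integral>\<^sup>+ x. f (digs n x) \<partial>\<mu>) * integral\<^sup>N \<mu> g)"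
proof -
  have "(\<integral>\<^sup>+ x. f (digs n x) * g ((gauss ^^ n) x) \<partial>\<mu>)
     = (\<integral>\<^sup>+ w. f w * (\<integral>\<^sup>+ x. g x * wtw w x \<partial>\<mu>) \<partial>count_space (prime_words n))"
    by (rule nn_integral_digs) fact
  also have "\<dots> \<le> (\<integral>\<^sup>+ w. (f w * integral\<^sup>N \<mu> (wtw w)) * (4 * integral\<^sup>N \<mu> g) \<partial>count_space (prime_words n))"
  proof (rule nn_integral_mono)
    fix w assume "w \<in> space (count_space (prime_words n))"
    then have w: "set w \<subseteq> {2..}" using prime_words_ge2 by auto
    have "(\<integral>\<^sup>+ x. g x * wtw w x \<partial>\<mu>) \<le> cyl w * integral\<^sup>N \<mu> g" by (rule nn_integral_wtw_le[OF w g])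
    also have "\<dots> \<le> (4 * integral\<^sup>N \<mu> (wtw w)) * integral\<^sup>N \<mu> g" by (intro mult_right_mono nn_integral_wtw_1' w) simp
    finally have "f w * (\<integral>\<^sup>+ x. g x * wtw w x \<partial>\<mu>) \<le> f w * ((4 * integral\<^sup>N \<mu> (wtw w)) * integral\<^sup>N \<mu> g)"
      by (rule mult_left_mono) simp
    then show "f w * (\<integral>\<^sup>+ x. g x * wtw w x \<partial>\<mu>) \<le> (f w * integral\<^sup>N \<mu> (wtw w)) * (4 * integral\<^sup>N \<mu> g)"
      by (simp add: mult_ac)
  qed
  also have "\<dots> = (\<integral>\<^sup>+ x. f (digs n x) \<partial>\<mu>) * (4 * integral\<^sup>N \<mu> g)"
    unfolding nn_integral_digs_0 by (rule nn_integral_multc) simp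
  finally show ?thesis by (simp add: mult_ac)
qed

lemma nn_integral_digs_ge:
  assumes g [measurable]: "g \<in> borel_measurable borel"
  shows "(\<integral>\<^sup>+ x. f (digs n x) \<partial>\<mu>) * integral\<^sup>N \<mu> g \<le> 4 * (\<integral>\<^sup>+ x. f (digs n x) * g ((gauss ^^ n) x) \<partial>\<mu>)"
proof -
  have "(\<integral>\<^sup>+ x. f (digs n x) \<partial>\<mu>) * integral\<^sup>N \<mu> g
    = (\<integral>\<^sup>+ w. (f w * integral\<^sup>N \<mu> (wtw w)) * integral\<^sup>N \<mu> g \<partial>count_space (prime_words n))"
    unfolding nn_integral_digs_0 by (rule nn_integral_multc[symmetric]) simp
  also have "\<dots> \<le> (\<integral>\<^sup>+ w. 4 * (f w * (\<integral>\<^sup>+ x. g x * wtw w x \<partial>\<mu>)) \<partial>count_space (prime_words n))"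
  proof (rule nn_integral_mono)
    fix w assume "w \<in> space (count_space (prime_words n))"
    then have w: "set w \<subseteq> {2..}" using prime_words_ge2 by auto
    have "integral\<^sup>N \<mu> (wtw w) * integral\<^sup>N \<mu> g \<le> cyl w * integral\<^sup>N \<mu> g"
      by (intro mult_right_mono nn_integral_wtw_1 w) simp
    also have "\<dots> \<le> 4 * (\<integral>\<^sup>+ x. g x * wtw w x \<partial>\<mu>)" by (rule nn_integral_wtw_ge[OF w g])
    finally have "f w * (integral\<^sup>N \<mu> (wtw w) * integral\<^sup>N \<mu> g) \<le> f w * (4 * (\<integral>\<^sup>+ x. g x * wtw w x \<partial>\<mu>))"
      by (rule mult_left_mono) simp
    then show "(f w * integral\<^sup>N \<mu> (wtw w)) * integral\<^sup>N \<mu> g \<le> 4 * (f w * (\<integral>\<^sup>+ x. g x * wtw w x \<partial>\<mu>))"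
      by (simp add: mult_ac)
  qed
  also have "\<dots> = 4 * (\<integral>\<^sup>+ w. f w * (\<integral>\<^sup>+ x. g x * wtw w x \<partial>\<mu>) \<partial>count_space (prime_words n))"
    by (rule nn_integral_cmult) simp
  also have "(\<integral>\<^sup>+ w. f w * (\<integral>\<^sup>+ x. g x * wtw w x \<partial>\<mu>) \<partial>count_space (prime_words n)) = (\<integral>\<^sup>+ x. f (digs n x) * g ((gauss ^^ n) x) \<partial>\<mu>)"
    by (rule nn_integral_digs[symmetric]) fact
  finally show ?thesis .
qed

lemma emeasure_word_image_le:
  assumes w: "w \<in> prime_words n" and B: "B \<in> sets borel" "B \<subseteq> J"
  shows "emeasure \<mu> (gphi_word w ` B) \<le> cyl w * emeasure \<mu> B"
proof -
  have ge: "set w \<subseteq> {2..}" using w by (rule prime_words_ge2)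
  have im: "gphi_word w ` B \<in> sets borel" using gphi_word_image_borel[OF ge B] .
  have "emeasure \<mu> (gphi_word w ` B) = (\<integral>\<^sup>+ x. 1 * indicator (gphi_word w ` B) x \<partial>\<mu>)" using im by simp
  also have "\<dots> = (\<integral>\<^sup>+ x. 1 * wtw w x * indicator B x \<partial>\<mu>)"
    using w B by (intro nn_integral_word) (auto simp: prime_words_def)
  also have "\<dots> = (\<integral>\<^sup>+ x. indicator B x * wtw w x \<partial>\<mu>)" by (simp add: mult.commute)
  also have "\<dots> \<le> cyl w * (\<integral>\<^sup>+ x. indicator B x \<partial>\<mu>)" using ge B by (intro nn_integral_wtw_le) auto
  also have "\<dots> = cyl w * emeasure \<mu> B" using B by simp
  finally show ?thesis .
qed

lemma emeasure_word_image_ge: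
  assumes w: "w \<in> prime_words n" and B: "B \<in> sets borel" "B \<subseteq> J"
  shows "cyl w * emeasure \<mu> B \<le> 4 * emeasure \<mu> (gphi_word w ` B)"
proof -
  have ge: "set w \<subseteq> {2..}" using w by (rule prime_words_ge2)
  have im: "gphi_word w ` B \<in> sets borel" using gphi_word_image_borel[OF ge B] .
  have "emeasure \<mu> (gphi_word w ` B) = (\<integral>\<^sup>+ x. 1 * indicator (gphi_word w ` B) x \<partial>\<mu>)" using im by simp
  also have "\<dots> = (\<integral>\<^sup>+ x. 1 * wtw w x * indicator B x \<partial>\<mu>)"
    using w B by (intro nn_integral_word) (auto simp: prime_words_def)
  also have "\<dots> = (\<integral>\<^sup>+ x. indicator B x * wtw w x \<partial>\<mu>)" by (simp add: mult.commute)
  finally have eq: "emeasure \<mu> (gphi_word w ` B) = (\<integral>\<^sup>+ x. indicator B x * wtw w x \<partial>\<mu>)" .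
  have "cyl w * emeasure \<mu> B = cyl w * (\<integral>\<^sup>+ x. indicator B x \<partial>\<mu>)" using B by simp
  also have "\<dots> \<le> 4 * (\<integral>\<^sup>+ x. indicator B x * wtw w x \<partial>\<mu>)" using ge B by (intro nn_integral_wtw_ge) auto
  finally show ?thesis unfolding eq .
qed

lemma dig_vimage_borel [measurable]: "{x. dig x \<in> D} \<in> sets borel"
  using measurable_sets[OF measurable_dig, of D] by (simp add: vimage_def)

lemma dig_gauss_borel [measurable]: "{x. digit n x \<in> D} \<in> sets borel"
  using measurable_sets[OF measurable_gauss_pow dig_vimage_borel, of n D] by (simp add: vimage_def)

lemma emeasure_dig_gauss_le: "emeasure \<mu> {x. digit n x \<in> D} \<le> 4 * emeasure \<mu> {x. dig x \<in> D}"
proof -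
  have "emeasure \<mu> {x. digit n x \<in> D} = (\<integral>\<^sup>+ x. indicator {x. digit n x \<in> D} x \<partial>\<mu>)"
    by (rule nn_integral_indicator[symmetric]) simp
  also have "\<dots> = (\<integral>\<^sup>+ x. 1 * indicator {x. dig x \<in> D} ((gauss ^^ n) x) \<partial>\<mu>)"
    by (intro nn_integral_cong) (auto simp: indicator_def)
  also have "\<dots> \<le> 4 * ((\<integral>\<^sup>+ x. 1 \<partial>\<mu>) * (\<integral>\<^sup>+ x. indicator {x. dig x \<in> D} x \<partial>\<mu>))"
    by (rule nn_integral_digs_le) simp
  finally show ?thesis by simp
qed

lemma AE_infinitely_often:
  fixes D :: "nat \<Rightarrow> nat set"
  assumes div: "\<not> summable (\<lambda>n. measure \<mu> {x. dig x \<in> D n})"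
  shows "AE x in \<mu>. \<exists>n\<ge>n0. digit n x \<in> D n"
proof -
  interpret finite_measure \<mu> by (rule finite_mu)
  define p where "p = (\<lambda>n. measure \<mu> {x. dig x \<in> D n})"
  define E where "E m = {x. \<forall>n\<in>{n0..<m}. digit n x \<notin> D n}" for m
  have Eb [measurable]: "E m \<in> sets borel" for m
  proof -
    have "E m = space borel - (\<Union>n\<in>{n0..<m}. {x. digit n x \<in> D n})" by (auto simp: E_def)
    also have "\<dots> \<in> sets borel" by (intro sets.compl_sets sets.finite_UN) auto
    finally show ?thesis .
  qed
  have step: "measure \<mu> (E (Suc m)) \<le> (1 - p m / 4) * measure \<mu> (E m)" if "m \<ge> n0" for m
  proof -
    define f :: "nat list \<Rightarrow> ennreal" where "f w = (if \<forall>n\<in>{n0..<m}. w ! n \<notin> D n then 1 else 0)" for w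
    have f: "f (digs m x) = indicator (E m) x" for x by (auto simp: f_def E_def digs_def)
    let ?B = "{x. digit m x \<in> D m}"
    have "emeasure \<mu> (E m) * emeasure \<mu> {x. dig x \<in> D m} 
      = (\<integral>\<^sup>+ x. f (digs m x) \<partial>\<mu>) * (\<integral>\<^sup>+ x. indicator {x. dig x \<in> D m} x \<partial>\<mu>)" by (simp add: f)
    also have "\<dots> \<le> 4 * (\<integral>\<^sup>+ x. f (digs m x) * indicator {x. dig x \<in> D m} ((gauss ^^ m) x) \<partial>\<mu>)"
      by (rule nn_integral_digs_ge) simp
    also have "(\<integral>\<^sup>+ x. f (digs m x) * indicator {x. dig x \<in> D m} ((gauss ^^ m) x) \<partial>\<mu>) = (\<integral>\<^sup>+ x. indicator (E m \<inter> ?B) x \<partial>\<mu>)"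
      by (intro nn_integral_cong) (auto simp: f indicator_def)
    also have "\<dots> = emeasure \<mu> (E m \<inter> ?B)" by (rule nn_integral_indicator) (simp add: sets.Int)
    finally have "ennreal (measure \<mu> (E m) * p m) \<le> ennreal (4 * measure \<mu> (E m \<inter> ?B))"
      by (simp add: emeasure_eq_measure p_def ennreal_mult)
    then have 1: "measure \<mu> (E m) * p m \<le> 4 * measure \<mu> (E m \<inter> ?B)"
      by (simp add: ennreal_le_iff)
    have "E m = E (Suc m) \<union> (E m \<inter> ?B)" using that by (auto simp: E_def less_Suc_eq)
    moreover have "E (Suc m) \<inter> (E m \<inter> ?B) = {}" using that by (auto simp: E_def)
    ultimately have "measure \<mu> (E m) = measure \<mu> (E (Suc m)) + measure \<mu> (E m \<inter> ?B)"
      by (metis Eb finite_measure_Union sets.Int sets_mu dig_gauss_borel)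
    then show ?thesis using 1 by (simp add: algebra_simps)
  qed
  have p: "0 \<le> p n" "p n \<le> 1" for n
    using emeasure_le_1[of "{x. dig x \<in> D n}"] by (auto simp: p_def emeasure_eq_measure)
  have bound: "measure \<mu> (E (n0 + k)) \<le> exp (- (\<Sum>i<k. p (n0 + i)) / 4)" for k
  proof (induction k)
    case 0
    then show ?case using emeasure_le_1[of "E n0"] by (simp add: emeasure_eq_measure)
  next
    case (Suc k)
    have "measure \<mu> (E (n0 + Suc k)) \<le> (1 - p (n0 + k) / 4) * measure \<mu> (E (n0 + k))" using step[of "n0 + k"] by simp
    also have "\<dots> \<le> exp (- p (n0 + k) / 4) * exp (- (\<Sum>i<k. p (n0 + i)) / 4)"
      using p[of "n0 + k"] exp_ge_add_one_self[of "- p (n0 + k) / 4"] Suc by (intro mult_mono) auto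
    also have "\<dots> = exp (- (\<Sum>i<Suc k. p (n0 + i)) / 4)"
      unfolding exp_add[symmetric] by (rule arg_cong[of _ _ exp]) (simp add: add_divide_distrib diff_divide_distrib)
    finally show ?case .
  qed
  have zero: "measure \<mu> {x. \<forall>n\<ge>n0. digit n x \<notin> D n} \<le> e" if e: "e > 0" for e
  proof -
    have "\<exists>k. (\<Sum>i<k. p (n0 + i)) > - 4 * ln e"
    proof (rule ccontr)
      assume "\<not> ?thesis"
      then have "summable (\<lambda>i. p (i + n0))" using p
        by (intro bounded_imp_summable[of _ "- 4 * ln e"])
           (auto simp: not_less add.commute lessThan_Suc_atMost[symmetric] simp del: sum.lessThan_Suc)
      then show False using div summable_iff_shift[of p n0] by (simp add: p_def)
    qed
    then obtain k where k: "(\<Sum>i<k. p (n0 + i)) > - 4 * ln e" by blast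
    have "measure \<mu> {x. \<forall>n\<ge>n0. digit n x \<notin> D n} \<le> measure \<mu> (E (n0 + k))"
      by (intro finite_measure_mono) (auto simp: E_def)
    also have "\<dots> \<le> exp (- (\<Sum>i<k. p (n0 + i)) / 4)" by (rule bound)
    also have "\<dots> \<le> exp (ln e)" using k by simp
    finally show ?thesis using e by simp
  qed
  let ?N = "{x. \<forall>n\<ge>n0. digit n x \<notin> D n}"
  have "measure \<mu> ?N \<le> 0" by (rule field_le_epsilon) (use zero in auto)
  then have "measure \<mu> ?N = 0" by (simp add: measure_le_0_iff)
  then have "emeasure \<mu> ?N = 0" by (simp add: emeasure_eq_measure)
  moreover have "?N \<in> sets \<mu>"
  proof -
    have "?N = space borel - (\<Union>n\<in>{n0..}. {x. digit n x \<in> D n})" by auto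
    also have "\<dots> \<in> sets borel" by (intro sets.compl_sets sets.countable_UN') auto
    finally show ?thesis by simp
  qed
  ultimately have "AE x in \<mu>. x \<notin> ?N" by (simp add: AE_iff_null null_setsI)
  then show ?thesis by (elim eventually_mono) auto
qed

section \<open>Digit statistics\<close>


abbreviation tail :: "nat \<Rightarrow> real" where "tail N \<equiv> measure \<mu> {x. dig x \<in> {N..}}"

lemma measure_dig_tail_le:
  "\<exists>C>0. \<forall>N\<ge>2. tail N \<le> C * (real N powr (1 - 2 * \<delta>) / ln (real N))"
proof -
  define C where "C = 8 / (1 - 2 powr (1 - 2 * \<delta>))"
  have C: "C > 0" using delta_gt_half powr_less_mono[of "1 - 2*\<delta>" 0 "2::real"] by (auto simp: C_def)
  have "tail N \<le> C * (real N powr (1 - 2 * \<delta>) / ln (real N))" if N: "N \<ge> 2" for N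
  proof -
    have "emeasure \<mu> {x. dig x \<in> {N..}} \<le> ennreal (C * (real N powr (1 - 2 * \<delta>) / ln (real N)))"
    proof (rule emeasure_dig_le)
      fix F assume "finite F" "F \<subseteq> {N..}" "\<forall>p\<in>F. prime p"
      then show "(\<Sum>p\<in>F. real p powr (- 2 * \<delta>)) \<le> C * (real N powr (1 - 2 * \<delta>) / ln (real N))"
        using sum_primes_tail_le[of "real N" "2 * \<delta>" F] N delta_gt_half unfolding C_def by auto
    qed (use delta_gt_half in simp)
    then show ?thesis using N C by (simp add: finite_measure.emeasure_eq_measure[OF finite_mu])
  qed
  then show ?thesis using C by blast
qed

lemma measure_dig_tail_ge:
  assumes N: "N \<ge> 1000"
  shows "real N powr (1 - 2 * \<delta>) / ln (real N) \<le> 2000 powr (2 * \<delta>) * tail N"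
proof -
  let ?F = "primes_between (real N) (1000 * real N)"
  have "2000 powr (- (2 * \<delta>)) * (real N powr (1 - 2 * \<delta>) / ln (real N)) = (2000 * real N) powr (- (2 * \<delta>)) * (real N / ln (real N))"
    using N powr_add[of "real N" 1 "- (2 * \<delta>)"] by (simp add: powr_mult)
  also have "\<dots> \<le> (\<Sum>p\<in>?F. (real p + 1/2) powr (- (2 * \<delta>)))"
    using N delta_gt_half by (intro sum_primes_between_ge) auto
  finally have 1: "2000 powr (- (2 * \<delta>)) * (real N powr (1 - 2 * \<delta>) / ln (real N)) \<le> (\<Sum>p\<in>?F. (real p + 1/2) powr (- (2 * \<delta>)))" .
  have "ennreal (\<Sum>p\<in>?F. (real p + 1/2) powr (- (2 * \<delta>))) \<le> emeasure \<mu> {x. dig x \<in> ?F}"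
  proof (rule emeasure_dig_ge)
    show "finite ?F" by (rule finite_primes_between)
  qed (use delta_gt_half in auto)
  also have "\<dots> \<le> emeasure \<mu> {x. dig x \<in> {N..}}"
  proof (rule emeasure_mono)
    show "{x. dig x \<in> ?F} \<subseteq> {x. dig x \<in> {N..}}" by auto
  qed simp
  finally have "(\<Sum>p\<in>?F. (real p + 1/2) powr (- (2 * \<delta>))) \<le> tail N"
    by (simp add: finite_measure.emeasure_eq_measure[OF finite_mu])
  then have "2000 powr (- (2 * \<delta>)) * (real N powr (1 - 2 * \<delta>) / ln (real N)) \<le> tail N"
    using 1 by linarith
  then have "2000 powr (2 * \<delta>) * (2000 powr (- (2 * \<delta>)) * (real N powr (1 - 2 * \<delta>) / ln (real N)))
      \<le> 2000 powr (2 * \<delta>) * tail N"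
    by (rule mult_left_mono) simp
  moreover have "(2000::real) powr (2 * \<delta>) * 2000 powr (- (2 * \<delta>)) = 1" by (simp add: powr_add[symmetric])
  ultimately show ?thesis unfolding mult.assoc[symmetric] by (simp only: mult_1)
qed

lemma emeasure_dig_near_le:
  "\<exists>C>0. \<forall>D q R. (\<forall>a\<in>D. prime a) \<longrightarrow> q \<in> D \<longrightarrow> (\<exists>a\<in>D. a \<noteq> q) \<longrightarrow> (\<forall>a\<in>D. \<bar>1 / real a - 1 / real q\<bar> \<le> R) \<longrightarrow>
     emeasure \<mu> {x. dig x \<in> D} \<le> ennreal (C * R powr \<delta> * (real q powr (1 - \<delta>) / ln (real q)))"
proof -
  obtain C where C: "C > 0" and near: "\<And>D q R. finite D \<Longrightarrow> (\<forall>a\<in>D. prime a) \<Longrightarrow> q \<in> D \<Longrightarrow> (\<exists>a\<in>D. a \<noteq> q) \<Longrightarrow>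
     (\<forall>a\<in>D. \<bar>1 / real a - 1 / real q\<bar> \<le> R) \<Longrightarrow>
     (\<Sum>a\<in>D. real a powr (- 2 * \<delta>)) \<le> C * R powr \<delta> * (real q powr (1 - \<delta>) / ln (real q))"
    using sum_primes_near_le[OF delta_gt_half delta_lt_1] by blast
  have "emeasure \<mu> {x. dig x \<in> D} \<le> ennreal (C * R powr \<delta> * (real q powr (1 - \<delta>) / ln (real q)))"
    if D: "\<forall>a\<in>D. prime a" "q \<in> D" "b \<in> D" "b \<noteq> q" and R: "\<forall>a\<in>D. \<bar>1 / real a - 1 / real q\<bar> \<le> R" for D q R b
  proof (rule emeasure_dig_le)
    fix F assume F: "finite F" "F \<subseteq> D" "\<forall>p\<in>F. prime p"
    have "(\<Sum>p\<in>F. real p powr (- 2 * \<delta>)) \<le> (\<Sum>p\<in>F \<union> {q, b}. real p powr (- 2 * \<delta>))"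
      using F by (intro sum_mono2) auto
    also have "\<dots> \<le> C * R powr \<delta> * (real q powr (1 - \<delta>) / ln (real q))"
      using F D R by (intro near) auto
    finally show "(\<Sum>p\<in>F. real p powr (- 2 * \<delta>)) \<le> C * R powr \<delta> * (real q powr (1 - \<delta>) / ln (real q))" .
  qed (use delta_gt_half in simp)
  then show ?thesis using C by blast
qed

lemma emeasure_singleton: "x \<in> prime_cf \<Longrightarrow> emeasure \<mu> {x} = 0"
proof -
  assume x: "x \<in> prime_cf"
  have le: "emeasure \<mu> {x} \<le> ennreal ((1/2) ^ n)" for n
  proof -
    let ?w = "digs n x"
    have w: "?w \<in> prime_words n" by (rule prime_cf_digs_word[OF x])
    have "{x} = gphi_word ?w ` {(gauss ^^ n) x}" using prime_cf_digs[OF x] by simp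
    then have "emeasure \<mu> {x} \<le> cyl ?w * emeasure \<mu> {(gauss ^^ n) x}"
      using emeasure_word_image_le[OF w, of "{(gauss ^^ n) x}"] prime_cf_J[OF x] by simp
    also have "\<dots> \<le> cyl ?w * 1" by (intro mult_left_mono emeasure_le_1) simp
    also have "\<dots> = ennreal (den ?w 0 powr (- (2 * \<delta>)))" by (simp add: cyl_def)
    also have "\<dots> \<le> ennreal ((1/2) ^ n)"
    proof (rule ennreal_leI)
      have d: "2 ^ n \<le> den ?w 0" using den_ge_power[OF prime_words_ge2[OF w], of 0] by simp
      then have d1: "1 \<le> den ?w 0" by (rule order_trans[rotated]) simp
      have "den ?w 0 powr (- (2 * \<delta>)) \<le> den ?w 0 powr (- 1)" using delta_gt_half d1 by (intro powr_mono) auto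
      also have "\<dots> \<le> (2 ^ n) powr (- 1)" using d by (intro powr_mono2') auto
      also have "\<dots> = (1/2) ^ n" by (simp add: powr_minus power_one_over inverse_eq_divide)
      finally show "den ?w 0 powr (- (2 * \<delta>)) \<le> (1/2) ^ n" .
    qed
    finally show ?thesis .
  qed
  have "(\<lambda>n. ennreal ((1/2) ^ n)) \<longlonglongrightarrow> ennreal 0" by (intro tendsto_ennrealI LIMSEQ_power_zero) simp
  then have "emeasure \<mu> {x} \<le> ennreal 0" by (rule LIMSEQ_le_const) (use le in auto)
  then show ?thesis by simp
qed

lemma nn_integral_dig_powr_finite:
  assumes "e < 2 * \<delta> - 1"
  shows "(\<integral>\<^sup>+ x. ennreal (real (dig x) powr e) \<partial>\<mu>) < \<infinity>"
proof -
  have "(\<integral>\<^sup>+ x. ennreal (real (dig x) powr e) \<partial>\<mu>)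
    = (\<integral>\<^sup>+ x. \<integral>\<^sup>+ a. ennreal (real a powr e) * indicator {x. dig x \<in> {a}} x \<partial>count_space UNIV \<partial>\<mu>)"
  proof (rule nn_integral_cong)
    fix x
    have "(\<integral>\<^sup>+ a. ennreal (real a powr e) * indicator {x. dig x \<in> {a}} x \<partial>count_space UNIV)
      = (\<integral>\<^sup>+ a. ennreal (real a powr e) * indicator {dig x} a \<partial>count_space UNIV)"
      by (intro nn_integral_cong) (auto simp: indicator_def)
    then show "ennreal (real (dig x) powr e) = (\<integral>\<^sup>+ a. ennreal (real a powr e) * indicator {x. dig x \<in> {a}} x \<partial>count_space UNIV)"
      by (subst (asm) nn_integral_indicator_singleton) auto
  qed
  also have "\<dots> = (\<integral>\<^sup>+ a. \<integral>\<^sup>+ x. ennreal (real a powr e) * indicator {x. dig x \<in> {a}} x \<partial>\<mu> \<partial>count_space UNIV)"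
    by (rule nn_integral_count_space_nn_integral) auto
  also have "\<dots> = (\<integral>\<^sup>+ a. ennreal (real a powr e) * emeasure \<mu> {x. dig x \<in> {a}} \<partial>count_space UNIV)"
    by (intro nn_integral_cong nn_integral_cmult_indicator) (simp only: sets_mu dig_vimage_borel)
  also have "\<dots> \<le> (\<integral>\<^sup>+ a. ennreal (real a powr (e - 2 * \<delta>)) \<partial>count_space UNIV)"
  proof (rule nn_integral_mono)
    fix a :: nat
    have "emeasure \<mu> {x. dig x \<in> {a}} \<le> ennreal (real a powr (- 2 * \<delta>))"
    proof (rule emeasure_dig_le)
      fix F assume "finite F" "F \<subseteq> {a}"
      then have "F = {} \<or> F = {a}" by auto
      then show "(\<Sum>p\<in>F. real p powr (- 2 * \<delta>)) \<le> real a powr (- 2 * \<delta>)" by auto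
    qed (use delta_gt_half in simp)
    then have "ennreal (real a powr e) * emeasure \<mu> {x. dig x \<in> {a}} \<le> ennreal (real a powr e) * ennreal (real a powr (- 2 * \<delta>))"
      by (rule mult_left_mono) simp
    also have "\<dots> = ennreal (real a powr (e - 2 * \<delta>))"
      by (simp add: ennreal_mult[symmetric] powr_add[symmetric])
    finally show "ennreal (real a powr e) * emeasure \<mu> {x. dig x \<in> {a}} \<le> ennreal (real a powr (e - 2 * \<delta>))" .
  qed
  also have "\<dots> = (\<Sum>a. ennreal (real a powr (e - 2 * \<delta>)))" by (rule nn_integral_count_space_nat)
  also have "\<dots> = ennreal (\<Sum>a. real a powr (e - 2 * \<delta>))"
    using assms by (intro suminf_ennreal2) (auto simp: summable_real_powr_iff)
  also have "\<dots> < \<infinity>" by simp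
  finally show ?thesis .
qed

lemma AE_prod_digs_le:
  "\<exists>C>0. AE x in \<mu>. \<forall>\<^sub>F n in sequentially. prod_list (map real (digs n x)) \<le> exp (C * real n)"
proof -
  interpret finite_measure \<mu> by (rule finite_mu)
  define e where "e = (2 * \<delta> - 1) / 2"
  have e: "0 < e" "e < 2 * \<delta> - 1" using delta_gt_half by (auto simp: e_def)
  define g where "g x = ennreal (real (dig x) powr e)" for x
  have g [measurable]: "g \<in> borel_measurable borel" unfolding g_def by measurable
  define h where "h w = ennreal (prod_list (map real w) powr e)" for w
  have h_app: "h (w @ [a]) = h w * ennreal (real a powr e)" for w a
    by (auto simp: h_def powr_mult ennreal_mult[symmetric])
  obtain M where M: "M \<ge> 1" "4 * integral\<^sup>N \<mu> g \<le> ennreal M"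
  proof -
    have "4 * integral\<^sup>N \<mu> g < \<infinity>" using nn_integral_dig_powr_finite[OF e(2)] 
      by (simp add: g_def[abs_def] ennreal_mult_less_top)
    then obtain r where "4 * integral\<^sup>N \<mu> g = ennreal r" "r \<ge> 0" by (metis ennreal_cases infinity_ennreal_def less_irrefl)
    then show ?thesis using that[of "max 1 r"] by (simp add: ennreal_leI)
  qed
  have hn: "(\<integral>\<^sup>+ x. h (digs n x) \<partial>\<mu>) \<le> ennreal (M ^ n)" for n
  proof (induction n)
    case (Suc n)
    have "(\<integral>\<^sup>+ x. h (digs (Suc n) x) \<partial>\<mu>) = (\<integral>\<^sup>+ x. h (digs n x) * g ((gauss ^^ n) x) \<partial>\<mu>)"
      by (simp add: digs_Suc h_app g_def)
    also have "\<dots> \<le> 4 * ((\<integral>\<^sup>+ x. h (digs n x) \<partial>\<mu>) * integral\<^sup>N \<mu> g)" by (rule nn_integral_digs_le) fact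
    also have "\<dots> = (\<integral>\<^sup>+ x. h (digs n x) \<partial>\<mu>) * (4 * integral\<^sup>N \<mu> g)" by (simp add: mult_ac)
    also have "\<dots> \<le> ennreal (M ^ n) * ennreal M" by (intro mult_mono Suc M) auto
    also have "\<dots> = ennreal (M ^ Suc n)" using M by (simp add: ennreal_mult[symmetric] mult.commute)
    finally show ?case .
  qed (simp add: h_def)
  define A where "A n = {x. 1 \<le> ennreal (1 / (2 * M) ^ n) * h (digs n x)}" for n
  have hm: "(\<lambda>x. h (digs n x)) \<in> borel_measurable borel" for n
    by (rule measurable_compose[OF measurable_digs]) simp
  have A [measurable]: "A n \<in> sets \<mu>" for n
    unfolding A_def sets_mu using hm[of n] by measurable
  have emA: "emeasure \<mu> (A n) \<le> ennreal ((1/2) ^ n)" for n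
  proof -
    have "emeasure \<mu> {x \<in> UNIV. 1 \<le> ennreal (1 / (2 * M) ^ n) * h (digs n x)}
       \<le> ennreal (1 / (2 * M) ^ n) * (\<integral>\<^sup>+ x. h (digs n x) * indicator UNIV x \<partial>\<mu>)"
      by (rule nn_integral_Markov_inequality) (use hm[of n] in auto)
    then have "emeasure \<mu> (A n) \<le> ennreal (1 / (2 * M) ^ n) * (\<integral>\<^sup>+ x. h (digs n x) \<partial>\<mu>)" by (simp add: A_def)
    also have "\<dots> \<le> ennreal (1 / (2 * M) ^ n) * ennreal (M ^ n)" by (intro mult_left_mono hn) simp
    also have "\<dots> = ennreal ((1/2) ^ n)" using M by (simp add: ennreal_mult[symmetric] power_mult_distrib power_one_over)
    finally show ?thesis .
  qed
  have "AE x in \<mu>. \<forall>\<^sub>F n in sequentially. x \<in> space \<mu> - A n"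
  proof (rule borel_cantelli_AE1)
    show "summable (\<lambda>n. measure \<mu> (A n))"
    proof (rule summable_comparison_test')
      show "summable (\<lambda>n. (1/2::real) ^ n)" by (simp add: summable_geometric)
      show "norm (measure \<mu> (A n)) \<le> (1/2) ^ n" for n using emA[of n] by (simp add: emeasure_eq_measure)
    qed
  qed (use A in \<open>auto simp: emeasure_eq_measure simp del: sets_mu\<close>)
  moreover define C where "C = ln (2 * M) / e"
  have C: "C > 0" using M e by (simp add: C_def)
  have "prod_list (map real (digs n x)) \<le> exp (C * real n)" if "x \<notin> A n" for n x
  proof -
    define q where "q = prod_list (map real (digs n x))"
    have q0: "q \<ge> 0" unfolding q_def by (intro prod_list_nonneg) auto
    have "ennreal (1 / (2 * M) ^ n) * h (digs n x) < 1" using that by (auto simp: A_def not_le)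
    moreover have "ennreal (1 / (2 * M) ^ n * q powr e) = ennreal (1 / (2 * M) ^ n) * h (digs n x)"
      unfolding h_def q_def using M by (intro ennreal_mult) auto
    ultimately have "ennreal (1 / (2 * M) ^ n * q powr e) < ennreal 1" by simp
    then have "1 / (2 * M) ^ n * q powr e < 1" by (simp add: ennreal_less_iff)
    then have 1: "q powr e < (2 * M) ^ n" using M by (simp add: field_simps)
    show "q \<le> exp (C * real n)"
    proof (cases "q = 0")
      case False
      then have q: "q > 0" using q0 by simp
      have "ln (q powr e) < ln ((2 * M) ^ n)" using 1 q M by (subst ln_less_cancel_iff) auto
      moreover have "ln ((2 * M) ^ n) = real n * ln (2 * M)" by (rule ln_realpow)
      ultimately have "e * ln q < real n * ln (2 * M)" using q by (simp only: ln_powr)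
      then have "ln q < C * real n" using e by (simp add: C_def field_simps)
      then show ?thesis using q by (metis exp_le_cancel_iff exp_ln less_imp_le)
    qed simp
  qed
  then have "AE x in \<mu>. \<forall>\<^sub>F n in sequentially. prod_list (map real (digs n x)) \<le> exp (C * real n)"
    using calculation by (auto elim!: eventually_mono)
  then show ?thesis using C by blast
qed

end

definition ratio :: "real \<Rightarrow> nat \<Rightarrow> real" where
  "ratio d q = real q powr (1 - d) / ln (real q)"

lemma gphi_word_image_subset: "set w \<subseteq> {2..} \<Longrightarrow> B \<subseteq> J \<Longrightarrow> gphi_word w ` B \<subseteq> J"
  using gphi_word_in_J by blast

lemma bounded_subset_J: "U \<subseteq> J \<Longrightarrow> bounded U"
  by (rule bounded_subset[of "{0..1}"]) (auto simp: J_def)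

lemma inverse_diff_le_gphi_diff:
  assumes "prime a" "prime q" "x \<in> J" "y \<in> J" "a \<noteq> q"
  shows "\<bar>1 / real a - 1 / real q\<bar> \<le> 9/2 * \<bar>gphi a x - gphi q y\<bar>"
proof -
  have a: "real a \<ge> 2" "real q \<ge> 2" using assms prime_ge_2_nat[of a] prime_ge_2_nat[of q] by auto
  have xy: "0 < x" "x \<le> 1/2" "0 < y" "y \<le> 1/2" using assms by (auto simp: J_def)
  have ne: "\<bar>real a - real q\<bar> \<ge> 1" using assms(5) by linarith
  have "\<bar>1 / real a - 1 / real q\<bar> = \<bar>real a - real q\<bar> / (real a * real q)"
    using a by (simp add: divide_simps abs_minus_commute abs_mult)
  also have "\<dots> \<le> (2 * \<bar>(real q + y) - (real a + x)\<bar>) / (4/9 * ((real a + x) * (real q + y)))"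
  proof (rule frac_le)
    show "\<bar>real a - real q\<bar> \<le> 2 * \<bar>(real q + y) - (real a + x)\<bar>" 
    proof -
      have "\<bar>y - x\<bar> \<le> 1/2" using xy by linarith
      moreover have "\<bar>real a - real q\<bar> \<le> \<bar>(real q + y) - (real a + x)\<bar> + \<bar>y - x\<bar>" by linarith
      moreover have "k \<le> 2 * m" if "e \<le> 1/2" "k \<le> m + e" "1 \<le> k" for k m e :: real using that by linarith
      ultimately show ?thesis using ne by blast
    qed
    have "(real a + x) * (real q + y) \<le> (3/2 * real a) * (3/2 * real q)"
      using a xy by (intro mult_mono) auto
    then show "4/9 * ((real a + x) * (real q + y)) \<le> real a * real q" by simp
    show "0 < 4/9 * ((real a + x) * (real q + y))" using a xy by (auto intro!: mult_pos_pos add_pos_pos)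
  qed auto
  also have "\<dots> = 9/2 * (\<bar>(real q + y) - (real a + x)\<bar> / ((real a + x) * (real q + y)))" by simp
  also have "\<bar>(real q + y) - (real a + x)\<bar> / ((real a + x) * (real q + y)) = \<bar>gphi a x - gphi q y\<bar>"
  proof -
    have pos: "real a + x > 0" "real q + y > 0" using a xy by auto
    then have "gphi a x - gphi q y = ((real q + y) - (real a + x)) / ((real a + x) * (real q + y))"
      by (simp add: gphi_def divide_simps)
    then show ?thesis using pos by (simp add: abs_mult)
  qed
  finally show ?thesis .
qed

lemma digs_eq_imp_close:
  assumes "x \<in> prime_cf" "y \<in> prime_cf" "digs n x = digs n y"
  shows "\<bar>x - y\<bar> \<le> (1/4) ^ n"
proof -
  let ?w = "digs n x"
  have w: "set ?w \<subseteq> {2..}" using prime_cf_digs_word[OF assms(1)] prime_words_ge2 by blast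
  define u v where "u = (gauss ^^ n) x" and "v = (gauss ^^ n) y"
  have uv: "u \<in> J" "v \<in> J" using prime_cf_J assms by (auto simp: u_def v_def)
  have xy: "x = gphi_word ?w u" "y = gphi_word ?w v"
    using prime_cf_digs[OF assms(1), of n] prime_cf_digs[OF assms(2), of n] assms(3) by (auto simp: u_def v_def)
  have "\<bar>x - y\<bar> \<le> \<bar>u - v\<bar> / (den ?w 0)\<^sup>2"
    using gphi_word_diff_le[OF w, of u v] uv xy by (auto simp: J_def)
  also have "\<dots> \<le> 1 / (2 ^ n)\<^sup>2"
    using den_ge_power[OF w, of 0] uv by (intro frac_le power_mono) (auto simp: J_def)
  also have "\<dots> = (1/4) ^ n" by (simp add: power2_eq_square power_one_over flip: power_mult_distrib)
  finally show ?thesis .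
qed

lemma prime_cf_eqI:
  assumes "x \<in> prime_cf" "y \<in> prime_cf" "\<And>n. digit n x = digit n y"
  shows "x = y"
proof -
  have "\<bar>x - y\<bar> \<le> (1/4) ^ n" for n
    using digs_eq_imp_close[OF assms(1,2), of n] assms(3) by (simp add: digs_def)
  then have "\<bar>x - y\<bar> \<le> 0"
    by (intro LIMSEQ_le_const[OF LIMSEQ_power_zero[of "1/4::real"]]) auto
  then show ?thesis by simp
qed

context prime_conformal
begin

text \<open>Every set of at least two limit points is contained in a union of sibling cylinders, taken below
  the longest common prefix of the digit sequences.\<close>
lemma small_set_bound:
  "\<exists>C>0. \<forall>U x. U \<subseteq> prime_cf \<longrightarrow> x \<in> U \<longrightarrow> (\<exists>y\<in>U. y \<noteq> x) \<longrightarrow>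
     (\<exists>n W. W \<in> sets borel \<and> U \<subseteq> W \<and> 0 < diameter U \<and> diameter U \<le> (1/4) ^ n \<and>
        emeasure \<mu> W \<le> ennreal (C * diameter U powr \<delta> * ratio \<delta> (digit n x)))"
proof -
  obtain C where C: "C > 0" and near: "\<And>D q R. (\<forall>a\<in>D. prime a) \<Longrightarrow> q \<in> D \<Longrightarrow> (\<exists>a\<in>D. a \<noteq> q) \<Longrightarrow> (\<forall>a\<in>D. \<bar>1 / real a - 1 / real q\<bar> \<le> R) \<Longrightarrow>
     emeasure \<mu> {x. dig x \<in> D} \<le> ennreal (C * R powr \<delta> * ratio \<delta> q)"
    using emeasure_dig_near_le unfolding ratio_def by blast
  have "\<exists>n W. W \<in> sets borel \<and> U \<subseteq> W \<and> 0 < diameter U \<and> diameter U \<le> (1/4) ^ n \<and>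
        emeasure \<mu> W \<le> ennreal (18 * C * diameter U powr \<delta> * ratio \<delta> (digit n x))"
    if U: "U \<subseteq> prime_cf" "x \<in> U" "y \<in> U" "y \<noteq> x" for U x y
  proof -
    have bU: "bounded U" using U(1) prime_cf_subset by (intro bounded_subset_J) auto
    define d where "d = diameter U"
    have dle: "\<bar>a - b\<bar> \<le> d" if "a \<in> U" "b \<in> U" for a b
      using diameter_bounded_bound[OF bU that] by (simp add: d_def dist_real_def)
    have d0: "d > 0" using dle[OF U(3,2)] U(4) by linarith
    define P where "P n \<longleftrightarrow> (\<exists>a\<in>U. digit n a \<noteq> digit n x)" for n
    have "\<exists>n. P n"
    proof (rule ccontr)
      assume "\<not> ?thesis"
      then have "\<And>n. digit n y = digit n x" using U(3) by (auto simp: P_def)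
      then have "y = x" using U by (intro prime_cf_eqI) auto
      then show False using U(4) by simp
    qed
    define n where "n = (LEAST n. P n)"
    have Pn: "P n" unfolding n_def by (rule LeastI_ex) fact
    have "\<not> P m" if "m < n" for m using that not_less_Least unfolding n_def by blast
    then have digs_eq: "digs n a = digs n x" if "a \<in> U" for a
      using that by (auto simp: digs_def P_def)
    define w where "w = digs n x"
    have w: "w \<in> prime_words n" using prime_cf_digs_word[of x n] U by (auto simp: w_def)
    have wge: "set w \<subseteq> {2..}" using w by (rule prime_words_ge2)
    define q where "q = digit n x"
    define D where "D = (\<lambda>a. digit n a) ` U"
    have dn: "den w 0 > 0" using den_pos[OF wge] by simp
    define R where "R = 18 * (den w 0)\<^sup>2 * d"
    have R: "\<bar>1 / real a - 1 / real q\<bar> \<le> R" if a: "a \<in> D" for a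
    proof (cases "a = q")
      case False
      obtain z where z: "z \<in> U" "a = digit n z" using a by (auto simp: D_def)
      define u v where "u = (gauss ^^ n) z" and "v = (gauss ^^ n) x"
      have uv: "u \<in> J" "v \<in> J" "gauss u \<in> J" "gauss v \<in> J"
        using prime_cf_J[of z n] prime_cf_J[of x n] prime_cf_J[of z "Suc n"] prime_cf_J[of x "Suc n"] z U
        by (auto simp: u_def v_def)
      have zx: "z = gphi_word w u" "x = gphi_word w v"
        using prime_cf_digs[of z n] prime_cf_digs[of x n] digs_eq[OF z(1)] z U by (auto simp: u_def v_def w_def)
      have "\<bar>1 / real a - 1 / real q\<bar> \<le> 9/2 * \<bar>gphi a (gauss u) - gphi q (gauss v)\<bar>"
        using False uv z U prime_cf_prime by (intro inverse_diff_le_gphi_diff) (auto simp: q_def)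
      also have "\<dots> = 9/2 * \<bar>u - v\<bar>"
        using gphi_dig_gauss[OF uv(1)] gphi_dig_gauss[OF uv(2)] by (simp add: z(2) q_def u_def v_def)
      also have "\<bar>u - v\<bar> \<le> (4 * (den w 0)\<^sup>2) * d"
      proof -
        have "\<bar>u - v\<bar> / (4 * (den w 0)\<^sup>2) \<le> \<bar>z - x\<bar>"
          using gphi_word_diff_ge[OF wge, of u v] uv unfolding zx by (auto simp: J_def)
        also have "\<dots> \<le> d" using dle z U by blast
        finally show ?thesis using dn by (simp add: field_simps)
      qed
      finally show ?thesis by (simp add: R_def mult_ac)
    qed (use d0 in \<open>simp add: R_def\<close>)
    define B where "B = {x. dig x \<in> D} \<inter> J"
    have B: "B \<in> sets borel" "B \<subseteq> J" by (auto simp: B_def)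
    have "U \<subseteq> gphi_word w ` B"
    proof
      fix a assume a: "a \<in> U"
      then have "a = gphi_word w ((gauss ^^ n) a)"
        using prime_cf_digs[of a n] digs_eq[OF a] U by (auto simp: w_def)
      moreover have "(gauss ^^ n) a \<in> B" using a U prime_cf_J by (auto simp: B_def D_def)
      ultimately show "a \<in> gphi_word w ` B" by blast
    qed
    moreover have "gphi_word w ` B \<in> sets borel" by (rule gphi_word_image_borel[OF wge B])
    moreover have "d \<le> (1/4) ^ n" unfolding d_def
    proof (rule diameter_le)
      fix a b assume ab: "a \<in> U" "b \<in> U"
      have "digs n a = digs n b" using digs_eq[OF ab(1)] digs_eq[OF ab(2)] by (rule trans[OF _ sym])
      then show "norm (a - b) \<le> (1/4) ^ n"
        using digs_eq_imp_close[of a b n] subsetD[OF U(1) ab(1)] subsetD[OF U(1) ab(2)] by simp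
    qed (use U in auto)
    moreover have "emeasure \<mu> (gphi_word w ` B) \<le> ennreal (18 * C * d powr \<delta> * ratio \<delta> q)"
    proof -
      have q2: "q \<ge> 2" using prime_cf_prime[of x n] U prime_ge_2_nat by (auto simp: q_def)
      then have F0: "ratio \<delta> q \<ge> 0" by (simp add: ratio_def)
      have "emeasure \<mu> B \<le> emeasure \<mu> {x. dig x \<in> D}" by (intro emeasure_mono) (auto simp: B_def)
      also have "\<dots> \<le> ennreal (C * R powr \<delta> * ratio \<delta> q)"
        using R Pn U prime_cf_prime by (intro near) (auto simp: D_def P_def q_def)
      finally have B: "emeasure \<mu> B \<le> ennreal (C * R powr \<delta> * ratio \<delta> q)" .
      have "emeasure \<mu> (gphi_word w ` B) \<le> cyl w * emeasure \<mu> B"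
        by (rule emeasure_word_image_le[OF w]) (auto simp: B_def)
      also have "\<dots> \<le> cyl w * ennreal (C * R powr \<delta> * ratio \<delta> q)" by (rule mult_left_mono[OF B]) simp
      also have "\<dots> = ennreal (den w 0 powr (- (2 * \<delta>)) * (C * R powr \<delta> * ratio \<delta> q))"
        unfolding cyl_def using C F0 by (intro ennreal_mult[symmetric]) auto
      also have "\<dots> \<le> ennreal (18 * C * d powr \<delta> * ratio \<delta> q)"
      proof (rule ennreal_leI)
        have "R powr \<delta> = 18 powr \<delta> * (den w 0 powr (2 * \<delta>)) * d powr \<delta>"
          using dn powr_powr[of "den w 0" 2 \<delta>] by (simp add: R_def powr_mult)
        then have "den w 0 powr (- (2 * \<delta>)) * (C * R powr \<delta> * ratio \<delta> q)
          = (den w 0 powr (- (2 * \<delta>)) * den w 0 powr (2 * \<delta>)) * 18 powr \<delta> * (C * d powr \<delta> * ratio \<delta> q)" by (simp add: mult_ac)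
        also have "den w 0 powr (- (2 * \<delta>)) * den w 0 powr (2 * \<delta>) = 1"
          using dn by (simp add: powr_add[symmetric])
        also have "1 * 18 powr \<delta> * (C * d powr \<delta> * ratio \<delta> q) \<le> 18 powr 1 * (C * d powr \<delta> * ratio \<delta> q)"
          using C F0 delta_lt_1 unfolding mult_1 by (intro mult_right_mono powr_mono) auto
        finally show "den w 0 powr (- (2 * \<delta>)) * (C * R powr \<delta> * ratio \<delta> q) \<le> 18 * C * d powr \<delta> * ratio \<delta> q" by simp
      qed
      finally show ?thesis .
    qed
    ultimately show ?thesis using d0 unfolding d_def q_def by blast
  qed
  then show ?thesis using C by (intro exI[of _ "18 * C"]) auto
qed

section \<open>Hausdorff measure criteria\<close>


lemma hausdorff_ge_of_summable:
  fixes \<psi> \<Psi> :: "real \<Rightarrow> real"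
  assumes psi: "\<And>r. r > 0 \<Longrightarrow> \<psi> r = r powr \<delta> * \<Psi> r"
    and psi_mono: "\<And>a b. 0 < a \<Longrightarrow> a \<le> b \<Longrightarrow> \<psi> a \<le> \<psi> b"
    and anti: "\<And>a b. 0 < a \<Longrightarrow> a \<le> b \<Longrightarrow> \<Psi> b \<le> \<Psi> a"
    and unb: "\<And>Y. \<exists>r>0. Y \<le> \<Psi> r"
  obtains C where "C > 0"
    "\<And>K N n1 A. K > 0 \<Longrightarrow> summable (\<lambda>n. tail (N n)) \<Longrightarrow>
      (\<forall>n\<ge>n1. \<forall>q. 2 \<le> q \<and> q < N n \<longrightarrow> K * ratio \<delta> q \<le> \<Psi> ((1/4) ^ n)) \<Longrightarrow>
      A \<in> sets \<mu> \<Longrightarrow> emeasure \<mu> (UNIV - A) = 0 \<Longrightarrow> ennreal (K / C) \<le> hausdorff_psi \<psi> A"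
proof -
  interpret finite_measure \<mu> by (rule finite_mu)
  obtain C where C: "C > 0" and small: "\<And>U x. U \<subseteq> prime_cf \<Longrightarrow> x \<in> U \<Longrightarrow> (\<exists>y\<in>U. y \<noteq> x) \<Longrightarrow>
     (\<exists>n W. W \<in> sets borel \<and> U \<subseteq> W \<and> 0 < diameter U \<and> diameter U \<le> (1/4) ^ n \<and>
        emeasure \<mu> W \<le> ennreal (C * diameter U powr \<delta> * ratio \<delta> (digit n x)))"
    using small_set_bound by blast
  have main: "ennreal (K / (2 * C)) \<le> hausdorff_psi \<psi> A"
    if K: "K > 0" and sumN: "summable (\<lambda>n. tail (N n))"
      and N: "\<forall>n\<ge>n1. \<forall>q. 2 \<le> q \<and> q < N n \<longrightarrow> K * ratio \<delta> q \<le> \<Psi> ((1/4) ^ n)"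
      and A: "A \<in> sets \<mu>" "emeasure \<mu> (UNIV - A) = 0" for K N n1 A
  proof -
    define t where "t = (\<lambda>n. tail (N n))"
    have sumt: "summable t" using sumN by (simp add: t_def)
    obtain n2 where n2: "\<And>n. n \<ge> n2 \<Longrightarrow> norm (\<Sum>i. t (i + n)) < 1/16"
      using suminf_exist_split[OF _ sumt, of "1/16"] by auto
    define n0 where "n0 = max n1 n2"
    have "t \<longlonglongrightarrow> 0" by (rule summable_LIMSEQ_zero[OF sumt])
    then have "\<forall>\<^sub>F m in sequentially. t m < 1 / (16 * (real n0 + 1))"
      by (rule order_tendstoD) (auto intro: divide_pos_pos)
    then obtain m where m: "t m < 1 / (16 * (real n0 + 1))" by (auto simp: eventually_sequentially)
    define M where "M = N m"
    define N' where "N' n = (if n < n0 then M else N n)" for n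
    define t' where "t' = (\<lambda>n. tail (N' n))"
    have t'_shift: "(\<lambda>i. t' (i + n0)) = (\<lambda>i. t (i + n0))" by (auto simp: t'_def t_def N'_def)
    have sumt': "summable t'"
      using sumt summable_iff_shift[of t' n0] summable_iff_shift[of t n0] t'_shift by simp
    have "suminf t' = (\<Sum>i. t' (i + n0)) + (\<Sum>i<n0. t' i)" by (rule suminf_split_initial_segment[OF sumt'])
    also have "(\<Sum>i<n0. t' i) \<le> (\<Sum>i<n0. 1 / (16 * (real n0 + 1)))"
      using m by (intro sum_mono) (simp add: t'_def t_def N'_def M_def)
    also have "\<dots> \<le> 1/16" by (simp add: field_simps)
    also have "(\<Sum>i. t' (i + n0)) \<le> 1/16" using n2[of n0] t'_shift by (simp add: n0_def)
    finally have sum_t': "suminf t' \<le> 1/8" by simp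
    define Bad where "Bad = (\<Union>n. {x. digit n x \<in> {N' n..}})"
    have Bad [measurable]: "Bad \<in> sets borel" unfolding Bad_def by (intro sets.countable_UN') auto
    have "emeasure \<mu> Bad \<le> (\<Sum>n. emeasure \<mu> {x. digit n x \<in> {N' n..}})"
      unfolding Bad_def by (rule emeasure_subadditive_countably) auto
    also have "\<dots> \<le> (\<Sum>n. ennreal (4 * t' n))"
    proof (rule suminf_le)
      fix n
      have "emeasure \<mu> {x. digit n x \<in> {N' n..}} \<le> 4 * emeasure \<mu> {x. dig x \<in> {N' n..}}"
        by (rule emeasure_dig_gauss_le)
      also have "\<dots> = ennreal (4 * t' n)" by (simp add: t'_def emeasure_eq_measure ennreal_mult)
      finally show "emeasure \<mu> {x. digit n x \<in> {N' n..}} \<le> ennreal (4 * t' n)" .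
    qed auto
    also have "\<dots> = ennreal (\<Sum>n. 4 * t' n)"
      by (rule suminf_ennreal2) (use sumt' in \<open>auto simp: t'_def\<close>)
    also have "\<dots> \<le> ennreal (1/2)"
      using sum_t' sumt' by (intro ennreal_leI) (simp add: suminf_mult)
    finally have "ennreal (measure \<mu> Bad) \<le> ennreal (1/2)" by (simp only: emeasure_eq_measure)
    then have Bad_le: "measure \<mu> Bad \<le> 1/2" by (subst (asm) ennreal_le_iff) auto
    define GA where "GA = (prime_cf - Bad) \<inter> A"
    have GA [measurable]: "GA \<in> sets borel" using A Bad prime_cf_borel unfolding GA_def by auto
    have AE_A: "AE x in \<mu>. x \<in> A"
    proof -
      have "UNIV - A \<in> null_sets \<mu>" using A by (intro null_setsI) (auto simp: Compl_eq_Diff_UNIV[symmetric])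
      from AE_not_in[OF this] show ?thesis by simp
    qed
    have "emeasure \<mu> GA = emeasure \<mu> (UNIV - Bad)"
    proof (rule emeasure_eq_AE)
      show "AE x in \<mu>. x \<in> GA \<longleftrightarrow> x \<in> UNIV - Bad"
        using AE_A AE_prime_cf by eventually_elim (simp add: GA_def)
    qed (use GA Bad in auto)
    then have "measure \<mu> GA = measure \<mu> (UNIV - Bad)" by (simp add: measure_def)
    also have "\<dots> = measure \<mu> UNIV - measure \<mu> Bad" using finite_measure_compl[of Bad] Bad by simp
    also have "measure \<mu> UNIV = 1" by (simp add: measure_def)
    finally have GA_ge: "1/2 \<le> measure \<mu> GA" using Bad_le by simp
    obtain \<epsilon> where \<epsilon>: "\<epsilon> > 0" "K * (real M / ln 2) \<le> \<Psi> \<epsilon>" using unb by blast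
    have good: "K * ratio \<delta> (digit n x) \<le> \<Psi> d"
      if x: "x \<in> GA" and d: "0 < d" "d \<le> (1/4) ^ n" "d \<le> \<epsilon>" for x n d
    proof -
      define q where "q = digit n x"
      have q2: "q \<ge> 2" using prime_cf_prime[of x n] x prime_ge_2_nat by (auto simp: q_def GA_def)
      have qN: "q < N' n"
      proof (rule ccontr)
        assume "\<not> q < N' n"
        then have "digit n x \<in> {N' n..}" by (simp add: q_def)
        then have "x \<in> Bad" unfolding Bad_def by blast
        then show False using x by (simp add: GA_def)
      qed
      have "K * ratio \<delta> q \<le> \<Psi> d"
      proof (cases "n < n0")
        case True
        then have qM: "real q \<le> real M" using qN by (simp add: N'_def)
        have "real q powr (1 - \<delta>) \<le> real q powr 1" using q2 delta_gt_half by (intro powr_mono) auto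
        then have "ratio \<delta> q \<le> real M / ln 2" unfolding ratio_def
          using qM q2 by (intro frac_le) auto
        then have "K * ratio \<delta> q \<le> K * (real M / ln 2)" using K by (intro mult_left_mono) auto
        also have "\<dots> \<le> \<Psi> \<epsilon>" by (rule \<epsilon>(2))
        also have "\<dots> \<le> \<Psi> d" using d by (intro anti) auto
        finally show ?thesis .
      next
        case False
        then have "q < N n" "n \<ge> n1" using qN by (auto simp: N'_def n0_def)
        then have "K * ratio \<delta> q \<le> \<Psi> ((1/4) ^ n)" using N q2 by blast
        also have "\<dots> \<le> \<Psi> d" using d by (intro anti) auto
        finally show ?thesis .
      qed
      then show ?thesis by (simp add: q_def)
    qed
    have "ennreal (K / (2 * C)) \<le> hausdorff_pre \<psi> \<epsilon> A"
      unfolding hausdorff_pre_def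
    proof (rule INF_greatest)
      fix U :: "nat \<Rightarrow> real set"
      assume "U \<in> {U. A \<subseteq> (\<Union>i. U i) \<and> (\<forall>i. bounded (U i) \<and> diameter (U i) \<le> \<epsilon>)}"
      then have cov: "A \<subseteq> (\<Union>i. U i)" and bU: "\<And>i. bounded (U i)" and dU: "\<And>i. diameter (U i) \<le> \<epsilon>" by auto
      have "\<exists>W. W \<in> sets borel \<and> U i \<inter> GA \<subseteq> W \<and> ennreal (K / C) * emeasure \<mu> W \<le> psi_diam \<psi> (U i)" for i
      proof (cases "U i \<inter> GA = {}")
        case True
        then show ?thesis by (intro exI[of _ "{}"]) auto
      next
        case False
        then obtain x where x: "x \<in> U i" "x \<in> GA" by blast
        then have xp: "x \<in> prime_cf" by (simp add: GA_def)
        define V where "V = U i \<inter> prime_cf"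
        have xV: "x \<in> V" using x xp by (simp add: V_def)
        have GV: "U i \<inter> GA \<subseteq> V" by (auto simp: V_def GA_def)
        show ?thesis
        proof (cases "\<exists>y\<in>V. y \<noteq> x")
          case False
          then have "U i \<inter> GA \<subseteq> {x}" using GV by blast
          then show ?thesis using emeasure_singleton[OF xp] by (intro exI[of _ "{x}"]) auto
        next
          case True
          have Vp: "V \<subseteq> prime_cf" by (auto simp: V_def)
          from small[OF Vp xV True] obtain n W where W: "W \<in> sets borel" "V \<subseteq> W" "0 < diameter V" "diameter V \<le> (1/4) ^ n"
            and em: "emeasure \<mu> W \<le> ennreal (C * diameter V powr \<delta> * ratio \<delta> (digit n x))" by blast
          define r where "r = ratio \<delta> (digit n x)"
          have r0: "r \<ge> 0" using prime_cf_prime[OF xp, of n] prime_ge_2_nat[of "digit n x"]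
            by (simp add: r_def ratio_def)
          have dVU: "diameter V \<le> diameter (U i)" by (rule diameter_subset) (auto simp: V_def bU)
          have "K * r \<le> \<Psi> (diameter V)" unfolding r_def using x W dVU dU[of i] by (intro good) auto
          then have "diameter V powr \<delta> * (K * r) \<le> diameter V powr \<delta> * \<Psi> (diameter V)"
            by (rule mult_left_mono) simp
          moreover have "K / C * (C * diameter V powr \<delta> * r) = diameter V powr \<delta> * (K * r)"
            using C by simp
          ultimately have "K / C * (C * diameter V powr \<delta> * r) \<le> diameter V powr \<delta> * \<Psi> (diameter V)" by simp
          also have "\<dots> = \<psi> (diameter V)" using psi W by simp
          also have "\<dots> \<le> \<psi> (diameter (U i))" using W dVU by (intro psi_mono) auto
          finally have 1: "K / C * (C * diameter V powr \<delta> * r) \<le> \<psi> (diameter (U i))" .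
          have "ennreal (K / C) * emeasure \<mu> W \<le> ennreal (K / C) * ennreal (C * diameter V powr \<delta> * r)"
            using em by (intro mult_left_mono) (auto simp: r_def)
          also have "\<dots> = ennreal (K / C * (C * diameter V powr \<delta> * r))"
            using K C r0 by (intro ennreal_mult[symmetric]) auto
          also have "\<dots> \<le> psi_diam \<psi> (U i)"
            unfolding psi_diam_def using W dVU 1 by (auto intro!: ennreal_leI)
          finally show ?thesis using W GV by blast
        qed
      qed
      then obtain W where W: "\<And>i. W i \<in> sets borel" "\<And>i. U i \<inter> GA \<subseteq> W i"
        "\<And>i. ennreal (K / C) * emeasure \<mu> (W i) \<le> psi_diam \<psi> (U i)" by metis
      have "ennreal (K / (2 * C)) = ennreal (K / C) * ennreal (1/2)"
        using K C by (subst ennreal_mult[symmetric]) (auto simp: mult.commute)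
      also have "\<dots> \<le> ennreal (K / C) * emeasure \<mu> GA"
        unfolding emeasure_eq_measure by (intro mult_left_mono ennreal_leI GA_ge) simp
      also have "\<dots> \<le> ennreal (K / C) * emeasure \<mu> (\<Union>i. W i)"
      proof (intro mult_left_mono emeasure_mono)
        show "GA \<subseteq> (\<Union>i. W i)" using W(2) cov by (fastforce simp: GA_def)
        show "(\<Union>i. W i) \<in> sets \<mu>" using W(1) by auto
      qed simp
      also have "\<dots> \<le> ennreal (K / C) * (\<Sum>i. emeasure \<mu> (W i))"
        using W(1) by (intro mult_left_mono emeasure_subadditive_countably) auto
      also have "\<dots> = (\<Sum>i. ennreal (K / C) * emeasure \<mu> (W i))" by (rule ennreal_suminf_cmult[symmetric])
      also have "\<dots> \<le> (\<Sum>i. psi_diam \<psi> (U i))" using W(3) by (intro suminf_le) auto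
      finally show "ennreal (K / (2 * C)) \<le> (\<Sum>i. psi_diam \<psi> (U i))" .
    qed
    also have "\<dots> \<le> hausdorff_psi \<psi> A" unfolding hausdorff_psi_def using \<epsilon> by (intro SUP_upper) auto
    finally show ?thesis .
  qed
  have "2 * C > 0" using C by simp
  from that[OF this main] show ?thesis .
qed


lemma hausdorff_le_of_not_summable:
  fixes \<psi> \<Psi> :: "real \<Rightarrow> real"
  assumes psi: "\<And>r. r > 0 \<Longrightarrow> \<psi> r = r powr \<delta> * \<Psi> r"
    and psi_pos: "\<And>r. r > 0 \<Longrightarrow> \<psi> r > 0"
    and psi_mono: "\<And>a b. 0 < a \<Longrightarrow> a \<le> b \<Longrightarrow> \<psi> a \<le> \<psi> b"
  obtains C \<beta> where "C > 0" "\<beta> > 0"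
    "\<And>K N I n1. K > 0 \<Longrightarrow> \<not> summable (\<lambda>n. measure \<mu> {x. dig x \<in> (if n \<in> I then {N n..} else {})}) \<Longrightarrow>
      (\<forall>n\<in>I. n \<ge> n1 \<longrightarrow> 1000 \<le> N n \<and> (\<forall>r. exp (- \<beta> * real n) / real (N n) \<le> r \<and> r \<le> 1 \<longrightarrow> K * \<Psi> r \<le> ratio \<delta> (N n))) \<Longrightarrow>
      \<exists>A\<in>sets \<mu>. emeasure \<mu> (UNIV - A) = 0 \<and> hausdorff_psi \<psi> A \<le> ennreal (C / K)"
proof -
  interpret finite_measure \<mu> by (rule finite_mu)
  obtain C0 where C0: "C0 > 0" and AE_prod: "AE x in \<mu>. \<forall>\<^sub>F n in sequentially. prod_list (map real (digs n x)) \<le> exp (C0 * real n)"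
    using AE_prod_digs_le by blast
  define C where "C = 4 * 2000 powr (2 * \<delta>)"
  have C: "C > 0" by (simp add: C_def)
  have main: "\<exists>A\<in>sets \<mu>. emeasure \<mu> (UNIV - A) = 0 \<and> hausdorff_psi \<psi> A \<le> ennreal (C / K)"
    if K: "K > 0" and div: "\<not> summable (\<lambda>n. measure \<mu> {x. dig x \<in> (if n \<in> I then {N n..} else {})})"
      and N: "\<forall>n\<in>I. n \<ge> n1 \<longrightarrow> 1000 \<le> N n \<and> (\<forall>r. exp (- (4 * C0) * real n) / real (N n) \<le> r \<and> r \<le> 1 \<longrightarrow> K * \<Psi> r \<le> ratio \<delta> (N n))"
    for K and N :: "nat \<Rightarrow> nat" and I n1
  proof -
    define Sw where "Sw n w \<longleftrightarrow> n \<in> I \<and> N n \<le> w ! n \<and> prod_list (map real (take n w)) \<le> exp (C0 * real n)" for n w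
    define S where "S n x \<longleftrightarrow> Sw n (digs (Suc n) x)" for n x
    have S_iff: "S n x \<longleftrightarrow> n \<in> I \<and> N n \<le> digit n x \<and> prod_list (map real (digs n x)) \<le> exp (C0 * real n)" for n x
      by (simp add: S_def Sw_def digs_Suc nth_append)
    have Sw_digs: "Sw m (digs n x) \<longleftrightarrow> S m x" if "m < n" for m n x
    proof -
      have "take m (digs n x) = digs m x" "digs n x ! m = digit m x"
        using that by (auto simp: digs_def take_map)
      then show ?thesis unfolding S_iff Sw_def by simp
    qed
    have Sb: "{x. S n x} \<in> sets borel" for n
    proof -
      have "{x. S n x} = digs (Suc n) -` {w. Sw n w} \<inter> space borel" by (auto simp: S_def)
      also have "\<dots> \<in> sets borel" by (rule measurable_sets[OF measurable_digs]) simp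
      finally show ?thesis .
    qed
    define A where "A = {x \<in> prime_cf. \<forall>k. \<exists>n\<ge>k. S n x}"
    have Ab: "A \<in> sets borel"
    proof -
      have "A = prime_cf \<inter> (\<Inter>k. \<Union>n\<in>{k..}. {x. S n x})" by (auto simp: A_def)
      also have "\<dots> \<in> sets borel"
        by (intro sets.Int prime_cf_borel sets.countable_INT' sets.countable_UN') (auto simp: Sb)
      finally show ?thesis .
    qed
    have io: "AE x in \<mu>. \<forall>k. \<exists>n\<ge>k. digit n x \<in> (if n \<in> I then {N n..} else {})"
      unfolding AE_all_countable using AE_infinitely_often[OF div] by blast
    have AE_A: "AE x in \<mu>. x \<in> A"
      using io AE_prod AE_prime_cf
    proof eventually_elim
      case (elim x)
      obtain m where m: "\<And>n. n \<ge> m \<Longrightarrow> prod_list (map real (digs n x)) \<le> exp (C0 * real n)"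
        using elim(2) by (auto simp: eventually_sequentially)
      have "\<exists>n\<ge>k. S n x" for k
      proof -
        obtain n where n: "n \<ge> max k m" "digit n x \<in> (if n \<in> I then {N n..} else {})" using elim(1) by blast
        then have "S n x" unfolding S_iff using m[of n] by (auto split: if_splits)
        then show ?thesis using n by auto
      qed
      then show ?case using elim(3) by (simp add: A_def)
    qed
    have null: "emeasure \<mu> (UNIV - A) = 0"
    proof -
      have "UNIV - A \<in> null_sets \<mu>"
        using AE_A Ab AE_iff_null_sets[of "UNIV - A" \<mu>] by auto
      then show ?thesis by auto
    qed
    have pre: "hausdorff_pre \<psi> \<epsilon> A \<le> ennreal (C / K)" if \<epsilon>: "\<epsilon> > 0" for \<epsilon>
    proof -
      obtain n2 where n2: "(1/4::real) ^ n2 < \<epsilon>" using real_arch_pow_inv[OF \<epsilon>, of "1/4"] by auto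
      define n0 where "n0 = max n1 n2"
      define Wd where "Wd = {w. w \<in> prime_words (length w) \<and> n0 \<le> length w \<and> length w \<in> I \<and>
        prod_list (map real w) \<le> exp (C0 * real (length w)) \<and> (\<forall>m. n0 \<le> m \<and> m < length w \<longrightarrow> \<not> Sw m w)}"
      define B where "B n = {x. dig x \<in> {N n..}} \<inter> J" for n
      have B: "B n \<in> sets borel" "B n \<subseteq> J" for n unfolding B_def by auto
      define V where "V w = gphi_word w ` B (length w)" for w
      have ge2: "set w \<subseteq> {2..}" if "w \<in> Wd" for w using that prime_words_ge2 by (auto simp: Wd_def)
      have Vb: "V w \<in> sets borel" if "w \<in> Wd" for w
        unfolding V_def using gphi_word_image_borel[OF ge2[OF that] B] .
      have digsV: "digs (length w) x = w \<and> N (length w) \<le> digit (length w) x" if "w \<in> Wd" "x \<in> V w" for w x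
      proof -
        obtain u where u: "u \<in> B (length w)" "x = gphi_word w u" using \<open>x \<in> V w\<close> by (auto simp: V_def)
        then have "u \<in> J" by (simp add: B_def)
        from funpow_gauss_gphi_word[OF ge2[OF \<open>w \<in> Wd\<close>] this] show ?thesis using u by (auto simp: B_def)
      qed
      have SV: "S (length w) x" if w: "w \<in> Wd" and x: "x \<in> V w" for w x
        unfolding S_iff using digsV[OF w x] w by (auto simp: Wd_def)
      have disj: "w = w'" if w: "w \<in> Wd" "w' \<in> Wd" and x: "x \<in> V w" "x \<in> V w'" for w w' x
      proof -
        have *: "\<not> length v < length v'" if v: "v \<in> Wd" "v' \<in> Wd" "x \<in> V v" "x \<in> V v'" for v v'
        proof
          assume l: "length v < length v'"
          have "S (length v) x" by (rule SV[OF v(1,3)])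
          then have "Sw (length v) (digs (length v') x)" using Sw_digs[OF l] by simp
          then have "Sw (length v) v'" using digsV[OF v(2,4)] by simp
          then show False using v l by (auto simp: Wd_def)
        qed
        have "length w = length w'" using *[OF w x] *[OF w(2) w(1) x(2) x(1)] by simp
        then show ?thesis using conjunct1[OF digsV[OF w(1) x(1)]] conjunct1[OF digsV[OF w(2) x(2)]] by metis
      qed
      have coverA: "\<exists>w\<in>Wd. x \<in> V w" if x: "x \<in> A" for x
      proof -
        have xp: "x \<in> prime_cf" and ex: "\<exists>n. n \<ge> n0 \<and> S n x" using x by (auto simp: A_def)
        define n where "n = (LEAST n. n \<ge> n0 \<and> S n x)"
        have n: "n \<ge> n0" "S n x" using LeastI_ex[OF ex] by (auto simp: n_def)
        have min: "\<not> S m x" if "n0 \<le> m" "m < n" for m using not_less_Least[of m] that by (auto simp: n_def)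
        define w where "w = digs n x"
        have lw: "length w = n" by (simp add: w_def)
        have "w \<in> Wd" unfolding Wd_def mem_Collect_eq lw
        proof (intro conjI allI impI)
          show "w \<in> prime_words n" unfolding w_def by (rule prime_cf_digs_word[OF xp])
          show "n0 \<le> n" by (rule n)
          show "n \<in> I" "prod_list (map real w) \<le> exp (C0 * real n)" using n unfolding S_iff w_def by auto
          fix m assume "n0 \<le> m \<and> m < n"
          then show "\<not> Sw m w" unfolding w_def using Sw_digs min by auto
        qed
        moreover have "x \<in> V w"
        proof -
          have "(gauss ^^ n) x \<in> B n" using n prime_cf_J[OF xp] by (auto simp: B_def S_iff)
          then show ?thesis unfolding V_def lw using prime_cf_digs[OF xp, of n] by (auto simp: w_def intro!: image_eqI)
        qed
        ultimately show ?thesis by blast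
      qed
      have piece: "bounded (V w) \<and> diameter (V w) \<le> \<epsilon> \<and> psi_diam \<psi> (V w) \<le> ennreal (C / K) * emeasure \<mu> (V w)" if w: "w \<in> Wd" for w
      proof -
        define n where "n = length w"
        have wp: "w \<in> prime_words n" and nI: "n \<in> I" and n0n: "n0 \<le> n" and prodw: "prod_list (map real w) \<le> exp (C0 * real n)"
          using w by (auto simp: Wd_def n_def)
        have N1000: "1000 \<le> N n" and Nr: "\<And>r. exp (- (4 * C0) * real n) / real (N n) \<le> r \<Longrightarrow> r \<le> 1 \<Longrightarrow> K * \<Psi> r \<le> ratio \<delta> (N n)"
          using N nI n0n by (auto simp: n0_def)
        define q where "q = den w 0"
        have q: "2 ^ n \<le> q" using den_ge_power[OF ge2[OF w], of 0] by (simp add: q_def n_def)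
        then have q1: "1 \<le> q" by (rule order_trans[rotated]) simp
        define D where "D = 1 / (q\<^sup>2 * real (N n))"
        have D0: "D > 0" using q1 N1000 by (simp add: D_def)
        have D4: "D \<le> (1/4) ^ n"
        proof -
          have "D \<le> 1 / (2 ^ n)\<^sup>2"
            unfolding D_def using q q1 N1000 mult_mono[of "(2^n)\<^sup>2" "q\<^sup>2" 1 "real (N n)"] by (intro divide_left_mono) (auto intro!: power_mono)
          also have "\<dots> = (1/4) ^ n" by (simp add: power2_eq_square power_one_over flip: power_mult_distrib)
          finally show ?thesis .
        qed
        have D1: "D \<le> 1" using D4 power_le_one[of "1/4::real" n] by simp
        have D\<epsilon>: "D \<le> \<epsilon>"
        proof -
          have "(1/4::real) ^ n \<le> (1/4) ^ n2" using n0n by (intro power_decreasing) (auto simp: n0_def)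
          then show ?thesis using D4 n2 by linarith
        qed
        have Dexp: "exp (- (4 * C0) * real n) / real (N n) \<le> D"
        proof -
          have "q \<le> (prod_list (map real w))\<^sup>2" unfolding q_def by (rule den_0_le_prod[OF ge2[OF w]])
          also have "\<dots> \<le> (exp (C0 * real n))\<^sup>2" using prodw by (intro power_mono) (auto intro!: prod_list_nonneg)
          finally have "q\<^sup>2 \<le> ((exp (C0 * real n))\<^sup>2)\<^sup>2" using q1 by (intro power_mono) auto
          also have "\<dots> = exp (4 * C0 * real n)" by (simp add: exp_double[symmetric] mult.assoc flip: power_mult exp_of_nat_mult)
          finally have "1 / exp (4 * C0 * real n) \<le> 1 / q\<^sup>2" using q1 by (intro divide_left_mono) auto
          then have "1 / exp (4 * C0 * real n) / real (N n) \<le> 1 / q\<^sup>2 / real (N n)" by (rule divide_right_mono) simp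
          then show ?thesis by (simp add: D_def exp_minus inverse_eq_divide)
        qed
        have Vsub: "V w \<subseteq> J" unfolding V_def by (rule gphi_word_image_subset[OF ge2[OF w] B(2)])
        have diam: "diameter (V w) \<le> D"
        proof (rule diameter_le)
          fix a b assume "a \<in> V w" "b \<in> V w"
          then obtain u v where uv: "u \<in> B n" "v \<in> B n" "a = gphi_word w u" "b = gphi_word w v" by (auto simp: V_def n_def)
          have le: "0 < z \<and> z \<le> 1 / real (N n) \<and> z \<le> 1" if "z \<in> B n" for z
          proof -
            have z: "0 < z" "z \<le> 1/2" "N n \<le> dig z" using that by (auto simp: B_def J_def)
            have "real (N n) \<le> real (dig z)" using z by simp
            also have "\<dots> \<le> 1 / z" using z by (simp add: dig_def)
            finally show ?thesis using z N1000 by (simp add: field_simps)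
          qed
          have "\<bar>a - b\<bar> \<le> \<bar>u - v\<bar> / q\<^sup>2"
            using gphi_word_diff_le[OF ge2[OF w], of u v] le[OF uv(1)] le[OF uv(2)] uv by (simp add: q_def)
          also have "\<dots> \<le> (1 / real (N n)) / q\<^sup>2" using le[OF uv(1)] le[OF uv(2)] by (intro divide_right_mono) auto
          finally show "norm (a - b) \<le> D" by (simp add: D_def mult.commute)
        qed (use D0 in simp)
        define T where "T = tail (N n)"
        have T: "real (N n) powr (1 - 2 * \<delta>) / ln (real (N n)) \<le> 2000 powr (2 * \<delta>) * T"
          unfolding T_def by (rule measure_dig_tail_ge[OF N1000])
        have TV: "q powr (- (2 * \<delta>)) * T \<le> 4 * measure \<mu> (V w)"
        proof -
          have "emeasure \<mu> (B n) = ennreal T"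
            unfolding B_def T_def using emeasure_inter_J[of "{x. dig x \<in> {N n..}}"] by (simp add: emeasure_eq_measure)
          then have "cyl w * ennreal T \<le> 4 * emeasure \<mu> (V w)"
            using emeasure_word_image_ge[OF wp B(1) B(2), of n] by (simp add: V_def n_def)
          then have "ennreal (q powr (- (2 * \<delta>)) * T) \<le> ennreal (4 * measure \<mu> (V w))"
            by (simp add: cyl_def q_def emeasure_eq_measure ennreal_mult T_def)
          then show ?thesis by (subst (asm) ennreal_le_iff) auto
        qed
        have "\<psi> D \<le> C / K * measure \<mu> (V w)"
        proof -
          have "K * \<psi> D = D powr \<delta> * (K * \<Psi> D)" using psi[OF D0] by simp
          also have "\<dots> \<le> D powr \<delta> * ratio \<delta> (N n)" using Nr[OF Dexp D1] by (intro mult_left_mono) auto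
          also have "\<dots> = q powr (- (2 * \<delta>)) * (real (N n) powr (1 - 2 * \<delta>) / ln (real (N n)))"
          proof -
            have "D powr \<delta> = q powr (- (2 * \<delta>)) * real (N n) powr (- \<delta>)"
              using q1 N1000 powr_powr[of q 2 \<delta>] by (simp add: D_def powr_divide powr_mult powr_minus_divide)
            moreover have "real (N n) powr (- \<delta>) * real (N n) powr (1 - \<delta>) = real (N n) powr (1 - 2 * \<delta>)"
              by (simp add: powr_add[symmetric])
            ultimately show ?thesis by (simp add: ratio_def)
          qed
          also have "\<dots> \<le> q powr (- (2 * \<delta>)) * (2000 powr (2 * \<delta>) * T)"
            by (rule mult_left_mono[OF T]) simp
          also have "\<dots> = 2000 powr (2 * \<delta>) * (q powr (- (2 * \<delta>)) * T)" by simp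
          also have "\<dots> \<le> 2000 powr (2 * \<delta>) * (4 * measure \<mu> (V w))" using TV by (intro mult_left_mono) auto
          finally have "K * \<psi> D \<le> C * measure \<mu> (V w)" by (simp add: C_def mult_ac)
          then show ?thesis using K by (simp add: field_simps)
        qed
        moreover have "psi_diam \<psi> (V w) \<le> ennreal (\<psi> D)"
        proof (cases "diameter (V w) = 0")
          case False
          then have "diameter (V w) > 0" using diameter_ge_0[OF bounded_subset_J[OF Vsub]] by simp
          then show ?thesis using psi_mono[OF _ diam] by (simp add: psi_diam_def ennreal_leI)
        qed (simp add: psi_diam_def)
        ultimately have "psi_diam \<psi> (V w) \<le> ennreal (C / K * measure \<mu> (V w))"
          using ennreal_leI order_trans by blast
        also have "\<dots> = ennreal (C / K) * emeasure \<mu> (V w)"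
          using C K by (simp add: emeasure_eq_measure ennreal_mult[symmetric])
        finally show ?thesis using diam D\<epsilon> bounded_subset_J[OF Vsub] by linarith
      qed
      define U where "U i = (if i \<in> to_nat ` Wd then V (from_nat i) else {})" for i :: nat
      have U_cases: "U i = {} \<or> (\<exists>w\<in>Wd. i = to_nat w \<and> U i = V w)" for i by (auto simp: U_def)
      have Ub: "U i \<in> sets \<mu>" for i using U_cases[of i] Vb by auto
      have "hausdorff_pre \<psi> \<epsilon> A \<le> (\<Sum>i. psi_diam \<psi> (U i))"
        unfolding hausdorff_pre_def
      proof (rule INF_lower, safe)
        fix x assume "x \<in> A"
        then obtain w where "w \<in> Wd" "x \<in> V w" using coverA by blast
        then have "x \<in> U (to_nat w)" by (auto simp: U_def)
        then show "x \<in> (\<Union>i. U i)" by blast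
      next
        fix i
        show "bounded (U i)" "diameter (U i) \<le> \<epsilon>" using U_cases[of i] piece \<epsilon> by auto
      qed
      also have "\<dots> \<le> (\<Sum>i. ennreal (C / K) * emeasure \<mu> (U i))"
      proof (rule suminf_le)
        show "psi_diam \<psi> (U i) \<le> ennreal (C / K) * emeasure \<mu> (U i)" for i
          using U_cases[of i]
        proof
          assume "\<exists>w\<in>Wd. i = to_nat w \<and> U i = V w"
          then show ?thesis using piece by auto
        qed (simp add: psi_diam_def)
      qed auto
      also have "\<dots> = ennreal (C / K) * (\<Sum>i. emeasure \<mu> (U i))" by (rule ennreal_suminf_cmult)
      also have "(\<Sum>i. emeasure \<mu> (U i)) = emeasure \<mu> (\<Union>i. U i)"
      proof (rule suminf_emeasure)
        show "range U \<subseteq> sets \<mu>" using Ub by auto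
        show "disjoint_family U" unfolding disjoint_family_on_def
        proof (intro ballI impI)
          fix i j :: nat assume "i \<noteq> j"
          then show "U i \<inter> U j = {}" using U_cases[of i] U_cases[of j] disj by blast
        qed
      qed
      also have "ennreal (C / K) * emeasure \<mu> (\<Union>i. U i) \<le> ennreal (C / K) * 1"
        by (intro mult_left_mono emeasure_le_1) simp
      finally show ?thesis by simp
    qed
    have "hausdorff_psi \<psi> A \<le> ennreal (C / K)"
      unfolding hausdorff_psi_def by (rule SUP_least) (use pre in auto)
    then show ?thesis using Ab null by auto
  qed
  have "4 * C0 > 0" using C0 by simp
  from that[OF C this main] show ?thesis .
qed

end

section \<open>The series\<close>

definition series_fun :: "real \<Rightarrow> real \<Rightarrow> real" where
  "series_fun d y = y powr ((1 - 2 * d) / (1 - d)) / (ln y) powr (d / (1 - d))"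

lemma series_fun_nonneg [simp]: "series_fun d y \<ge> 0"
  by (simp add: series_fun_def)

lemma series_fun_antimono:
  assumes d: "1/2 < d" "d < 1" and y: "1 < y" "y \<le> z"
  shows "series_fun d z \<le> series_fun d y"
proof -
  have ly: "0 < ln y" "ln y \<le> ln z" using y by auto
  show ?thesis unfolding series_fun_def
  proof (rule frac_le)
    have "z powr (- ((2 * d - 1) / (1 - d))) \<le> y powr (- ((2 * d - 1) / (1 - d)))"
      using y d by (intro powr_mono2') auto
    moreover have "- ((2 * d - 1) / (1 - d)) = (1 - 2 * d) / (1 - d)" by (simp add: minus_divide_left)
    ultimately show "z powr ((1 - 2 * d) / (1 - d)) \<le> y powr ((1 - 2 * d) / (1 - d))" by simp
    show "ln y powr (d / (1 - d)) \<le> ln z powr (d / (1 - d))" using ly d by (intro powr_mono2) auto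
    show "0 < ln y powr (d / (1 - d))" using ly by simp
  qed simp
qed

lemma series_fun_scale:
  assumes d: "1/2 < d" "d < 1" and L: "L \<ge> 1" and y: "y \<ge> exp 1"
  shows "series_fun d y \<le> L powr ((2 * d - 1) / (1 - d)) * (1 + ln L) powr (d / (1 - d)) * series_fun d (L * y)"
proof -
  define a b where "a = (2 * d - 1) / (1 - d)" and "b = d / (1 - d)"
  have ab: "a > 0" "b > 0" using d by (auto simp: a_def b_def)
  have a': "(1 - 2 * d) / (1 - d) = - a" by (simp add: a_def minus_divide_left)
  have y0: "y > 0" using y by (rule less_le_trans[rotated]) simp
  have ly: "ln y \<ge> 1" using y y0 by (metis ln_exp ln_mono exp_gt_zero)
  have lL: "ln L \<ge> 0" using L by simp
  have lLy: "ln (L * y) = ln L + ln y" using L y0 by (subst ln_mult_pos) auto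
  have pos: "ln (L * y) > 0" using lLy lL ly by simp
  have "ln (L * y) \<le> (1 + ln L) * ln y"
    unfolding lLy using mult_left_mono[OF ly lL] by (simp add: algebra_simps)
  then have "ln (L * y) powr b \<le> ((1 + ln L) * ln y) powr b" using pos ab by (intro powr_mono2) auto
  also have "\<dots> = (1 + ln L) powr b * ln y powr b" by (rule powr_mult)
  finally have 1: "ln (L * y) powr b \<le> (1 + ln L) powr b * ln y powr b" .
  have "series_fun d y = y powr (- a) / ln y powr b" by (simp add: series_fun_def a' b_def)
  also have "\<dots> \<le> y powr (- a) * ((1 + ln L) powr b / ln (L * y) powr b)"
  proof -
    have "1 / ln y powr b \<le> (1 + ln L) powr b / ln (L * y) powr b"
      using 1 ly pos by (simp add: divide_simps)
    then have "y powr (- a) * (1 / ln y powr b) \<le> y powr (- a) * ((1 + ln L) powr b / ln (L * y) powr b)"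
      by (rule mult_left_mono) simp
    then show ?thesis by simp
  qed
  also have "y powr (- a) = L powr a * (L * y) powr (- a)"
  proof -
    have "(L * y) powr (- a) = L powr (- a) * y powr (- a)" by (rule powr_mult)
    moreover have "L powr a * L powr (- a) = 1" using L by (simp add: powr_add[symmetric])
    ultimately show ?thesis by simp
  qed
  also have "L powr a * (L * y) powr (- a) * ((1 + ln L) powr b / ln (L * y) powr b)
    = L powr a * (1 + ln L) powr b * series_fun d (L * y)"
    by (simp add: series_fun_def a' b_def)
  finally show ?thesis by (simp add: a_def b_def)
qed

text \<open>\<open>threshold d y\<close> inverts \<open>q \<mapsto> q powr (1 - d) / ln q\<close> up to constants.\<close>
definition threshold :: "real \<Rightarrow> real \<Rightarrow> real" where
  "threshold d y = (y * ln y) powr (1 / (1 - d))"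

lemma threshold_facts:
  assumes d: "1/2 < d" "d < 1" and y: "y \<ge> exp 1"
  shows "threshold d y \<ge> 2" "threshold d y powr (1 - d) = y * ln y"
    "ln y \<le> ln (threshold d y)" "ln (threshold d y) \<le> 2 / (1 - d) * ln y"
    "threshold d y powr (1 - 2 * d) / ln y = series_fun d y"
proof -
  define s where "s = 1 - d"
  have s: "0 < s" "s \<le> 1" "1 \<le> 1 / s" using d by (auto simp: s_def)
  have y0: "y > 0" using y by (rule less_le_trans[rotated]) simp
  have y2: "y \<ge> 2" using y exp_ge_add_one_self[of "1::real"] by linarith
  have ly: "ln y \<ge> 1" using y y0 by (metis ln_exp ln_mono exp_gt_zero)
  have yl: "y * ln y \<ge> y" using mult_left_mono[OF ly, of y] y0 by simp
  have yl0: "y * ln y > 0" using yl y0 by linarith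
  have "y * ln y = (y * ln y) powr 1" by (rule powr_one[symmetric]) (use yl0 in linarith)
  also have "\<dots> \<le> threshold d y" unfolding threshold_def s_def[symmetric]
  proof (rule powr_mono)
    show "1 \<le> y * ln y" using yl y2 by linarith
  qed (use s in simp)
  finally have Qy: "y \<le> threshold d y" using yl by linarith
  then show "threshold d y \<ge> 2" using y2 by linarith
  show "ln y \<le> ln (threshold d y)" using Qy y0 by (intro ln_mono) auto
  show "threshold d y powr (1 - d) = y * ln y"
  proof -
    have "threshold d y powr (1 - d) = (y * ln y) powr (1 / (1 - d) * (1 - d))"
      unfolding threshold_def by (rule powr_powr)
    also have "1 / (1 - d) * (1 - d) = 1" using d by simp
    also have "(y * ln y) powr 1 = y * ln y" by (rule powr_one) (use yl0 in linarith)
    finally show ?thesis .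
  qed
  have "ln (threshold d y) = 1 / s * (ln y + ln (ln y))"
    unfolding threshold_def s_def[symmetric] 
    using yl0 ln_mult_pos[of y "ln y"] y0 y2 ly by (simp add: ln_powr)
  also have "\<dots> \<le> 1 / s * (ln y + ln y)" using s ln_le_minus_one[of "ln y"] ly by (intro mult_left_mono) auto
  finally show "ln (threshold d y) \<le> 2 / (1 - d) * ln y" by (simp add: s_def)
  have "threshold d y powr (1 - 2 * d) = (y * ln y) powr ((1 - 2 * d) / (1 - d))"
    unfolding threshold_def by (simp add: powr_powr)
  also have "\<dots> = y powr ((1 - 2 * d) / (1 - d)) * ln y powr ((1 - 2 * d) / (1 - d))" by (rule powr_mult)
  also have "(1 - 2 * d) / (1 - d) = 1 - d / (1 - d)" using d by (simp add: field_simps)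
  finally have *: "threshold d y powr (1 - 2 * d) = y powr (1 - d / (1 - d)) * ln y powr (1 - d / (1 - d))" .
  have "ln y powr (1 - d / (1 - d)) = ln y powr 1 / ln y powr (d / (1 - d))" by (rule powr_diff)
  also have "ln y powr 1 = ln y" by (rule powr_one) (use ly in linarith)
  finally show "threshold d y powr (1 - 2 * d) / ln y = series_fun d y"
    unfolding series_fun_def \<open>(1 - 2 * d) / (1 - d) = 1 - d / (1 - d)\<close> * using ly by simp
qed

lemma ratio_le_threshold:
  assumes d: "1/2 < d" "d < 1" and y: "y \<ge> exp 1" and q: "2 \<le> q" "real q \<le> threshold d y"
  shows "ratio d q \<le> (1 + 1 / ((1 - d) * ln 2)) * y"
proof -
  note t = threshold_facts[OF d y]
  have c: "0 \<le> 1 + 1 / ((1 - d) * ln 2)" using d by auto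
  have y0: "y > 0" using y by (rule less_le_trans[rotated]) simp
  have ly: "ln y \<ge> 1" using y y0 by (metis ln_exp ln_mono exp_gt_zero)
  have y1: "y > 1" "y * ln y \<ge> 0" using ly y0 ln_le_minus_one[of y] by auto
  have "ratio d q \<le> (1 + 1 / ((1 - d) * ln 2)) * (threshold d y powr (1 - d) / ln (threshold d y))"
    unfolding ratio_def using d q by (intro powr_over_ln_quasi_mono) auto
  also have "threshold d y powr (1 - d) / ln (threshold d y) \<le> (y * ln y) / ln y"
    unfolding t(2) using t(3) ly y0 y1 by (intro divide_left_mono mult_pos_pos) auto
  then have "(1 + 1 / ((1 - d) * ln 2)) * (threshold d y powr (1 - d) / ln (threshold d y)) \<le> (1 + 1 / ((1 - d) * ln 2)) * y"
    using ly c by (intro mult_left_mono) auto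
  finally show ?thesis .
qed

lemma ratio_ge_threshold:
  assumes d: "1/2 < d" "d < 1" and y: "y \<ge> exp 1" and q: "threshold d y \<le> real q"
  shows "(1 - d) / 2 * y \<le> (1 + 1 / ((1 - d) * ln 2)) * ratio d q"
proof -
  note t = threshold_facts[OF d y]
  have y0: "y > 0" using y by (rule less_le_trans[rotated]) simp
  have ly: "ln y \<ge> 1" using y y0 by (metis ln_exp ln_mono exp_gt_zero)
  have y1: "y > 1" "y * ln y \<ge> 0" using ly y0 ln_le_minus_one[of y] by auto
  have "(1 - d) / 2 * y = (y * ln y) / (2 / (1 - d) * ln y)" using ly d by simp
  also have "\<dots> \<le> threshold d y powr (1 - d) / ln (threshold d y)"
    unfolding t(2) using t(3,4) ly y0 y1 d by (intro divide_left_mono mult_pos_pos) auto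
  also have "\<dots> \<le> (1 + 1 / ((1 - d) * ln 2)) * ratio d q"
    unfolding ratio_def using d q t(1) by (intro powr_over_ln_quasi_mono) auto
  finally show ?thesis .
qed

lemma summable_div_nat:
  fixes v :: "nat \<Rightarrow> real"
  assumes v: "summable v" "\<And>n. v n \<ge> 0" and m: "m > 0"
  shows "summable (\<lambda>n. v (n div m))"
proof (rule bounded_imp_summable)
  fix N
  have "(\<Sum>n\<le>N. v (n div m)) \<le> (\<Sum>n<Suc N * m. v (n div m))"
  proof (rule sum_mono2)
    show "{..N} \<subseteq> {..<Suc N * m}"
    proof
      fix x assume "x \<in> {..N}"
      then have "x < Suc N * 1" by simp
      also have "\<dots> \<le> Suc N * m" using m by (intro mult_le_mono2) simp
      finally show "x \<in> {..<Suc N * m}" by simp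
    qed
  qed (use v in auto)
  also have "\<dots> = (\<Sum>j<Suc N. \<Sum>n\<in>{j * m..<j * m + m}. v (n div m))"
    by (rule sum.nat_group[symmetric])
  also have "\<dots> = (\<Sum>j<Suc N. \<Sum>n\<in>{j * m..<j * m + m}. v j)"
  proof (intro sum.cong refl)
    fix j n assume "n \<in> {j * m..<j * m + m}"
    then have "n div m = j" using m by (intro div_nat_eqI) (auto simp: algebra_simps)
    then show "v (n div m) = v j" by simp
  qed
  also have "\<dots> = real m * (\<Sum>j<Suc N. v j)" by (simp add: sum_distrib_left del: sum.lessThan_Suc)
  also have "\<dots> \<le> real m * suminf v" using v by (intro mult_left_mono sum_le_suminf) auto
  finally show "(\<Sum>n\<le>N. v (n div m)) \<le> real m * suminf v" .
qed (use v in auto)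

lemma summable_rescale:
  fixes u :: "real \<Rightarrow> real"
  assumes ab: "a > 0" "b > 0"
    and nonneg: "\<And>t. u t \<ge> 0"
    and anti: "\<And>s t. t0 \<le> s \<Longrightarrow> s \<le> t \<Longrightarrow> u t \<le> u s"
    and sum: "summable (\<lambda>n. u (a * real n))"
  shows "summable (\<lambda>n. u (b * real n))"
proof -
  obtain m :: nat where m: "a / b \<le> real m" using real_arch_simple by blast
  have m0: "m > 0" using m ab by (cases m) (auto simp: divide_le_0_iff)
  have mb: "a \<le> b * real m" using m ab by (simp add: field_simps)
  obtain k :: nat where k: "t0 / a \<le> real k" using real_arch_simple by blast
  have ka: "t0 \<le> a * real k" using k ab by (simp add: field_simps)
  have "summable (\<lambda>n. u (a * real (n div m)))" by (rule summable_div_nat[OF sum nonneg m0])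
  then show ?thesis
  proof (rule summable_comparison_test'[where N = "k * m"])
    fix n assume n: "n \<ge> k * m"
    have "k \<le> n div m" using n m0 by (simp add: less_eq_div_iff_mult_less_eq)
    then have "a * real k \<le> a * real (n div m)" using ab by (intro mult_left_mono) auto
    then have 1: "t0 \<le> a * real (n div m)" using ka by linarith
    have "a * real (n div m) \<le> b * real m * real (n div m)" using mb by (intro mult_right_mono) auto
    also have "\<dots> = b * real (m * (n div m))" by simp
    also have "\<dots> \<le> b * real n" using ab by (intro mult_left_mono of_nat_mono) auto
    finally have "u (b * real n) \<le> u (a * real (n div m))" by (intro anti 1)
    then show "norm (u (b * real n)) \<le> u (a * real (n div m))" using nonneg by simp
  qed
qed

lemma threshold_exceeds:
  assumes "1/2 < d" "d < 1" 
  shows "\<exists>N::nat. 1000 \<le> N \<and> Y \<le> ratio d N"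
proof -
  define c where "c = 1 + 1 / ((1 - d) * ln 2)"
  have c: "c > 0" using assms by (auto simp: c_def intro!: add_pos_pos)
  define y where "y = max (exp 1) (c * Y * 2 / (1 - d))"
  define N where "N = nat \<lceil>threshold d y\<rceil> + 1000"
  have "threshold d y \<le> real N" using real_nat_ceiling_ge[of "threshold d y"] by (simp add: N_def)
  then have "(1 - d) / 2 * y \<le> c * ratio d N"
    unfolding c_def using assms by (intro ratio_ge_threshold) (auto simp: y_def)
  moreover have "c * Y = (1 - d) / 2 * (c * Y * 2 / (1 - d))" using assms by simp
  moreover have "(1 - d) / 2 * (c * Y * 2 / (1 - d)) \<le> (1 - d) / 2 * y"
    using assms by (intro mult_left_mono) (auto simp: y_def)
  ultimately have "c * Y \<le> c * ratio d N" by linarith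
  then show ?thesis using c by (intro exI[of _ N]) (auto simp: N_def)
qed

lemma divide_powr_minus: "(x / a) powr (- c) = a powr c * x powr (- c)" for x a c :: real
proof -
  have "(x / a) powr (- c) = x powr (- c) / a powr (- c)" by (rule powr_divide)
  then show ?thesis by (simp add: powr_minus_divide)
qed

lemma hausdorff_measure_zeroI:
  assumes C: "C > 0" and ex: "\<And>K. K > 0 \<Longrightarrow> \<exists>A\<in>sets \<mu>. emeasure \<mu> (UNIV - A) = 0 \<and> hausdorff_psi \<psi> A \<le> ennreal (C / K)"
  shows "hausdorff_psi_measure \<psi> \<mu> = 0"
proof -
  have "hausdorff_psi_measure \<psi> \<mu> \<le> ennreal e" if e: "e > 0" for e
  proof -
    obtain A where A: "A \<in> sets \<mu>" "emeasure \<mu> (UNIV - A) = 0" "hausdorff_psi \<psi> A \<le> ennreal (C / (C / e))"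
      using ex[of "C / e"] C e by auto
    have "hausdorff_psi_measure \<psi> \<mu> \<le> hausdorff_psi \<psi> A"
      unfolding hausdorff_psi_measure_def using A by (intro INF_lower) auto
    then show ?thesis using A C e by simp
  qed
  note le = this
  have "hausdorff_psi_measure \<psi> \<mu> \<le> 0"
  proof (rule ennreal_le_epsilon)
    fix e :: real assume "0 < e"
    from le[OF this] show "hausdorff_psi_measure \<psi> \<mu> \<le> 0 + ennreal e" by simp
  qed
  then show ?thesis by simp
qed

context prime_conformal
begin

lemma hausdorff_zero_of_bounded:
  fixes \<psi> \<Psi> :: "real \<Rightarrow> real"
  assumes psi: "\<And>r. r > 0 \<Longrightarrow> \<psi> r = r powr \<delta> * \<Psi> r"
    and psi_pos: "\<And>r. r > 0 \<Longrightarrow> \<psi> r > 0"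
    and psi_mono: "\<And>a b. 0 < a \<Longrightarrow> a \<le> b \<Longrightarrow> \<psi> a \<le> \<psi> b"
    and bdd: "\<And>r. 0 < r \<Longrightarrow> r \<le> 1 \<Longrightarrow> \<Psi> r \<le> Y"
  shows "hausdorff_psi_measure \<psi> \<mu> = 0"
proof -
  obtain C \<beta> where C: "C > 0" and \<beta>: "\<beta> > 0" and crit: "\<And>K N I n1. K > 0 \<Longrightarrow> \<not> summable (\<lambda>n. measure \<mu> {x. dig x \<in> (if n \<in> I then {N n..} else {})}) \<Longrightarrow>
    (\<forall>n\<in>I. n \<ge> n1 \<longrightarrow> 1000 \<le> N n \<and> (\<forall>r. exp (- \<beta> * real n) / real (N n) \<le> r \<and> r \<le> 1 \<longrightarrow> K * \<Psi> r \<le> ratio \<delta> (N n))) \<Longrightarrow>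
    \<exists>A\<in>sets \<mu>. emeasure \<mu> (UNIV - A) = 0 \<and> hausdorff_psi \<psi> A \<le> ennreal (C / K)"
    by (rule hausdorff_le_of_not_summable[OF psi psi_pos psi_mono]; (assumption | (rule that, assumption+)))
  show ?thesis
  proof (rule hausdorff_measure_zeroI[OF C])
    fix K :: real assume K: "K > 0"
    obtain N where N: "1000 \<le> N" "K * Y \<le> ratio \<delta> N" using threshold_exceeds[OF delta_gt_half delta_lt_1] by blast
    have pos: "0 < tail N"
    proof -
      have "0 < real N powr (1 - 2 * \<delta>) / ln (real N)" using N by (intro divide_pos_pos) auto
      then have "0 < 2000 powr (2 * \<delta>) * tail N"
        using measure_dig_tail_ge[OF N(1)] by (rule less_le_trans)
      then show ?thesis by (simp add: zero_less_mult_iff)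
    qed
    show "\<exists>A\<in>sets \<mu>. emeasure \<mu> (UNIV - A) = 0 \<and> hausdorff_psi \<psi> A \<le> ennreal (C / K)"
    proof (rule crit[where N = "\<lambda>_. N" and I = UNIV and ?n1.0 = 0, OF K])
      show "\<not> summable (\<lambda>n::nat. measure \<mu> {x. dig x \<in> (if n \<in> UNIV then {N..} else {})})"
        using pos by (simp add: summable_const_iff)
      show "\<forall>n\<in>UNIV. 0 \<le> n \<longrightarrow> 1000 \<le> N \<and> (\<forall>r. exp (- \<beta> * real n) / real N \<le> r \<and> r \<le> 1 \<longrightarrow> K * \<Psi> r \<le> ratio \<delta> N)"
      proof (intro ballI impI conjI allI)
        fix n :: nat and r assume r: "exp (- \<beta> * real n) / real N \<le> r \<and> r \<le> 1"
        have "0 < exp (- \<beta> * real n) / real N" using N by simp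
        then have "0 < r" using r by linarith
        then have "K * \<Psi> r \<le> K * Y" using bdd r K by (intro mult_left_mono) auto
        then show "K * \<Psi> r \<le> ratio \<delta> N" using N by linarith
      qed (rule N)
    qed
  qed
qed

lemma hausdorff_zero_of_not_summable:
  fixes \<psi> \<Psi> :: "real \<Rightarrow> real"
  assumes psi: "\<And>r. r > 0 \<Longrightarrow> \<psi> r = r powr \<delta> * \<Psi> r"
    and psi_pos: "\<And>r. r > 0 \<Longrightarrow> \<psi> r > 0"
    and psi_mono: "\<And>a b. 0 < a \<Longrightarrow> a \<le> b \<Longrightarrow> \<psi> a \<le> \<psi> b"
    and anti: "\<And>a b. 0 < a \<Longrightarrow> a \<le> b \<Longrightarrow> \<Psi> b \<le> \<Psi> a"
    and unb: "\<And>Y. \<exists>r>0. Y \<le> \<Psi> r"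
    and div: "\<And>b. b > 0 \<Longrightarrow> \<not> summable (\<lambda>n. series_fun \<delta> (\<Psi> (exp (- (b * real n)))))"
  shows "hausdorff_psi_measure \<psi> \<mu> = 0"
proof -
  note d = delta_gt_half delta_lt_1
  obtain C \<beta> where C: "C > 0" and \<beta>: "\<beta> > 0" and crit: "\<And>K N I n1. K > 0 \<Longrightarrow> \<not> summable (\<lambda>n. measure \<mu> {x. dig x \<in> (if n \<in> I then {N n..} else {})}) \<Longrightarrow>
    (\<forall>n\<in>I. n \<ge> n1 \<longrightarrow> 1000 \<le> N n \<and> (\<forall>r. exp (- \<beta> * real n) / real (N n) \<le> r \<and> r \<le> 1 \<longrightarrow> K * \<Psi> r \<le> ratio \<delta> (N n))) \<Longrightarrow>
    \<exists>A\<in>sets \<mu>. emeasure \<mu> (UNIV - A) = 0 \<and> hausdorff_psi \<psi> A \<le> ennreal (C / K)"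
    by (rule hausdorff_le_of_not_summable[OF psi psi_pos psi_mono]; (assumption | (rule that, assumption+)))
  show ?thesis
  proof (rule hausdorff_measure_zeroI[OF C])
    fix K :: real assume K: "K > 0"
    define c where "c = 1 + 1 / ((1 - \<delta>) * ln 2)"
    have c: "c > 0" using d by (auto simp: c_def intro!: add_pos_pos)
    define L where "L = max 1 (c * K * 2 / (1 - \<delta>))"
    have L: "L \<ge> 1" "c * K \<le> (1 - \<delta>) / 2 * L"
    proof -
      have "c * K = (1 - \<delta>) / 2 * (c * K * 2 / (1 - \<delta>))" using d by simp
      also have "\<dots> \<le> (1 - \<delta>) / 2 * L" using d by (intro mult_left_mono) (auto simp: L_def)
      finally show "c * K \<le> (1 - \<delta>) / 2 * L" .
    qed (simp add: L_def)
    define Pn where "Pn n = \<Psi> (exp (- ((\<beta> + 1) * real n)))" for n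
    define y where "y n = L * Pn n" for n
    define N where "N n = nat \<lceil>threshold \<delta> (y n)\<rceil> + 1000" for n
    define I where "I = {n. real (N n) \<le> exp (real n)}"
    obtain r0 where r0: "r0 > 0" "exp 1 \<le> \<Psi> r0" using unb by blast
    obtain n1 :: nat where n1: "- ln r0 \<le> real n1" using real_arch_simple by blast
    have Pn_ge: "Pn n \<ge> exp 1" if n: "n \<ge> n1" for n
    proof -
      have "- ((\<beta> + 1) * real n) \<le> - real n1" using n \<beta> by (simp add: algebra_simps add_increasing2)
      also have "\<dots> \<le> ln r0" using n1 by simp
      finally have "exp (- ((\<beta> + 1) * real n)) \<le> exp (ln r0)" by simp
      then have "\<Psi> r0 \<le> Pn n" unfolding Pn_def using r0 by (intro anti) auto
      then show ?thesis using r0 by linarith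
    qed
    have y_ge: "y n \<ge> exp 1" "y n \<ge> Pn n" if "n \<ge> n1" for n
    proof -
      have "Pn n \<ge> 0" using Pn_ge[OF that] by (rule order_trans[rotated]) simp
      then show "y n \<ge> Pn n" unfolding y_def using L mult_right_mono[of 1 L "Pn n"] by simp
      then show "y n \<ge> exp 1" using Pn_ge[OF that] by linarith
    qed
    have NQ: "threshold \<delta> (y n) \<le> real (N n)" "real (N n) \<le> 1000 * threshold \<delta> (y n)" if "n \<ge> n1" for n
    proof -
      have "threshold \<delta> (y n) \<ge> 2" using threshold_facts(1)[OF d y_ge(1)[OF that]] .
      then show "real (N n) \<le> 1000 * threshold \<delta> (y n)" unfolding N_def by linarith
      show "threshold \<delta> (y n) \<le> real (N n)"
        using real_nat_ceiling_ge[of "threshold \<delta> (y n)"] by (simp add: N_def)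
    qed
    have N1000: "1000 \<le> N n" for n by (simp add: N_def)
    define cL where "cL = L powr ((2 * \<delta> - 1) / (1 - \<delta>)) * (1 + ln L) powr (\<delta> / (1 - \<delta>))"
    have cL: "cL \<ge> 0" by (simp add: cL_def)
    text \<open>Indices with \<open>N n > exp n\<close> contribute only a geometric series.\<close>
    have nonI: "series_fun \<delta> (y n) \<le> 1000 powr (2 * \<delta> - 1) * exp (1 - 2 * \<delta>) ^ n" if n: "n \<ge> n1" "n \<notin> I" for n
    proof -
      define Q where "Q = threshold \<delta> (y n)"
      have Q: "Q \<ge> 2" using threshold_facts(1)[OF d y_ge(1)[OF n(1)]] by (simp add: Q_def)
      have "exp (real n) \<le> 1000 * Q" using n NQ[OF n(1)] by (auto simp: I_def Q_def)
      then have "exp (real n) / 1000 \<le> Q" by simp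
      then have "Q powr (- (2 * \<delta> - 1)) \<le> (exp (real n) / 1000) powr (- (2 * \<delta> - 1))" using d by (intro powr_mono2') auto
      also have "\<dots> = 1000 powr (2 * \<delta> - 1) * exp (real n) powr (- (2 * \<delta> - 1))"
        by (rule divide_powr_minus)
      also have "exp (real n) powr (- (2 * \<delta> - 1)) = exp (1 - 2 * \<delta>) ^ n"
        by (simp add: powr_def exp_of_nat_mult[symmetric] algebra_simps)
      finally have 1: "Q powr (1 - 2 * \<delta>) \<le> 1000 powr (2 * \<delta> - 1) * exp (1 - 2 * \<delta>) ^ n" by simp
      have ly: "ln (y n) \<ge> 1" using y_ge(1)[OF n(1)] by (metis ln_exp ln_mono exp_gt_zero less_le_trans)
      have "series_fun \<delta> (y n) = Q powr (1 - 2 * \<delta>) / ln (y n)"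
        unfolding Q_def using threshold_facts(5)[OF d y_ge(1)[OF n(1)]] by simp
      also have "\<dots> \<le> Q powr (1 - 2 * \<delta>) / 1" using ly by (intro divide_left_mono) auto
      finally show ?thesis using 1 by simp
    qed
    define c2 where "c2 = 2000 powr (2 * \<delta>) * 1000 powr (2 * \<delta> - 1) * (7 + 2 / (1 - \<delta>))"
    have c2: "c2 \<ge> 0" using d by (simp add: c2_def)
    have inI: "series_fun \<delta> (y n) \<le> c2 * tail (N n)" if n: "n \<ge> n1" for n
    proof -
      define Q where "Q = threshold \<delta> (y n)"
      note t = threshold_facts[OF d y_ge(1)[OF n], folded Q_def]
      have y0: "y n > 0" using y_ge(1)[OF n] by (rule less_le_trans[rotated]) simp
      have ly: "ln (y n) \<ge> 1" using y_ge(1)[OF n] by (metis ln_exp ln_mono exp_gt_zero less_le_trans)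
      have Np: "real (N n) \<ge> 1000" using N1000[of n] by simp
      have lN: "ln (real (N n)) \<le> (7 + 2 / (1 - \<delta>)) * ln (y n)"
      proof -
        have "ln (real (N n)) \<le> ln (1000 * Q)" using NQ[OF n] Np by (intro ln_mono) (auto simp: Q_def)
        also have "\<dots> = ln 1000 + ln Q" using t(1) by (subst ln_mult_pos) auto
        also have "\<dots> \<le> 7 * ln (y n) + 2 / (1 - \<delta>) * ln (y n)"
        proof (rule add_mono[OF _ t(4)])
          have "ln (1000::real) \<le> ln (2 ^ 10)" by (intro ln_mono) auto
          moreover have "ln ((2::real) ^ 10) = 10 * ln 2" by (subst ln_realpow) simp
          ultimately have "ln (1000::real) \<le> 7" using ln2_le_25_over_36 by linarith
          then show "ln 1000 \<le> 7 * ln (y n)" using ly by simp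
        qed
        finally show ?thesis by (simp add: algebra_simps)
      qed
      have lN0: "ln (real (N n)) > 0" using Np by simp
      have "series_fun \<delta> (y n) = Q powr (1 - 2 * \<delta>) / ln (y n)" using t(5) by simp
      also have "\<dots> \<le> (1000 powr (2 * \<delta> - 1) * real (N n) powr (1 - 2 * \<delta>)) / (ln (real (N n)) / (7 + 2 / (1 - \<delta>)))"
      proof (rule frac_le)
        have "Q powr (- (2 * \<delta> - 1)) \<le> (real (N n) / 1000) powr (- (2 * \<delta> - 1))"
          using NQ[OF n] Np d by (intro powr_mono2') (auto simp: Q_def)
        also have "\<dots> = 1000 powr (2 * \<delta> - 1) * real (N n) powr (- (2 * \<delta> - 1))"
          by (rule divide_powr_minus)
        finally show "Q powr (1 - 2 * \<delta>) \<le> 1000 powr (2 * \<delta> - 1) * real (N n) powr (1 - 2 * \<delta>)" by simp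
        have "0 < 7 + 2 / (1 - \<delta>)" using d by (intro add_pos_pos) auto
        then show "ln (real (N n)) / (7 + 2 / (1 - \<delta>)) \<le> ln (y n)" "0 < ln (real (N n)) / (7 + 2 / (1 - \<delta>))"
          using lN lN0 by (simp_all add: pos_divide_le_eq mult.commute)
      qed simp
      also have "\<dots> = 1000 powr (2 * \<delta> - 1) * (7 + 2 / (1 - \<delta>)) * (real (N n) powr (1 - 2 * \<delta>) / ln (real (N n)))" by simp
      also have "\<dots> \<le> 1000 powr (2 * \<delta> - 1) * (7 + 2 / (1 - \<delta>)) * (2000 powr (2 * \<delta>) * tail (N n))"
        using d by (intro mult_left_mono[OF measure_dig_tail_ge[OF N1000[of n]]]) auto
      finally show ?thesis by (simp add: c2_def mult_ac)
    qed
    show "\<exists>A\<in>sets \<mu>. emeasure \<mu> (UNIV - A) = 0 \<and> hausdorff_psi \<psi> A \<le> ennreal (C / K)"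
    proof (rule crit[where N = N and I = I and ?n1.0 = n1, OF K])
      show "\<not> summable (\<lambda>n. measure \<mu> {x. dig x \<in> (if n \<in> I then {N n..} else {})})"
      proof
        let ?m = "\<lambda>n. measure \<mu> {x. dig x \<in> (if n \<in> I then {N n..} else {})}"
        assume sm: "summable ?m"
        have geo: "summable (\<lambda>n. exp (1 - 2 * \<delta>) ^ n)" using d by (intro summable_geometric) simp
        have "summable (\<lambda>n. cL * (c2 * ?m n + 1000 powr (2 * \<delta> - 1) * exp (1 - 2 * \<delta>) ^ n))"
          by (intro summable_mult summable_add sm geo)
        then have "summable (\<lambda>n. series_fun \<delta> (\<Psi> (exp (- ((\<beta> + 1) * real n)))))"
        proof (rule summable_comparison_test'[where N = n1])
          fix n assume n: "n \<ge> n1"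
          have "series_fun \<delta> (Pn n) \<le> cL * series_fun \<delta> (y n)"
            unfolding cL_def y_def by (rule series_fun_scale[OF d L(1) Pn_ge[OF n]])
          also have "\<dots> \<le> cL * (c2 * ?m n + 1000 powr (2 * \<delta> - 1) * exp (1 - 2 * \<delta>) ^ n)"
          proof (rule mult_left_mono[OF _ cL])
            show "series_fun \<delta> (y n) \<le> c2 * ?m n + 1000 powr (2 * \<delta> - 1) * exp (1 - 2 * \<delta>) ^ n"
            proof (cases "n \<in> I")
              case True
              then show ?thesis using inI[OF n] by (intro add_increasing2) auto
            next
              case False
              then show ?thesis using nonI[OF n] by (simp add: add_increasing)
            qed
          qed
          finally show "norm (series_fun \<delta> (\<Psi> (exp (- ((\<beta> + 1) * real n))))) \<le> cL * (c2 * ?m n + 1000 powr (2 * \<delta> - 1) * exp (1 - 2 * \<delta>) ^ n)"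
            by (simp add: Pn_def)
        qed
        then show False using div[of "\<beta> + 1"] \<beta> by simp
      qed
      show "\<forall>n\<in>I. n1 \<le> n \<longrightarrow> 1000 \<le> N n \<and> (\<forall>r. exp (- \<beta> * real n) / real (N n) \<le> r \<and> r \<le> 1 \<longrightarrow> K * \<Psi> r \<le> ratio \<delta> (N n))"
      proof (intro ballI impI conjI allI)
        fix n r assume nI: "n \<in> I" and n: "n1 \<le> n" and r: "exp (- \<beta> * real n) / real (N n) \<le> r \<and> r \<le> 1"
        have "exp (- ((\<beta> + 1) * real n)) = exp (- \<beta> * real n) / exp (real n)"
          by (simp add: exp_diff[symmetric] algebra_simps)
        also have "\<dots> \<le> exp (- \<beta> * real n) / real (N n)"
          using nI N1000[of n] by (intro divide_left_mono) (auto simp: I_def)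
        also have "\<dots> \<le> r" using r by simp
        finally have "\<Psi> r \<le> Pn n" unfolding Pn_def by (intro anti) auto
        then have "(c * K) * \<Psi> r \<le> (c * K) * Pn n" using c K by (intro mult_left_mono) auto
        also have "\<dots> \<le> ((1 - \<delta>) / 2 * L) * Pn n"
          using L(2) Pn_ge[OF n] by (intro mult_right_mono) (auto intro: order_trans[rotated])
        also have "\<dots> = (1 - \<delta>) / 2 * y n" by (simp add: y_def)
        also have "\<dots> \<le> c * ratio \<delta> (N n)"
          unfolding c_def by (rule ratio_ge_threshold[OF d y_ge(1)[OF n] NQ(1)[OF n]])
        finally have "c * (K * \<Psi> r) \<le> c * ratio \<delta> (N n)" by (simp add: mult_ac)
        then show "K * \<Psi> r \<le> ratio \<delta> (N n)" using c by simp
      qed (rule N1000)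
    qed
  qed
qed

lemma hausdorff_infinite_of_summable:
  fixes \<psi> \<Psi> :: "real \<Rightarrow> real"
  assumes psi: "\<And>r. r > 0 \<Longrightarrow> \<psi> r = r powr \<delta> * \<Psi> r"
    and psi_mono: "\<And>a b. 0 < a \<Longrightarrow> a \<le> b \<Longrightarrow> \<psi> a \<le> \<psi> b"
    and anti: "\<And>a b. 0 < a \<Longrightarrow> a \<le> b \<Longrightarrow> \<Psi> b \<le> \<Psi> a"
    and unb: "\<And>Y. \<exists>r>0. Y \<le> \<Psi> r"
    and sm: "summable (\<lambda>n. series_fun \<delta> (\<Psi> ((1/4) ^ n)))"
  shows "hausdorff_psi_measure \<psi> \<mu> = \<infinity>"
proof -
  note d = delta_gt_half delta_lt_1
  obtain C where C: "C > 0" and crit: "\<And>K N n1 A. K > 0 \<Longrightarrow> summable (\<lambda>n. tail (N n)) \<Longrightarrow>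
    (\<forall>n\<ge>n1. \<forall>q. 2 \<le> q \<and> q < N n \<longrightarrow> K * ratio \<delta> q \<le> \<Psi> ((1/4) ^ n)) \<Longrightarrow>
    A \<in> sets \<mu> \<Longrightarrow> emeasure \<mu> (UNIV - A) = 0 \<Longrightarrow> ennreal (K / C) \<le> hausdorff_psi \<psi> A"
    by (rule hausdorff_ge_of_summable[OF psi psi_mono anti unb]; (assumption | (rule that, assumption+)))
  obtain Ct where Ct: "Ct > 0" and tail: "\<And>N. N \<ge> 2 \<Longrightarrow> tail N \<le> Ct * (real N powr (1 - 2 * \<delta>) / ln (real N))"
    using measure_dig_tail_le by blast
  have key: "ennreal (K / C) \<le> hausdorff_psi \<psi> A"
    if K: "K > 0" and A: "A \<in> sets \<mu>" "emeasure \<mu> (UNIV - A) = 0" for K A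
  proof -
    define c where "c = 1 + 1 / ((1 - \<delta>) * ln 2)"
    have c: "c > 0" using d by (auto simp: c_def intro!: add_pos_pos)
    define L where "L = max 1 (K * c)"
    have L: "L \<ge> 1" "K * c \<le> L" by (auto simp: L_def)
    define y where "y n = \<Psi> ((1/4) ^ n) / L" for n
    define N where "N n = nat \<lceil>threshold \<delta> (y n)\<rceil>" for n
    obtain r0 where r0: "r0 > 0" "L * exp 1 \<le> \<Psi> r0" using unb by blast
    obtain n1 where n1: "(1/4::real) ^ n1 < r0" using real_arch_pow_inv[OF r0(1), of "1/4"] by auto
    have y_ge: "y n \<ge> exp 1" if n: "n \<ge> n1" for n
    proof -
      have "(1/4::real) ^ n \<le> (1/4) ^ n1" using n by (intro power_decreasing) auto
      then have "(1/4) ^ n \<le> r0" using n1 by linarith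
      then have "\<Psi> r0 \<le> \<Psi> ((1/4) ^ n)" by (intro anti) simp
      then have "L * exp 1 \<le> \<Psi> ((1/4) ^ n)" using r0 by linarith
      then show ?thesis using L by (simp add: y_def pos_le_divide_eq mult.commute)
    qed
    define cL where "cL = L powr ((2 * \<delta> - 1) / (1 - \<delta>)) * (1 + ln L) powr (\<delta> / (1 - \<delta>))"
    have "summable (\<lambda>n. tail (N n))"
    proof (rule summable_comparison_test'[where N = n1])
      show "summable (\<lambda>n. Ct * cL * series_fun \<delta> (\<Psi> ((1/4) ^ n)))" by (intro summable_mult sm)
      fix n assume n: "n \<ge> n1"
      define Q where "Q = threshold \<delta> (y n)"
      note t = threshold_facts[OF d y_ge[OF n], folded Q_def]
      have ly: "ln (y n) \<ge> 1" using y_ge[OF n] by (metis ln_exp ln_mono exp_gt_zero less_le_trans)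
      have NQ: "Q \<le> real (N n)" unfolding N_def Q_def by (rule real_nat_ceiling_ge)
      then have N2: "N n \<ge> 2" using t(1) by linarith
      have "tail (N n) \<le> Ct * (real (N n) powr (1 - 2 * \<delta>) / ln (real (N n)))" by (rule tail[OF N2])
      also have "\<dots> \<le> Ct * (Q powr (1 - 2 * \<delta>) / ln (y n))"
      proof (rule mult_left_mono[OF frac_le])
        have "real (N n) powr (- (2 * \<delta> - 1)) \<le> Q powr (- (2 * \<delta> - 1))" using NQ t(1) d by (intro powr_mono2') auto
        then show "real (N n) powr (1 - 2 * \<delta>) \<le> Q powr (1 - 2 * \<delta>)" by simp
        have "ln Q \<le> ln (real (N n))" using NQ t(1) by (intro ln_mono) auto
        then show "ln (y n) \<le> ln (real (N n))" using t(3) by linarith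
      qed (use ly Ct in auto)
      also have "Q powr (1 - 2 * \<delta>) / ln (y n) = series_fun \<delta> (y n)" by (rule t(5))
      also have "Ct * series_fun \<delta> (y n) \<le> Ct * (cL * series_fun \<delta> (L * y n))"
        unfolding cL_def using Ct by (intro mult_left_mono series_fun_scale[OF d L(1) y_ge[OF n]]) auto
      also have "L * y n = \<Psi> ((1/4) ^ n)" using L by (simp add: y_def)
      finally show "norm (tail (N n)) \<le> Ct * cL * series_fun \<delta> (\<Psi> ((1/4) ^ n))"
        by (simp add: mult_ac)
    qed
    moreover have "\<forall>n\<ge>n1. \<forall>q. 2 \<le> q \<and> q < N n \<longrightarrow> K * ratio \<delta> q \<le> \<Psi> ((1/4) ^ n)"
    proof (intro allI impI)
      fix n q assume n: "n1 \<le> n" and q: "2 \<le> q \<and> q < N n"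
      have "real q \<le> threshold \<delta> (y n)"
      proof (rule ccontr)
        assume "\<not> ?thesis"
        then have "\<lceil>threshold \<delta> (y n)\<rceil> \<le> int q" by (simp add: ceiling_le_iff)
        then have "N n \<le> q" by (simp add: N_def nat_le_iff)
        then show False using q by simp
      qed
      then have "ratio \<delta> q \<le> c * y n" unfolding c_def using q by (intro ratio_le_threshold[OF d y_ge[OF n]]) auto
      then have "K * ratio \<delta> q \<le> K * (c * y n)" using K by (intro mult_left_mono) auto
      also have "\<dots> = (K * c) * y n" by simp
      also have "\<dots> \<le> L * y n" using L y_ge[OF n] by (intro mult_right_mono) (auto intro: order_trans[rotated])
      also have "\<dots> = \<Psi> ((1/4) ^ n)" using L by (simp add: y_def)
      finally show "K * ratio \<delta> q \<le> \<Psi> ((1/4) ^ n)" .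
    qed
    ultimately show ?thesis using crit[OF K _ _ A] by blast
  qed
  have inf: "hausdorff_psi \<psi> A = \<infinity>" if A: "A \<in> sets \<mu>" "emeasure \<mu> (UNIV - A) = 0" for A
  proof (rule ccontr)
    assume "hausdorff_psi \<psi> A \<noteq> \<infinity>"
    then obtain r where r: "hausdorff_psi \<psi> A = ennreal r" "r \<ge> 0" by (metis ennreal_cases infinity_ennreal_def)
    have "ennreal ((C * (r + 1)) / C) \<le> ennreal r" using key[OF _ A, of "C * (r + 1)"] C r by simp
    then show False using C r by simp
  qed
  have "\<infinity> \<le> hausdorff_psi_measure \<psi> \<mu>"
    unfolding hausdorff_psi_measure_def
  proof (rule INF_greatest)
    fix A assume "A \<in> {A \<in> sets \<mu>. emeasure \<mu> (UNIV - A) = 0}"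
    then show "\<infinity> \<le> hausdorff_psi \<psi> A" using inf by simp
  qed
  then show ?thesis by (simp add: infinity_ennreal_def top_unique)
qed

end

theorem theorem1:
  fixes \<delta> :: real and \<mu> :: "real measure" and \<psi> :: "real \<Rightarrow> real" and lam :: real
  defines "P \<equiv> {p :: nat. prime p}"
  defines "\<Psi> \<equiv> (\<lambda>r. r powr (- \<delta>) * \<psi> r)"
  assumes delta: "pressure_zero P \<delta>"
    and mu: "conformal_measure P \<delta> \<mu>"
    and dimfun: "dimension_function \<psi>"
    and doub: "doubling \<psi>"
    and Psi_mono: "mono_on {0<..} \<Psi> \<or> mono_on {0<..} (\<lambda>r. - \<Psi> r)"
    and lam: "lam > 1"
  shows "(\<not> series_converges \<delta> \<Psi> lam \<longrightarrow> hausdorff_psi_measure \<psi> \<mu> = 0) \<and>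
         (series_converges \<delta> \<Psi> lam \<longrightarrow> hausdorff_psi_measure \<psi> \<mu> = \<infinity>)"
proof -
  interpret prime_conformal \<mu> \<delta>
    using mu by unfold_locales (simp add: P_def)
  note d = delta_gt_half delta_lt_1
  have psi: "\<psi> r = r powr \<delta> * \<Psi> r" if "r > 0" for r
  proof -
    have "r powr \<delta> * \<Psi> r = (r powr \<delta> * r powr (- \<delta>)) * \<psi> r" by (simp add: \<Psi>_def)
    also have "r powr \<delta> * r powr (- \<delta>) = 1" using that by (simp add: powr_add[symmetric])
    finally show ?thesis by simp
  qed
  have psi_pos: "\<psi> r > 0" if "r > 0" for r
    using dimfun that by (simp add: dimension_function_def)
  have psi_mono: "\<psi> a \<le> \<psi> b" if "0 < a" "a \<le> b" for a b
    using dimfun that unfolding dimension_function_def by (auto intro: mono_onD[of "{0<..}" \<psi>])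
  define L where "L = ln lam"
  have L: "L > 0" using lam by (simp add: L_def)
  have lam_powr: "lam powr (- real k) = exp (- (L * real k))" for k :: nat
    using lam by (simp add: powr_def L_def mult.commute)
  have st: "series_term \<delta> \<Psi> lam k = series_fun \<delta> (\<Psi> (lam powr (- real k)))" if "\<Psi> (lam powr (- real k)) > 1" for k
    using that by (simp add: series_term_def series_fun_def Let_def)
  show ?thesis
  proof (cases "\<exists>Y. \<forall>r. 0 < r \<and> r \<le> 1 \<longrightarrow> \<Psi> r \<le> Y")
    case True
    then obtain Y where Y: "\<And>r. 0 < r \<Longrightarrow> r \<le> 1 \<Longrightarrow> \<Psi> r \<le> Y" by blast
    have "\<not> series_converges \<delta> \<Psi> lam"
    proof
      assume "series_converges \<delta> \<Psi> lam"
      then have ev: "\<forall>\<^sub>F k in sequentially. \<Psi> (lam powr (- real k)) > 1" and sm: "summable (series_term \<delta> \<Psi> lam)"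
        by (auto simp: series_converges_def)
      define c where "c = series_fun \<delta> (max Y 2)"
      have c: "c > 0" unfolding c_def series_fun_def by (intro divide_pos_pos) auto
      have "series_term \<delta> \<Psi> lam \<longlonglongrightarrow> 0" by (rule summable_LIMSEQ_zero[OF sm])
      then have "\<forall>\<^sub>F k in sequentially. series_term \<delta> \<Psi> lam k < c" using c by (rule order_tendstoD)
      then have "\<forall>\<^sub>F k in sequentially. False"
        using ev
      proof eventually_elim
        case (elim k)
        have "lam powr (- real k) \<le> 1" using L unfolding lam_powr by simp
        then have "\<Psi> (lam powr (- real k)) \<le> max Y 2" using Y[of "lam powr (- real k)"] lam by simp
        then have "c \<le> series_fun \<delta> (\<Psi> (lam powr (- real k)))"
          unfolding c_def using elim by (intro series_fun_antimono[OF d]) auto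
        then show False using elim st[of k] by simp
      qed
      then show False by simp
    qed
    moreover have "hausdorff_psi_measure \<psi> \<mu> = 0"
      by (rule hausdorff_zero_of_bounded[OF psi psi_pos psi_mono Y])
    ultimately show ?thesis by blast
  next
    case False
    then have unb1: "\<exists>r. 0 < r \<and> r \<le> 1 \<and> Y < \<Psi> r" for Y by (auto simp: not_le)
    have unb: "\<exists>r>0. Y \<le> \<Psi> r" for Y using unb1[of Y] by (auto intro: less_imp_le)
    have "\<not> mono_on {0<..} \<Psi>"
    proof
      assume m: "mono_on {0<..} \<Psi>"
      obtain r where r: "0 < r" "r \<le> 1" "\<Psi> 1 < \<Psi> r" using unb1 by blast
      then have "\<Psi> r \<le> \<Psi> 1" by (intro mono_onD[OF m]) auto
      then show False using r by simp
    qed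
    then have m: "mono_on {0<..} (\<lambda>r. - \<Psi> r)" using Psi_mono by blast
    have anti: "\<Psi> b \<le> \<Psi> a" if "0 < a" "a \<le> b" for a b
      using mono_onD[OF m, of a b] that by simp
    define u where "u t = series_fun \<delta> (\<Psi> (exp (- t)))" for t
    obtain r0 where r0: "0 < r0" "1 < \<Psi> r0" using unb1[of 1] by blast
    define t0 where "t0 = - ln r0"
    have gt1: "1 < \<Psi> (exp (- t))" if "t0 \<le> t" for t
    proof -
      have "exp (- t) \<le> exp (- t0)" using that by simp
      also have "exp (- t0) = r0" using r0 by (simp add: t0_def)
      finally have "\<Psi> r0 \<le> \<Psi> (exp (- t))" by (intro anti) simp
      then show ?thesis using r0 by linarith
    qed
    have u_anti: "u t \<le> u s" if "t0 \<le> s" "s \<le> t" for s t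
      unfolding u_def using that gt1[of s] by (intro series_fun_antimono[OF d] anti) auto
    have u_nonneg: "u t \<ge> 0" for t by (simp add: u_def)
    obtain k0 :: nat where k0: "t0 / L \<le> real k0" using real_arch_simple by blast
    have Lk: "t0 \<le> L * real k" if "k \<ge> k0" for k
    proof -
      have "t0 / L \<le> real k" using k0 that by linarith
      then show ?thesis using L by (simp add: field_simps)
    qed
    have gtk: "1 < \<Psi> (lam powr (- real k))" if "k \<ge> k0" for k
      unfolding lam_powr by (rule gt1[OF Lk[OF that]])
    have "summable (series_term \<delta> \<Psi> lam) \<longleftrightarrow> summable (\<lambda>k. u (L * real k))"
    proof (rule summable_cong)
      show "\<forall>\<^sub>F k in sequentially. series_term \<delta> \<Psi> lam k = u (L * real k)"
        using eventually_ge_at_top[of k0]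
        by eventually_elim (simp add: st[OF gtk] u_def lam_powr)
    qed
    moreover have "\<forall>\<^sub>F k in sequentially. \<Psi> (lam powr (- real k)) > 1"
      using eventually_ge_at_top[of k0] by eventually_elim (rule gtk)
    ultimately have conv_iff: "series_converges \<delta> \<Psi> lam \<longleftrightarrow> summable (\<lambda>k. u (L * real k))"
      by (simp add: series_converges_def)
    have scale: "summable (\<lambda>k. u (b * real k))" if "summable (\<lambda>k. u (a * real k))" "0 < a" "0 < b" for a b
      by (rule summable_rescale[OF that(2,3) u_nonneg u_anti that(1)])
    show ?thesis
    proof (intro conjI impI)
      assume "\<not> series_converges \<delta> \<Psi> lam"
      then have div: "\<not> summable (\<lambda>n. u (b * real n))" if "b > 0" for b
        using scale[of b L] that L conv_iff by blast
      show "hausdorff_psi_measure \<psi> \<mu> = 0"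
        by (rule hausdorff_zero_of_not_summable[OF psi psi_pos psi_mono anti unb div[unfolded u_def]])
    next
      assume "series_converges \<delta> \<Psi> lam"
      then have "summable (\<lambda>n. u (ln 4 * real n))" using scale[of L "ln 4"] L conv_iff by simp
      moreover have "exp (- (ln 4 * real n)) = (1/4) ^ n" for n
      proof -
        have "exp (- (ln 4 * real n)) = inverse (exp (real n * ln 4))" by (simp add: exp_minus mult.commute)
        also have "exp (real n * ln 4) = exp (ln 4) ^ n" by (rule exp_of_nat_mult)
        finally show ?thesis by (simp add: power_one_over inverse_eq_divide)
      qed
      ultimately have sm: "summable (\<lambda>n. series_fun \<delta> (\<Psi> ((1/4) ^ n)))" by (simp add: u_def)
      show "hausdorff_psi_measure \<psi> \<mu> = \<infinity>"
        by (rule hausdorff_infinite_of_summable[OF psi psi_mono anti unb sm])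
    qed
  qed
qed

end
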